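(* Let $\mathcal{A}=(Q,\delta,\Sigma,s)$ be an NFA. The coarsest forward-stable co-lex (CFS) order $\leq_{FS}$ of $\mathcal{A}$ can be computed in $O(\lvert\delta\rvert^{2})$ time, where $\lvert\delta\rvert$ is the number of transitions of $\mathcal{A}$.
   Context: NFA: a tuple $(Q,\delta,\Sigma,s)$ with finite state set $Q$, finite alphabet $\Sigma$, transition function $\delta:Q\times\Sigma\to 2^Q$ and initial state $s\in Q$ (no set of final states). Standing assumptions: every state is reachable from $s$; $s$ has no incoming edges; every character of $\Sigma$ labels at least one transition. Write $\delta_a(u)=\delta(u,a)$ and $\delta_a(S)=\bigcup_{u\in S}\delta_a(u)$ for $S\subseteq Q$. The set $\Sigma\cup\{\#\}$ ($\#\notin\Sigma$) carries a fixed total order with $\#<a$ for all $a\in\Sigma$. For $u\ne s$, $\lambda(u)\subseteq\Sigma$ is the set of labels of edges entering $u$; $\lambda(s)=\{\#\}$. $\lambda(u)\le\lambda(v)$ means $a\le a'$ for all $a\in\lambda(u)$, $a'\in\lambda(v)$. Forward-stability: for $S,T\subseteq Q$, $S$ is forward-stable w.r.t. $T$ if for every $a\in\Sigma$ either $S\subseteq\delta_a(T)$ or $S\cap\delta_a(T)=\emptyset$. A partition of $Q$ is forward-stable for $\mathcal{A}$ if each part is forward-stable w.r.t. each part. The coarsest forward-stable partition is the unique forward-stable partition of which every forward-stable partition is a refinement (it always exists). Quotient automaton: for an equivalence relation $\sim$ on $Q$, $\mathcal{A}/_\sim=(Q/_\sim,\delta/_\sim,\Sigma,[s]_\sim)$,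 where $[v]_\sim\in\delta/_\sim([u]_\sim,a)$ iff there are $u'\in[u]_\sim$, $v'\in[v]_\sim$ with $v'\in\delta(u',a)$. Co-lex order of $\mathcal{A}$: a partial order $\le$ on $Q$ such that (1) $u<v$ (i.e. $u\le v$ and not $v\le u$) implies $\lambda(u)\le\lambda(v)$; (2) whenever $u\in\delta_a(u')$, $v\in\delta_a(v')$ and $u<v$, then $u'\le v'$. The maximum co-lex order, if it exists, is a co-lex order equal to the union of all co-lex orders. CFS order: let $\sim_{FS}$ be the equivalence on $Q$ whose classes are the parts of the coarsest forward-stable partition for $\mathcal{A}$. The quotient $\mathcal{A}/_{\sim_{FS}}$ always admits a maximum co-lex order $\le$, and the CFS order $\le_{FS}$ is the relation on $Q$ defined by $u\le_{FS}v\iff[u]_{\sim_{FS}}\le[v]_{\sim_{FS}}$. *)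

theory Defs
  imports
    "HOL-Library.Disjoint_Sets"
    "HOL-Library.Landau_Symbols"
    "HOL-Library.Monad_Syntax"
    "HOL-Library.Option_ord"
begin

section \<open>Nondeterministic finite automata\<close>

text \<open>
  Automata have no final states. The values of \<open>trans A u a\<close> are only relevant for
  \<open>u \<in> states A\<close> and \<open>a \<in> alphabet A\<close>.
\<close>

record ('q, 'a) nfa =
  states :: "'q set"
  alphabet :: "'a set"
  trans :: "'q \<Rightarrow> 'a \<Rightarrow> 'q set"
  init :: 'q

definition transitions :: "('q, 'a) nfa \<Rightarrow> ('q \<times> 'a \<times> 'q) set" where
  "transitions A = {(u, a, v). u \<in> states A \<and> a \<in> alphabet A \<and> v \<in> trans A u a}"

definition is_nfa :: "('q, 'a) nfa \<Rightarrow> bool" where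
  "is_nfa A \<longleftrightarrow>
     finite (states A) \<and> finite (alphabet A) \<and> init A \<in> states A \<and>
     (\<forall>u\<in>states A. \<forall>a\<in>alphabet A. trans A u a \<subseteq> states A) \<and>
     (\<forall>u\<in>states A. (init A, u) \<in> {(v, w). \<exists>a. (v, a, w) \<in> transitions A}\<^sup>*) \<and>
     (\<nexists>u a. (u, a, init A) \<in> transitions A) \<and>
     (\<forall>a\<in>alphabet A. \<exists>u v. (u, a, v) \<in> transitions A)"

definition post :: "('q, 'a) nfa \<Rightarrow> 'a \<Rightarrow> 'q set \<Rightarrow> 'q set" where
  "post A a S = (\<Union>u\<in>S. trans A u a)"

text \<open>
  The extra symbol \<open>#\<close> is \<^term>\<open>None\<close>, which is below every \<^term>\<open>Some a\<close> in the
  order on the option type.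
\<close>

definition labels :: "('q, 'a) nfa \<Rightarrow> 'q \<Rightarrow> 'a option set" where
  "labels A u =
     (if u = init A then {None} else Some ` {a. \<exists>w. (w, a, u) \<in> transitions A})"

definition labels_le :: "('q, 'a::linorder) nfa \<Rightarrow> 'q \<Rightarrow> 'q \<Rightarrow> bool" where
  "labels_le A u v \<longleftrightarrow> (\<forall>a\<in>labels A u. \<forall>b\<in>labels A v. a \<le> b)"

section \<open>Forward-stable partitions and quotients\<close>

definition forward_stable_wrt :: "('q, 'a) nfa \<Rightarrow> 'q set \<Rightarrow> 'q set \<Rightarrow> bool" where
  "forward_stable_wrt A S T \<longleftrightarrow>
     (\<forall>a\<in>alphabet A. S \<subseteq> post A a T \<or> S \<inter> post A a T = {})"

definition forward_stable_partition :: "('q, 'a) nfa \<Rightarrow> 'q set set \<Rightarrow> bool" where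
  "forward_stable_partition A P \<longleftrightarrow>
     partition_on (states A) P \<and> (\<forall>S\<in>P. \<forall>T\<in>P. forward_stable_wrt A S T)"

definition coarsest_fs_partition :: "('q, 'a) nfa \<Rightarrow> 'q set set" where
  "coarsest_fs_partition A =
     (THE P. forward_stable_partition A P \<and>
        (\<forall>P'. forward_stable_partition A P' \<longrightarrow> refines (states A) P' P))"

definition fs_equiv :: "('q, 'a) nfa \<Rightarrow> 'q rel" where
  "fs_equiv A = {(u, v). \<exists>S\<in>coarsest_fs_partition A. u \<in> S \<and> v \<in> S}"

definition quotient_nfa :: "('q, 'a) nfa \<Rightarrow> 'q rel \<Rightarrow> ('q set, 'a) nfa" where
  "quotient_nfa A r =
     \<lparr>states = states A // r,
      alphabet = alphabet A,
      trans = (\<lambda>U a. {V \<in> states A // r. \<exists>u\<in>U. \<exists>v\<in>V. v \<in> trans A u a}),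
      init = r `` {init A}\<rparr>"

section \<open>Co-lex orders\<close>

definition colex_order :: "('q, 'a::linorder) nfa \<Rightarrow> 'q rel \<Rightarrow> bool" where
  "colex_order A R \<longleftrightarrow>
     partial_order_on (states A) R \<and>
     (\<forall>u v. (u, v) \<in> R \<and> (v, u) \<notin> R \<longrightarrow> labels_le A u v) \<and>
     (\<forall>a u' u v' v. (u', a, u) \<in> transitions A \<and> (v', a, v) \<in> transitions A \<and>
        (u, v) \<in> R \<and> (v, u) \<notin> R \<longrightarrow> (u', v') \<in> R)"

definition max_colex_order :: "('q, 'a::linorder) nfa \<Rightarrow> 'q rel" where
  "max_colex_order A = (THE R. colex_order A R \<and> R = \<Union>{R'. colex_order A R'})"

definition CFS_order :: "('q, 'a::linorder) nfa \<Rightarrow> 'q rel" where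
  "CFS_order A =
     {(u, v) \<in> states A \<times> states A.
        (fs_equiv A `` {u}, fs_equiv A `` {v})
          \<in> max_colex_order (quotient_nfa A (fs_equiv A))}"

section \<open>A word RAM\<close>

text \<open>
  The machine has registers and a random access memory, both indexed by natural numbers and
  holding machine words, that is, natural numbers below a bound \<open>W\<close> (two to the power of the
  word length). Programs are structured; every operation of an expression and every executed
  command costs one time unit. An operation with a result outside of the word range has no
  value, and a program that attempts one has no execution, so large intermediate results cannot
  be used to save time. Subtraction is truncated at zero.
\<close>

datatype aexp =
    Const nat
  | Reg nat
  | Load aexp
  | Add aexp aexp
  | Sub aexp aexp
  | Mul aexp aexp

datatype bexp =
    Less aexp aexp
  | Equal aexp aexp
  | Not bexp
  | And bexp bexp

datatype com =
    Skip
  | Assign nat aexp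
  | Store aexp aexp
  | Seq com com
  | If bexp com com
  | While bexp com

record machine =
  reg :: "nat \<Rightarrow> nat"
  mem :: "nat \<Rightarrow> nat"

definition fit :: "nat \<Rightarrow> nat \<Rightarrow> nat option" where
  "fit W x = (if x < W then Some x else None)"

fun aval :: "nat \<Rightarrow> aexp \<Rightarrow> machine \<Rightarrow> nat option" where
  "aval W (Const k) \<sigma> = fit W k"
| "aval W (Reg r) \<sigma> = Some (reg \<sigma> r)"
| "aval W (Load e) \<sigma> = do {x \<leftarrow> aval W e \<sigma>; Some (mem \<sigma> x)}"
| "aval W (Add e f) \<sigma> = do {x \<leftarrow> aval W e \<sigma>; y \<leftarrow> aval W f \<sigma>; fit W (x + y)}"
| "aval W (Sub e f) \<sigma> = do {x \<leftarrow> aval W e \<sigma>; y \<leftarrow> aval W f \<sigma>; fit W (x - y)}"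
| "aval W (Mul e f) \<sigma> = do {x \<leftarrow> aval W e \<sigma>; y \<leftarrow> aval W f \<sigma>; fit W (x * y)}"

fun bval :: "nat \<Rightarrow> bexp \<Rightarrow> machine \<Rightarrow> bool option" where
  "bval W (Less e f) \<sigma> = do {x \<leftarrow> aval W e \<sigma>; y \<leftarrow> aval W f \<sigma>; Some (x < y)}"
| "bval W (Equal e f) \<sigma> = do {x \<leftarrow> aval W e \<sigma>; y \<leftarrow> aval W f \<sigma>; Some (x = y)}"
| "bval W (Not b) \<sigma> = do {p \<leftarrow> bval W b \<sigma>; Some (\<not> p)}"
| "bval W (And b c) \<sigma> = do {p \<leftarrow> bval W b \<sigma>; q \<leftarrow> bval W c \<sigma>; Some (p \<and> q)}"

fun acost :: "aexp \<Rightarrow> nat" where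
  "acost (Const k) = 1"
| "acost (Reg r) = 1"
| "acost (Load e) = acost e + 1"
| "acost (Add e f) = acost e + acost f + 1"
| "acost (Sub e f) = acost e + acost f + 1"
| "acost (Mul e f) = acost e + acost f + 1"

fun bcost :: "bexp \<Rightarrow> nat" where
  "bcost (Less e f) = acost e + acost f + 1"
| "bcost (Equal e f) = acost e + acost f + 1"
| "bcost (Not b) = bcost b + 1"
| "bcost (And b c) = bcost b + bcost c + 1"

text \<open>
  \<open>exec W p \<sigma> t \<tau>\<close>: with word bound \<open>W\<close>, program \<open>p\<close> started in \<open>\<sigma>\<close> halts after
  exactly \<open>t\<close> time units in \<open>\<tau>\<close>.
\<close>

inductive exec :: "nat \<Rightarrow> com \<Rightarrow> machine \<Rightarrow> nat \<Rightarrow> machine \<Rightarrow> bool" for W where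
  Skip: "exec W Skip \<sigma> 1 \<sigma>"
| Assign: "aval W e \<sigma> = Some x \<Longrightarrow>
    exec W (Assign r e) \<sigma> (acost e + 1) (\<sigma>\<lparr>reg := (reg \<sigma>)(r := x)\<rparr>)"
| Store: "aval W e \<sigma> = Some i \<Longrightarrow> aval W f \<sigma> = Some x \<Longrightarrow>
    exec W (Store e f) \<sigma> (acost e + acost f + 1) (\<sigma>\<lparr>mem := (mem \<sigma>)(i := x)\<rparr>)"
| Seq: "exec W p \<sigma> t \<sigma>' \<Longrightarrow> exec W q \<sigma>' t' \<sigma>'' \<Longrightarrow>
    exec W (Seq p q) \<sigma> (t + t' + 1) \<sigma>''"
| IfTrue: "bval W b \<sigma> = Some True \<Longrightarrow> exec W p \<sigma> t \<sigma>' \<Longrightarrow>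
    exec W (If b p q) \<sigma> (bcost b + t + 1) \<sigma>'"
| IfFalse: "bval W b \<sigma> = Some False \<Longrightarrow> exec W q \<sigma> t \<sigma>' \<Longrightarrow>
    exec W (If b p q) \<sigma> (bcost b + t + 1) \<sigma>'"
| WhileFalse: "bval W b \<sigma> = Some False \<Longrightarrow>
    exec W (While b p) \<sigma> (bcost b + 1) \<sigma>"
| WhileTrue: "bval W b \<sigma> = Some True \<Longrightarrow> exec W p \<sigma> t \<sigma>' \<Longrightarrow>
    exec W (While b p) \<sigma>' t' \<sigma>'' \<Longrightarrow>
    exec W (While b p) \<sigma> (bcost b + t + t' + 1) \<sigma>''"

inductive_cases exec_SkipE: "exec W Skip \<sigma> t \<tau>"
  and exec_AssignE: "exec W (Assign r e) \<sigma> t \<tau>"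
  and exec_StoreE: "exec W (Store e f) \<sigma> t \<tau>"
  and exec_SeqE: "exec W (Seq p q) \<sigma> t \<tau>"
  and exec_IfE: "exec W (If b p q) \<sigma> t \<tau>"
  and exec_WhileE: "exec W (While b p) \<sigma> t \<tau>"

lemma exec_deterministic:
  "exec W p \<sigma> t \<tau> \<Longrightarrow> exec W p \<sigma> t' \<tau>' \<Longrightarrow> t' = t \<and> \<tau>' = \<tau>"
proof (induction arbitrary: t' \<tau>' rule: exec.induct)
  case (Skip \<sigma>)
  then show ?case by (auto elim: exec_SkipE)
next
  case (Assign e \<sigma> x r)
  from Assign.prems Assign.hyps show ?case by (auto elim: exec_AssignE)
next
  case (Store e \<sigma> i f x)
  from Store.prems Store.hyps show ?case by (auto elim: exec_StoreE)
next
  case (Seq p \<sigma> t \<sigma>' q u \<sigma>'')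
  show ?case
  proof (rule exec_SeqE[OF Seq.prems])
    fix t1 t2 \<rho>
    assume *: "exec W p \<sigma> t1 \<rho>" "exec W q \<rho> t2 \<tau>'" "t' = Suc (t1 + t2)"
    have 1: "t1 = t \<and> \<rho> = \<sigma>'" by (rule Seq.IH(1)[OF *(1)])
    then have "exec W q \<sigma>' t2 \<tau>'" using *(2) by blast
    from Seq.IH(2)[OF this] 1 *(3) show ?thesis by presburger
  qed
next
  case (IfTrue b \<sigma> p t \<sigma>' q)
  from IfTrue.prems IfTrue.hyps(1) obtain t1 where
    *: "exec W p \<sigma> t1 \<tau>'" "t' = bcost b + t1 + 1"
    by (elim exec_IfE) simp_all
  then show ?case using IfTrue.IH[OF *(1)] by simp
next
  case (IfFalse b \<sigma> q t \<sigma>' p)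
  from IfFalse.prems IfFalse.hyps(1) obtain t1 where
    *: "exec W q \<sigma> t1 \<tau>'" "t' = bcost b + t1 + 1"
    by (elim exec_IfE) simp_all
  then show ?case using IfFalse.IH[OF *(1)] by simp
next
  case (WhileFalse b \<sigma> p)
  from WhileFalse.prems show ?case by (rule exec_WhileE) (simp_all add: WhileFalse.hyps)
next
  case (WhileTrue b \<sigma> p t \<sigma>' u \<sigma>'')
  show ?case
  proof (rule exec_WhileE[OF WhileTrue.prems])
    assume "bval W b \<sigma> = Some False"
    then show ?thesis using WhileTrue.hyps(1) by simp
  next
    fix t1 t2 \<rho>
    assume *: "exec W p \<sigma> t1 \<rho>" "exec W (While b p) \<rho> t2 \<tau>'"
      "t' = Suc (bcost b + t1 + t2)"
    have 1: "t1 = t \<and> \<rho> = \<sigma>'" by (rule WhileTrue.IH(1)[OF *(1)])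
    then have "exec W (While b p) \<sigma>' t2 \<tau>'" using *(2) by blast
    from WhileTrue.IH(2)[OF this] 1 *(3) show ?thesis by presburger
  qed
qed

section \<open>Representation of inputs and outputs\<close>

text \<open>
  States are numbered \<open>0, \<dots>, |Q| - 1\<close> by \<open>\<nu>\<close>, in any way, and the transitions are listed in
  any order. The letters are natural numbers, ordered as such, and represent themselves.
\<close>

definition encodes :: "('q \<Rightarrow> nat) \<Rightarrow> (nat \<times> nat \<times> nat) list \<Rightarrow> ('q, nat) nfa \<Rightarrow> bool" where
  "encodes \<nu> ts A \<longleftrightarrow>
     bij_betw \<nu> (states A) {..<card (states A)} \<and>
     distinct ts \<and> set ts = (\<lambda>(u, a, v). (\<nu> u, a, \<nu> v)) ` transitions A"

text \<open>
  The machine starts with the number of states, the number of transitions and the initial state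
  in registers 0, 1 and 2 and with the transitions in consecutive memory cells, three cells per
  transition. Everything else is zero.
\<close>

definition input_machine :: "('q \<Rightarrow> nat) \<Rightarrow> (nat \<times> nat \<times> nat) list \<Rightarrow> ('q, nat) nfa \<Rightarrow> machine" where
  "input_machine \<nu> ts A =
     (let cells = concat (map (\<lambda>(i, a, j). [i, a, j]) ts) in
      \<lparr>reg = (\<lambda>_. 0)(0 := card (states A), 1 := length ts, 2 := \<nu> (init A)),
       mem = (\<lambda>i. if i < length cells then cells ! i else 0)\<rparr>)"

text \<open>
  The output is the Boolean matrix of a relation on the states, stored row by row from the
  address in register 0 on.
\<close>

definition output_relation :: "('q \<Rightarrow> nat) \<Rightarrow> ('q, nat) nfa \<Rightarrow> machine \<Rightarrow> 'q rel \<Rightarrow> bool" where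
  "output_relation \<nu> A \<tau> R \<longleftrightarrow>
     (\<forall>u\<in>states A. \<forall>v\<in>states A.
        mem \<tau> (reg \<tau> 0 + \<nu> u * card (states A) + \<nu> v) = of_bool ((u, v) \<in> R))"

end

theory Submission
  imports Defs
begin

text \<open>
  Call two states distinguished if this follows from the rule: a transition into one of them has a
  letter such that all transitions with this letter into the other start at states distinguished
  from its source. The coarsest forward-stable partition identifies exactly the states that are
  not distinguished, because the complement of this relation is the largest equivalence that
  satisfies the back-and-forth condition expressed by forward stability. A distinguished pair
  violates the CFS order if its labels are in the wrong order or if two transitions with the same
  letter lead to it from a pair that violates the order. In the quotient, the complement of this
  second relation is transitive, and it is antisymmetric since its symmetric part is again forward
  stable; being the largest relation that satisfies the two co-lex axioms, it is the maximum
  co-lex order.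

  Both relations are least fixed points of monotone rules, which together form one AND-OR graph
  with quadratically many nodes and edges in the number of transitions. Its reachable nodes are
  found in linear time with counters and a stack. Since every state but the initial one has an
  incoming transition, the number of states is at most one more than the number of transitions.
\<close>

section \<open>The order as the complement of a least fixed point\<close>

text \<open>Being indistinguishable is bisimilarity of the reversed automaton. Working with the
  negation makes both layers inductive: closure properties become inductions on derivations, and the
  derivations are what the search finds. A letter that enters one state but not the other makes the
  premise vacuous, which is the base case. Transitivity of a complement reads as cotransitivity:
  \<open>R u v\<close> implies \<open>R u y\<close> or \<open>R y v\<close>.

  The delicate point is antisymmetry. If neither of two distinguished states is excluded against the
  other, each label set bounds the other, so both consist of one common letter; only this makes the
  back-and-forth condition available for such pairs.

  For quadratic time, conjunctions are indexed by a transition and a state instead of by two states: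
  a conjunction then runs over the transitions into that state with the given letter, so every pair
  of transitions contributes a bounded number of edges in the whole graph.\<close>

inductive distinguished :: "('q, 'a) nfa \<Rightarrow> 'q \<Rightarrow> 'q \<Rightarrow> bool" for A where
  left: "(u, a, w) \<in> transitions A \<Longrightarrow> z \<in> states A \<Longrightarrow>
    (\<And>v. (v, a, z) \<in> transitions A \<Longrightarrow> distinguished A u v) \<Longrightarrow> distinguished A w z"
| right: "(u, a, w) \<in> transitions A \<Longrightarrow> z \<in> states A \<Longrightarrow>
    (\<And>v. (v, a, z) \<in> transitions A \<Longrightarrow> distinguished A v u) \<Longrightarrow> distinguished A z w"

text \<open>Both rules require a distinguished pair because the co-lex axioms restrict strict pairs
  only, and in the quotient a class is always below itself.\<close>

inductive excluded :: "('q, 'a::linorder) nfa \<Rightarrow> 'q \<Rightarrow> 'q \<Rightarrow> bool" for A where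
  labels: "distinguished A w z \<Longrightarrow> \<not> labels_le A w z \<Longrightarrow> excluded A w z"
| step: "distinguished A w z \<Longrightarrow> (u, a, w) \<in> transitions A \<Longrightarrow> (v, a, z) \<in> transitions A \<Longrightarrow>
    excluded A u v \<Longrightarrow> excluded A w z"

text \<open>Equivalences that are bisimulations for reversed edges; one direction of matching
  suffices because the relation is symmetric.\<close>

definition stable_rel :: "('q, 'a) nfa \<Rightarrow> 'q rel \<Rightarrow> bool" where
  "stable_rel A r \<longleftrightarrow> equiv (states A) r \<and>
     (\<forall>x y u a. (x, y) \<in> r \<and> (u, a, x) \<in> transitions A \<longrightarrow>
        (\<exists>v. (v, a, y) \<in> transitions A \<and> (u, v) \<in> r))"

section \<open>Distinguished states and the coarsest forward-stable partition\<close>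

lemma transitions_states:
  assumes "is_nfa A" "(u, a, v) \<in> transitions A"
  shows "u \<in> states A" "v \<in> states A" "a \<in> alphabet A"
  using assms by (auto simp: is_nfa_def transitions_def)

lemma finite_transitions:
  assumes "is_nfa A"
  shows "finite (transitions A)"
proof (rule finite_subset)
  show "transitions A \<subseteq> states A \<times> alphabet A \<times> states A"
    using transitions_states[OF assms] by auto
  show "finite (states A \<times> alphabet A \<times> states A)"
    using assms by (simp add: is_nfa_def)
qed

lemma no_transition_to_init: "is_nfa A \<Longrightarrow> (u, a, init A) \<notin> transitions A"
  by (auto simp: is_nfa_def)

lemma ex_transition_to:
  assumes "is_nfa A" "v \<in> states A" "v \<noteq> init A"
  obtains u a where "(u, a, v) \<in> transitions A"
proof -
  have "(init A, v) \<in> {(v, w). \<exists>a. (v, a, w) \<in> transitions A}\<^sup>*"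
    using assms by (auto simp: is_nfa_def)
  then show ?thesis using assms(3) that by (cases rule: rtranclE) auto
qed

lemma distinguished_states:
  assumes "is_nfa A" "distinguished A u v"
  shows "u \<in> states A \<and> v \<in> states A"
  using assms(2) by cases (use transitions_states[OF assms(1)] in auto)

lemma distinguished_sym: "distinguished A u v \<Longrightarrow> distinguished A v u"
  by (induction rule: distinguished.induct)
    (blast intro: distinguished.left distinguished.right)+

text \<open>A related pair would have to match the transition named by the last rule from a related
  source, which the induction hypothesis forbids. Hence the complement contains every stable
  relation.\<close>

lemma distinguished_not_stable:
  assumes "stable_rel A r" "distinguished A u v"
  shows "(u, v) \<notin> r"
proof -
  have eq: "equiv (states A) r"
    and st: "\<And>x y u a. (x, y) \<in> r \<Longrightarrow> (u, a, x) \<in> transitions A \<Longrightarrow>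
        \<exists>v. (v, a, y) \<in> transitions A \<and> (u, v) \<in> r"
    using assms(1) by (auto simp: stable_rel_def)
  have sym: "\<And>x y. (x, y) \<in> r \<Longrightarrow> (y, x) \<in> r"
    using eq by (meson equivE symD)
  show ?thesis
    using assms(2) by (induction rule: distinguished.induct) (use st sym in blast)+
qed

lemma distinguished_irrefl:
  assumes "distinguished A u v"
  shows "u \<noteq> v"
  using assms by (induction rule: distinguished.induct) auto

text \<open>This is transitivity of the complement, proved by induction on the derivation with the
  intermediate state left arbitrary.\<close>

lemma distinguished_cotrans:
  assumes "distinguished A u v" "y \<in> states A" "is_nfa A"
  shows "distinguished A u y \<or> distinguished A y v"
  using assms(1,2)
proof (induction arbitrary: y rule: distinguished.induct)
  case (left u a w z)
  show ?case
  proof (rule ccontr)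
    assume *: "\<not> ?thesis"
    \<comment> \<open>As \<open>y\<close> is not distinguished from \<open>w\<close>, some source
      \<open>y'\<close> matches \<open>u\<close>; the induction hypothesis then passes every
      difference between \<open>u\<close> and \<open>v\<close> on to \<open>y'\<close> and
      \<open>v\<close>.\<close>
    then obtain y' where y': "(y', a, y) \<in> transitions A" "\<not> distinguished A u y'"
      using distinguished.left[OF left.hyps(1) left.prems] by blast
    then have "distinguished A y' v" if "(v, a, z) \<in> transitions A" for v
      using left.IH[OF that] transitions_states(1)[OF assms(3) y'(1)] by blast
    then have "distinguished A y z" using distinguished.left[OF y'(1) left.hyps(2)] by blast
    then show False using * by blast
  qed
next
  case (right u a w z)
  show ?case
  proof (rule ccontr)
    assume *: "\<not> ?thesis"
    then obtain y' where y': "(y', a, y) \<in> transitions A" "\<not> distinguished A y' u"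
      using distinguished.right[OF right.hyps(1) right.prems] by blast
    then have "distinguished A v y'" if "(v, a, z) \<in> transitions A" for v
      using right.IH[OF that] transitions_states(1)[OF assms(3) y'(1)] by blast
    then have "distinguished A z y" using distinguished.right[OF y'(1) right.hyps(2)] by blast
    then show False using * by blast
  qed
qed

definition indistinct :: "('q, 'a) nfa \<Rightarrow> 'q rel" where
  "indistinct A = {(u, v) \<in> states A \<times> states A. \<not> distinguished A u v}"

lemma stable_indistinct:
  assumes "is_nfa A"
  shows "stable_rel A (indistinct A)"
  unfolding stable_rel_def
proof (intro conjI allI impI)
  show "equiv (states A) (indistinct A)"
  proof (rule equivI)
    show "indistinct A \<subseteq> states A \<times> states A" by (auto simp: indistinct_def)
    show "refl_on (states A) (indistinct A)"
      using distinguished_irrefl by (fastforce simp: refl_on_def indistinct_def)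
    show "sym (indistinct A)"
      using distinguished_sym by (fastforce simp: sym_def indistinct_def)
    show "Relation.trans (indistinct A)"
      using distinguished_cotrans[OF _ _ assms] by (fastforce simp: Relation.trans_def indistinct_def)
  qed
  fix x y u a
  assume "(x, y) \<in> indistinct A \<and> (u, a, x) \<in> transitions A"
  then show "\<exists>v. (v, a, y) \<in> transitions A \<and> (u, v) \<in> indistinct A"
    using distinguished.left[of u a x A y] transitions_states[OF assms]
    by (auto simp: indistinct_def)
qed

text \<open>If one member of a class has an \<open>a\<close>-predecessor in \<open>T\<close>,
  stability gives every other member an equivalent \<open>a\<close>-predecessor, which again lies in
  the class \<open>T\<close>.\<close>

lemma stable_rel_forward_stable:
  assumes "is_nfa A" "stable_rel A r"
  shows "forward_stable_partition A (states A // r)"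
proof -
  have eq: "equiv (states A) r"
    and st: "\<And>x y u a. (x, y) \<in> r \<Longrightarrow> (u, a, x) \<in> transitions A \<Longrightarrow>
        \<exists>v. (v, a, y) \<in> transitions A \<and> (u, v) \<in> r"
    using assms(2) by (auto simp: stable_rel_def)
  have "S \<subseteq> post A a T"
    if S: "S \<in> states A // r" and T: "T \<in> states A // r" and a: "a \<in> alphabet A"
      and x: "x \<in> S" "x \<in> post A a T" for S T a x
  proof
    fix y assume "y \<in> S"
    then have "(x, y) \<in> r" using quotient_eq_iff[OF eq S S x(1)] by simp
    from x(2) obtain u where u: "u \<in> T" "x \<in> trans A u a" by (auto simp: post_def)
    then have "(u, a, x) \<in> transitions A"
      using T a in_quotient_imp_subset[OF eq T] by (auto simp: transitions_def)
    from st[OF \<open>(x, y) \<in> r\<close> this] obtain v where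
      v: "(v, a, y) \<in> transitions A" "(u, v) \<in> r" by blast
    then have "v \<in> T" using in_quotient_imp_closed[OF eq T u(1)] by simp
    then show "y \<in> post A a T" using v by (auto simp: post_def transitions_def)
  qed
  then show ?thesis
    unfolding forward_stable_partition_def forward_stable_wrt_def
    using partition_on_quotient[OF eq] by blast
qed

lemma forward_stable_stable_rel:
  assumes "is_nfa A" "forward_stable_partition A P"
  shows "stable_rel A {(u, v). \<exists>S\<in>P. u \<in> S \<and> v \<in> S}" (is "stable_rel A ?r")
  unfolding stable_rel_def
proof (intro conjI allI impI)
  have part: "partition_on (states A) P" using assms by (simp add: forward_stable_partition_def)
  then show "equiv (states A) ?r" by (rule equiv_partition_on)
  fix x y u a
  assume *: "(x, y) \<in> ?r \<and> (u, a, x) \<in> transitions A"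
  then obtain S where S: "S \<in> P" "x \<in> S" "y \<in> S" by blast
  have u: "u \<in> states A" "a \<in> alphabet A" "x \<in> trans A u a" using * by (auto simp: transitions_def)
  then obtain T where T: "T \<in> P" "u \<in> T" using part by (auto simp: partition_on_def)
  then have "x \<in> post A a T" using u by (auto simp: post_def)
  then have "S \<subseteq> post A a T"
    using assms(2) S T u(2) unfolding forward_stable_partition_def forward_stable_wrt_def by blast
  then obtain v where "v \<in> T" "y \<in> trans A v a" using S by (auto simp: post_def)
  then show "\<exists>v. (v, a, y) \<in> transitions A \<and> (u, v) \<in> ?r"
    using T u part by (auto simp: transitions_def partition_on_def)
qed

text \<open>Stable equivalences and forward-stable partitions translate into each other, so the
  largest of the former is the coarsest of the latter; antisymmetry of refinement makes the
  description by \<open>THE\<close> unique.\<close>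

lemma fs_equiv_eq:
  assumes "is_nfa A"
  shows "fs_equiv A = indistinct A"
proof -
  let ?P = "states A // indistinct A"
  have eq: "equiv (states A) (indistinct A)"
    using stable_indistinct[OF assms] by (simp add: stable_rel_def)
  have fs: "forward_stable_partition A ?P"
    by (rule stable_rel_forward_stable[OF assms stable_indistinct[OF assms]])
  have coarse: "refines (states A) P' ?P" if P': "forward_stable_partition A P'" for P'
    unfolding refines_def
  proof (intro conjI ballI)
    show part: "partition_on (states A) P'" "partition_on (states A) ?P"
      using P' fs by (simp_all add: forward_stable_partition_def)
    fix X assume X: "X \<in> P'"
    then obtain x where x: "x \<in> X" using part(1) by (fastforce simp: partition_on_def)
    have sub: "X \<subseteq> states A" using X part(1) by (auto simp: partition_on_def)
    have "X \<subseteq> indistinct A `` {x}"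
      using distinguished_not_stable[OF forward_stable_stable_rel[OF assms P'], of x] X x sub
      by (fastforce simp: indistinct_def)
    then show "\<exists>Y\<in>?P. X \<subseteq> Y" using x sub by (auto intro: quotientI)
  qed
  have "coarsest_fs_partition A = ?P"
    unfolding coarsest_fs_partition_def
    by (rule the_equality) (use fs coarse refines_asym in blast)+
  moreover have "(u, v) \<in> indistinct A \<longleftrightarrow> (\<exists>S\<in>?P. u \<in> S \<and> v \<in> S)" for u v
  proof
    assume uv: "(u, v) \<in> indistinct A"
    then have "u \<in> states A" by (simp add: indistinct_def)
    then show "\<exists>S\<in>?P. u \<in> S \<and> v \<in> S"
      using uv equiv_class_self[OF eq] by (intro bexI[of _ "indistinct A `` {u}"]) (auto intro: quotientI)
  qed (use quotient_eq_iff[OF eq] in blast)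
  ultimately show ?thesis unfolding fs_equiv_def by auto
qed

lemma fs_equiv_equiv: "is_nfa A \<Longrightarrow> equiv (states A) (fs_equiv A)"
  using stable_indistinct by (auto simp: fs_equiv_eq stable_rel_def)

lemma fs_equivD:
  assumes "is_nfa A" "(x, y) \<in> fs_equiv A" "(u, a, x) \<in> transitions A"
  obtains v where "(v, a, y) \<in> transitions A" "(u, v) \<in> fs_equiv A"
  using stable_indistinct[OF assms(1)] assms that unfolding fs_equiv_eq[OF assms(1)] stable_rel_def
  by blast

lemma fs_equiv_iff:
  "is_nfa A \<Longrightarrow> (u, v) \<in> fs_equiv A \<longleftrightarrow> u \<in> states A \<and> v \<in> states A \<and> \<not> distinguished A u v"
  by (simp add: fs_equiv_eq indistinct_def)

text \<open>Any other state has an incoming transition, and stability would carry it over to the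
  initial state.\<close>

lemma fs_equiv_init:
  assumes "is_nfa A" "(u, init A) \<in> fs_equiv A"
  shows "u = init A"
  using assms by (metis ex_transition_to fs_equivD fs_equiv_iff no_transition_to_init)

lemma fs_equiv_sym: "is_nfa A \<Longrightarrow> (u, v) \<in> fs_equiv A \<Longrightarrow> (v, u) \<in> fs_equiv A"
  using fs_equiv_equiv by (meson equivE symD)

lemma labels_fs_equiv:
  assumes "is_nfa A" "(u, v) \<in> fs_equiv A"
  shows "labels A u = labels A v"
proof -
  have *: "labels A u \<subseteq> labels A v" if "(u, v) \<in> fs_equiv A" for u v
  proof (cases "u = init A \<or> v = init A")
    case True
    then have "u = v" using fs_equiv_init[OF assms(1)] fs_equiv_sym[OF assms(1)] that by metis
    then show ?thesis by simp
  next
    case False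
    then show ?thesis using fs_equivD[OF assms(1) that] by (auto simp: labels_def) blast
  qed
  show ?thesis using *[OF assms(2)] *[OF fs_equiv_sym[OF assms]] by blast
qed

lemma labels_nonempty:
  assumes "is_nfa A" "u \<in> states A"
  shows "labels A u \<noteq> {}"
proof (cases "u = init A")
  case False
  then obtain w a where "(w, a, u) \<in> transitions A" using ex_transition_to[OF assms] by blast
  then show ?thesis using False by (auto simp: labels_def)
qed (simp add: labels_def)

lemma labels_transition: "is_nfa A \<Longrightarrow> (u, a, v) \<in> transitions A \<Longrightarrow> Some a \<in> labels A v"
  using no_transition_to_init[of A u a] by (auto simp: labels_def)

section \<open>Exclusion as a relation between classes\<close>

lemma excluded_distinguished: "excluded A u v \<Longrightarrow> distinguished A u v"
  by (induction rule: excluded.induct)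

lemma excluded_states:
  "is_nfa A \<Longrightarrow> excluded A u v \<Longrightarrow> u \<in> states A \<and> v \<in> states A"
  using excluded_distinguished distinguished_states by metis

lemma distinguished_fs_equiv:
  assumes "is_nfa A" "distinguished A u v" "(u, u') \<in> fs_equiv A" "(v, v') \<in> fs_equiv A"
  shows "distinguished A u' v'"
proof -
  have st: "u' \<in> states A" "v' \<in> states A" "\<not> distinguished A u u'" "\<not> distinguished A v' v"
    using assms(3,4) by (auto simp: fs_equiv_iff[OF assms(1)] dest: distinguished_sym)
  then have "distinguished A u' v"
    using distinguished_cotrans[OF assms(2) st(1) assms(1)] by blast
  then show ?thesis
    using distinguished_cotrans[OF _ st(2) assms(1)] st(4) by blast
qed

text \<open>Makes exclusion independent of representatives. In the rule \<open>step\<close>,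
  stability supplies transitions with the same letter into the new representatives, from sources
  equivalent to the old ones.\<close>

lemma excluded_fs_equiv:
  assumes "is_nfa A" "excluded A u v" "(u, u') \<in> fs_equiv A" "(v, v') \<in> fs_equiv A"
  shows "excluded A u' v'"
  using assms(2-)
proof (induction arbitrary: u' v' rule: excluded.induct)
  case (labels w z)
  have "\<not> labels_le A u' v'"
    using labels.hyps(2) labels.prems[THEN labels_fs_equiv[OF assms(1)]] by (simp add: labels_le_def)
  then show ?case
    by (rule excluded.labels[OF distinguished_fs_equiv[OF assms(1) labels.hyps(1) labels.prems]])
next
  case (step w z u a v)
  obtain u1 where u1: "(u1, a, u') \<in> transitions A" "(u, u1) \<in> fs_equiv A"
    using fs_equivD[OF assms(1) step.prems(1) step.hyps(2)] .
  obtain v1 where v1: "(v1, a, v') \<in> transitions A" "(v, v1) \<in> fs_equiv A"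
    using fs_equivD[OF assms(1) step.prems(2) step.hyps(3)] .
  show ?case
    using excluded.step[OF _ u1(1) v1(1) step.IH[OF u1(2) v1(2)]]
      distinguished_fs_equiv[OF assms(1) step.hyps(1) step.prems] by blast
qed

text \<open>The label set of \<open>y\<close> is nonempty and squeezed between \<open>Some a\<close>
  and \<open>Some a\<close>, so \<open>y\<close> has an incoming \<open>a\<close>-transition. This
  lets arguments about \<open>w\<close> and \<open>z\<close> pass through a state in the
  middle.\<close>

lemma labels_le_between:
  assumes "is_nfa A" "labels_le A w y" "labels_le A y z" "y \<in> states A"
    "(u, a, w) \<in> transitions A" "(v, a, z) \<in> transitions A"
  obtains x where "(x, a, y) \<in> transitions A"
proof -
  obtain b where b: "b \<in> labels A y" using labels_nonempty[OF assms(1,4)] by blast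
  have "Some a \<le> b" "b \<le> Some a"
    using assms b labels_transition[OF assms(1)] by (auto simp: labels_le_def)
  then have "b = Some a" by simp
  then show ?thesis using b that by (auto simp: labels_def split: if_splits)
qed

text \<open>An intermediate state excluded on neither side respects the labels on both, so it has a
  transition with the letter used by \<open>step\<close>, and the induction hypothesis applies to
  its source.\<close>

lemma excluded_cotrans:
  assumes "is_nfa A" "excluded A u v" "y \<in> states A"
  shows "excluded A u y \<or> excluded A y v"
  using assms(2,3)
proof (induction arbitrary: y rule: excluded.induct)
  case (labels w z)
  have ex: "excluded A w z" by (rule excluded.labels[OF labels.hyps])
  have st: "w \<in> states A" "z \<in> states A" using excluded_states[OF assms(1) ex] by auto
  show ?case
  proof (rule ccontr)
    assume *: "\<not> ?thesis"
    \<comment> \<open>Otherwise \<open>y\<close> lies in the class of \<open>w\<close>, and the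
      exclusion of \<open>w\<close> against \<open>z\<close> would transfer to \<open>y\<close>
      against \<open>z\<close>.\<close>
    have "distinguished A w y"
      using excluded_fs_equiv[OF assms(1) ex, of y z] * st labels.prems
        distinguished_irrefl[of A z z] by (auto simp: fs_equiv_iff[OF assms(1)])
    moreover have "distinguished A y z"
      using excluded_fs_equiv[OF assms(1) ex, of w y] * st labels.prems
        distinguished_irrefl[of A w w] distinguished_sym[of A z y]
      by (auto simp: fs_equiv_iff[OF assms(1)])
    ultimately have "labels_le A w y" "labels_le A y z"
      using * by (auto intro: excluded.labels)
    moreover obtain b where "b \<in> labels A y" using labels_nonempty[OF assms(1) labels.prems] by blast
    ultimately have "labels_le A w z" unfolding labels_le_def by (meson order_trans)
    then show False using labels.hyps by simp
  qed
next
  case (step w z u a v)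
  have ex: "excluded A w z" by (rule excluded.step[OF step.hyps])
  have st: "w \<in> states A" "z \<in> states A" using excluded_states[OF assms(1) ex] by auto
  show ?case
  proof (rule ccontr)
    assume *: "\<not> ?thesis"
    have d: "distinguished A w y"
      using excluded_fs_equiv[OF assms(1) ex, of y z] * st step.prems
        distinguished_irrefl[of A z z] by (auto simp: fs_equiv_iff[OF assms(1)])
    have d': "distinguished A y z"
      using excluded_fs_equiv[OF assms(1) ex, of w y] * st step.prems
        distinguished_irrefl[of A w w] distinguished_sym[of A z y]
      by (auto simp: fs_equiv_iff[OF assms(1)])
    have "labels_le A w y" "labels_le A y z"
      using * d d' by (auto intro: excluded.labels)
    then obtain x where x: "(x, a, y) \<in> transitions A"
      using labels_le_between[OF assms(1) _ _ step.prems step.hyps(2,3)] by blast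
    then have "excluded A u x \<or> excluded A x v"
      using step.IH transitions_states(1)[OF assms(1)] by blast
    then show False
      using * excluded.step[OF d step.hyps(2) x] excluded.step[OF d' x step.hyps(3)] by blast
  qed
qed

text \<open>The pairs excluded in neither direction form a stable relation, and a stable relation
  contains no distinguished pair. So any two different classes are comparable in at most one
  direction.\<close>

lemma excluded_total:
  assumes "is_nfa A" "distinguished A u v"
  shows "excluded A u v \<or> excluded A v u"
proof -
  let ?E = "{(u, v) \<in> states A \<times> states A. \<not> excluded A u v \<and> \<not> excluded A v u}"
  have "stable_rel A ?E"
    unfolding stable_rel_def
  proof (intro conjI allI impI)
    show "equiv (states A) ?E"
    proof (rule equivI)
      show "refl_on (states A) ?E"
        using excluded_distinguished distinguished_irrefl by (fastforce simp: refl_on_def)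
      show "sym ?E" by (auto simp: sym_def)
      show "Relation.trans ?E" using excluded_cotrans[OF assms(1)] by (fastforce simp: Relation.trans_def)
    qed auto
    fix x y u a
    assume *: "(x, y) \<in> ?E \<and> (u, a, x) \<in> transitions A"
    show "\<exists>v. (v, a, y) \<in> transitions A \<and> (u, v) \<in> ?E"
    proof (cases "distinguished A x y")
      case False
      then have "(x, y) \<in> fs_equiv A" using * by (auto simp: fs_equiv_iff[OF assms(1)])
      then obtain v where "(v, a, y) \<in> transitions A" "(u, v) \<in> fs_equiv A"
        using fs_equivD[OF assms(1)] * by blast
      then show ?thesis
        using excluded_distinguished[of A] distinguished_sym[of A]
        by (auto simp: fs_equiv_iff[OF assms(1)])
    next
      case True
      \<comment> \<open>Each label set bounds the other, so \<open>y\<close> has a transition with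
        the letter of the given one into \<open>x\<close>. Reading \<open>step\<close> backwards in
        both directions shows that the two sources are not excluded either.\<close>
      then have "labels_le A x y" "labels_le A y x"
        using * by (auto intro: excluded.labels dest: distinguished_sym)
      then obtain v where v: "(v, a, y) \<in> transitions A"
        using labels_le_between[OF assms(1)] * by blast
      then show ?thesis
        using * excluded.step[OF True, of u a v] excluded.step[OF distinguished_sym[OF True], of v a u]
          transitions_states(1)[OF assms(1)] by blast
    qed
  qed
  from distinguished_not_stable[OF this assms(2)] show ?thesis
    using distinguished_states[OF assms] by blast
qed

section \<open>The maximum co-lex order of the quotient\<close>

context
  fixes A :: "('q, 'a::linorder) nfa"
  assumes nfa: "is_nfa A"
begin

lemma fs_class_eq_iff:
  "u \<in> states A \<Longrightarrow> v \<in> states A \<Longrightarrow>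
    fs_equiv A `` {u} = fs_equiv A `` {v} \<longleftrightarrow> (u, v) \<in> fs_equiv A"
  using eq_equiv_class_iff[OF fs_equiv_equiv[OF nfa]] by simp

text \<open>Stability allows the representative of the target class to be chosen freely; only the
  source class has to be matched by some predecessor.\<close>

lemma quotient_transitions_iff:
  assumes "v \<in> states A"
  shows "(U, a, fs_equiv A `` {v}) \<in> transitions (quotient_nfa A (fs_equiv A)) \<longleftrightarrow>
    (\<exists>u. (u, a, v) \<in> transitions A \<and> U = fs_equiv A `` {u})" (is "?L \<longleftrightarrow> ?R")
proof
  let ?r = "fs_equiv A"
  have eq: "equiv (states A) ?r" by (rule fs_equiv_equiv[OF nfa])
  {
    assume ?L
    then obtain x y where xy: "U \<in> states A // ?r" "a \<in> alphabet A" "x \<in> U" "(v, y) \<in> ?r"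
      "y \<in> trans A x a"
      by (auto simp: transitions_def quotient_nfa_def)
    have x: "x \<in> states A" using xy in_quotient_imp_subset[OF eq] by blast
    then have "(x, a, y) \<in> transitions A" using xy by (simp add: transitions_def)
    then obtain u where u: "(u, a, v) \<in> transitions A" "(x, u) \<in> ?r"
      using fs_equivD[OF nfa fs_equiv_sym[OF nfa xy(4)]] by blast
    have "u \<in> states A" using u transitions_states[OF nfa] by blast
    have "U = ?r `` {x}"
      using xy(1,3) eq by (metis Image_singleton_iff equiv_class_eq quotientE)
    also have "\<dots> = ?r `` {u}" using u(2) by (rule equiv_class_eq[OF eq])
    finally show ?R using u(1) by blast
  next
    assume ?R
    then obtain u where u: "(u, a, v) \<in> transitions A" "U = ?r `` {u}" by blast
    have "u \<in> states A" "a \<in> alphabet A" using u transitions_states[OF nfa] by blast+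
    moreover have "v \<in> trans A u a" using u(1) by (simp add: transitions_def)
    ultimately show ?L
      using u assms equiv_class_self[OF eq]
      by (auto simp: transitions_def quotient_nfa_def intro!: quotientI)
  }
qed

lemma quotient_labels:
  assumes "u \<in> states A"
  shows "labels (quotient_nfa A (fs_equiv A)) (fs_equiv A `` {u}) = labels A u"
proof -
  have "init A \<in> states A" using nfa by (simp add: is_nfa_def)
  then have "fs_equiv A `` {u} = fs_equiv A `` {init A} \<longleftrightarrow> u = init A"
    using fs_class_eq_iff[OF assms] fs_equiv_init[OF nfa] by blast
  then show ?thesis
    unfolding labels_def using quotient_transitions_iff[OF assms]
    by (auto simp: quotient_nfa_def)
qed

lemma quotient_labels_le:
  assumes "u \<in> states A" "v \<in> states A"
  shows "labels_le (quotient_nfa A (fs_equiv A)) (fs_equiv A `` {u}) (fs_equiv A `` {v}) \<longleftrightarrow>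
    labels_le A u v"
  by (simp add: labels_le_def quotient_labels assms)

definition quotient_order :: "'q set rel" where
  "quotient_order = {(fs_equiv A `` {u}, fs_equiv A `` {v}) | u v.
     u \<in> states A \<and> v \<in> states A \<and> \<not> excluded A u v}"

lemma quotient_order_iff:
  assumes "u \<in> states A" "v \<in> states A"
  shows "(fs_equiv A `` {u}, fs_equiv A `` {v}) \<in> quotient_order \<longleftrightarrow> \<not> excluded A u v"
proof
  assume "(fs_equiv A `` {u}, fs_equiv A `` {v}) \<in> quotient_order"
  then obtain u' v' where *: "fs_equiv A `` {u} = fs_equiv A `` {u'}"
    "fs_equiv A `` {v} = fs_equiv A `` {v'}" "u' \<in> states A" "v' \<in> states A" "\<not> excluded A u' v'"
    by (auto simp: quotient_order_def)
  then have "(u, u') \<in> fs_equiv A" "(v, v') \<in> fs_equiv A"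
    using fs_class_eq_iff assms by blast+
  then show "\<not> excluded A u v" using excluded_fs_equiv[OF nfa, of u v u' v'] * by blast
qed (use assms in \<open>auto simp: quotient_order_def\<close>)

text \<open>A strict pair of classes comes from a distinguished pair of states, by totality of
  exclusion or directly from the missing converse. This is the premise of both exclusion rules,
  whose contrapositives are the two axioms.\<close>

lemma colex_quotient_order: "colex_order (quotient_nfa A (fs_equiv A)) quotient_order"
  unfolding colex_order_def
proof (intro conjI allI impI)
  let ?B = "quotient_nfa A (fs_equiv A)" and ?c = "\<lambda>u. fs_equiv A `` {u}"
  have st: "states ?B = ?c ` states A" by (auto simp: quotient_nfa_def quotient_def)
  have dist: "distinguished A u v" if "(?c u, ?c v) \<notin> quotient_order" "u \<in> states A" "v \<in> states A"
    for u v using that quotient_order_iff[of u v] excluded_distinguished[of A u v] by simp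
  have strict: "\<exists>u v. U = ?c u \<and> V = ?c v \<and> u \<in> states A \<and> v \<in> states A \<and>
      \<not> excluded A u v \<and> distinguished A u v"
    if UV: "(U, V) \<in> quotient_order \<and> (V, U) \<notin> quotient_order" for U V
  proof -
    from UV obtain u v where *: "U = ?c u" "V = ?c v" "u \<in> states A" "v \<in> states A" "\<not> excluded A u v"
      unfolding quotient_order_def by blast
    then have "distinguished A v u" using UV dist[of v u] by simp
    then show ?thesis using * distinguished_sym[of A v u] by blast
  qed
  show "partial_order_on (states ?B) quotient_order"
    unfolding partial_order_on_def preorder_on_def
  proof (intro conjI)
    show "quotient_order \<subseteq> states ?B \<times> states ?B"
      unfolding st by (auto simp: quotient_order_def)
    show "refl_on (states ?B) quotient_order"
    proof (unfold st refl_on_def, intro ballI)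
      fix U assume "U \<in> ?c ` states A"
      then obtain u where "U = ?c u" "u \<in> states A" by blast
      then show "(U, U) \<in> quotient_order"
        using quotient_order_iff[of u u] excluded_distinguished[of A u u] distinguished_irrefl[of A u u]
        by auto
    qed
    show "Relation.trans quotient_order"
    proof (rule transI)
      fix U V W
      assume UV: "(U, V) \<in> quotient_order" and VW: "(V, W) \<in> quotient_order"
      obtain u v where u: "U = ?c u" "u \<in> states A" "V = ?c v" "v \<in> states A"
        using UV by (auto simp: quotient_order_def)
      obtain w where w: "W = ?c w" "w \<in> states A"
        using VW by (auto simp: quotient_order_def)
      have "\<not> excluded A u v" "\<not> excluded A v w"
        using UV VW u w by (simp_all add: quotient_order_iff)
      then have "\<not> excluded A u w" using excluded_cotrans[OF nfa _ u(4)] by blast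
      then show "(U, W) \<in> quotient_order" using u w by (simp add: quotient_order_iff)
    qed
    show "antisym quotient_order"
    proof (rule antisymI)
      fix U V
      assume UV: "(U, V) \<in> quotient_order" and VU: "(V, U) \<in> quotient_order"
      obtain u v where u: "U = ?c u" "u \<in> states A" "V = ?c v" "v \<in> states A"
        using UV by (auto simp: quotient_order_def)
      have "\<not> excluded A u v" "\<not> excluded A v u"
        using UV VU u by (simp_all add: quotient_order_iff)
      then have "\<not> distinguished A u v" using excluded_total[OF nfa] by blast
      then show "U = V" using u fs_class_eq_iff fs_equiv_iff[OF nfa] by blast
    qed
  qed
  show "labels_le ?B U V" if "(U, V) \<in> quotient_order \<and> (V, U) \<notin> quotient_order" for U V
  proof -
    from strict[OF that] obtain u v where *: "U = ?c u" "V = ?c v" "u \<in> states A" "v \<in> states A"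
      "\<not> excluded A u v" "distinguished A u v" by blast
    then have "labels_le A u v" using excluded.labels[of A u v] by blast
    then show ?thesis using * by (simp add: quotient_labels_le)
  qed
  fix a U' U V' V
  assume *: "(U', a, U) \<in> transitions ?B \<and> (V', a, V) \<in> transitions ?B \<and>
    (U, V) \<in> quotient_order \<and> (V, U) \<notin> quotient_order"
  then obtain u v where uv: "U = ?c u" "V = ?c v" "u \<in> states A" "v \<in> states A"
    "\<not> excluded A u v" "distinguished A u v" using strict by blast
  obtain u' v' where uv': "(u', a, u) \<in> transitions A" "U' = ?c u'"
    "(v', a, v) \<in> transitions A" "V' = ?c v'"
    using * uv quotient_transitions_iff[of u U' a] quotient_transitions_iff[of v V' a] by blast
  then have "\<not> excluded A u' v'" using excluded.step[OF uv(6)] uv(5) by blast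
  then show "(U', V') \<in> quotient_order"
    using uv' quotient_order_iff[of u' v'] transitions_states(1)[OF nfa] by simp
qed

text \<open>Induction on exclusion: antisymmetry makes a related pair of different classes strict,
  so the axioms force the labels into order and relate the predecessors, against the rule applied
  last.\<close>

lemma colex_order_le_quotient_order:
  assumes "colex_order (quotient_nfa A (fs_equiv A)) R"
  shows "R \<subseteq> quotient_order"
proof -
  let ?B = "quotient_nfa A (fs_equiv A)" and ?c = "\<lambda>u. fs_equiv A `` {u}"
  have st: "states ?B = ?c ` states A" by (auto simp: quotient_nfa_def quotient_def)
  have po: "R \<subseteq> states ?B \<times> states ?B" "antisym R"
    using assms by (auto simp: colex_order_def partial_order_on_def preorder_on_def)
  have lab: "\<And>U V. (U, V) \<in> R \<Longrightarrow> (V, U) \<notin> R \<Longrightarrow> labels_le ?B U V"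
    and stp: "\<And>U' a U V' V. (U', a, U) \<in> transitions ?B \<Longrightarrow> (V', a, V) \<in> transitions ?B \<Longrightarrow>
        (U, V) \<in> R \<Longrightarrow> (V, U) \<notin> R \<Longrightarrow> (U', V') \<in> R"
    using assms unfolding colex_order_def by blast+
  have strict: "(?c v, ?c u) \<notin> R" if "distinguished A u v" "(?c u, ?c v) \<in> R" for u v
  proof
    assume "(?c v, ?c u) \<in> R"
    then have "?c u = ?c v" using that po(2) by (auto dest: antisymD)
    then show False
      using that fs_class_eq_iff distinguished_states[OF nfa that(1)] fs_equiv_iff[OF nfa] by blast
  qed
  have "(?c u, ?c v) \<notin> R" if "excluded A u v" for u v
    using that
  proof (induction rule: excluded.induct)
    case (labels w z)
    then show ?case
      using strict lab quotient_labels_le distinguished_states[OF nfa labels.hyps(1)] by blast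
  next
    case (step w z u a v)
    have "w \<in> states A" "z \<in> states A" using distinguished_states[OF nfa step.hyps(1)] by auto
    then have "(?c u, a, ?c w) \<in> transitions ?B" "(?c v, a, ?c z) \<in> transitions ?B"
      using step.hyps quotient_transitions_iff by blast+
    then show ?case using stp strict[OF step.hyps(1)] step.IH by blast
  qed
  then show ?thesis using po(1) unfolding st quotient_order_def by fastforce
qed

lemma max_colex_quotient: "max_colex_order (quotient_nfa A (fs_equiv A)) = quotient_order"
  unfolding max_colex_order_def
proof (rule the_equality)
  show "colex_order (quotient_nfa A (fs_equiv A)) quotient_order \<and>
    quotient_order = \<Union> {R. colex_order (quotient_nfa A (fs_equiv A)) R}"
    using colex_quotient_order colex_order_le_quotient_order by blast
  then show "R = quotient_order" if "colex_order (quotient_nfa A (fs_equiv A)) R \<and>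
    R = \<Union> {R. colex_order (quotient_nfa A (fs_equiv A)) R}" for R
    using that by simp
qed

theorem CFS_order_eq: "CFS_order A = {(u, v) \<in> states A \<times> states A. \<not> excluded A u v}"
  by (auto simp: CFS_order_def max_colex_quotient quotient_order_iff)

end

section \<open>Timed weakest preconditions\<close>

text \<open>Total correctness with time: the existence of an execution is asserted, so termination
  and all word-range checks are part of it.\<close>

definition wp :: "nat \<Rightarrow> com \<Rightarrow> machine \<Rightarrow> (nat \<Rightarrow> machine \<Rightarrow> bool) \<Rightarrow> bool" where
  "wp W c \<sigma> Q \<longleftrightarrow> (\<exists>t \<tau>. exec W c \<sigma> t \<tau> \<and> Q t \<tau>)"

lemma wp_mono: "wp W c \<sigma> Q \<Longrightarrow> (\<And>t \<tau>. Q t \<tau> \<Longrightarrow> R t \<tau>) \<Longrightarrow> wp W c \<sigma> R"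
  by (auto simp: wp_def)

lemma wp_Skip: "Q 1 \<sigma> \<Longrightarrow> wp W Skip \<sigma> Q"
  unfolding wp_def by (blast intro: exec.Skip)

lemma wp_Assign:
  "aval W e \<sigma> = Some x \<Longrightarrow> Q (acost e + 1) (\<sigma>\<lparr>reg := (reg \<sigma>)(r := x)\<rparr>) \<Longrightarrow> wp W (Assign r e) \<sigma> Q"
  unfolding wp_def by (blast intro: exec.Assign)

lemma wp_Store:
  "aval W e \<sigma> = Some i \<Longrightarrow> aval W f \<sigma> = Some x \<Longrightarrow>
    Q (acost e + acost f + 1) (\<sigma>\<lparr>mem := (mem \<sigma>)(i := x)\<rparr>) \<Longrightarrow> wp W (Store e f) \<sigma> Q"
  unfolding wp_def by (blast intro: exec.Store)

lemma wp_Seq: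
  "wp W p \<sigma> (\<lambda>t \<sigma>'. wp W q \<sigma>' (\<lambda>t' \<tau>. Q (t + t' + 1) \<tau>)) \<Longrightarrow> wp W (Seq p q) \<sigma> Q"
  unfolding wp_def by (blast intro: exec.Seq)

lemma wp_If:
  "bval W b \<sigma> = Some x \<Longrightarrow> wp W (if x then p else q) \<sigma> (\<lambda>t. Q (bcost b + t + 1)) \<Longrightarrow>
    wp W (If b p q) \<sigma> Q"
  unfolding wp_def
  by (cases x) (use exec.IfTrue exec.IfFalse in \<open>metis (mono_tags, lifting)\<close>)+

abbreviation seq :: "com \<Rightarrow> com \<Rightarrow> com" (infixr ";;" 60) where
  "p ;; q \<equiv> Seq p q"

lemma wp_If_le:
  assumes "bval W b \<sigma> = Some x" "wp W (if x then p else q) \<sigma> (\<lambda>t \<tau>. t \<le> k \<and> R \<tau>)"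
    "bcost b + k + 1 \<le> k'"
  shows "wp W (If b p q) \<sigma> (\<lambda>t \<tau>. t \<le> k' \<and> R \<tau>)"
  by (rule wp_If[OF assms(1)], rule wp_mono[OF assms(2)]) (use assms(3) in linarith)

lemma wp_Seq_le:
  assumes "wp W p \<sigma> (\<lambda>t \<tau>. t \<le> k1 \<and> R \<tau>)" "\<And>\<tau>. R \<tau> \<Longrightarrow> wp W q \<tau> (\<lambda>t \<rho>. t \<le> k2 \<and> S \<rho>)"
    "k1 + k2 + 1 \<le> k"
  shows "wp W (Seq p q) \<sigma> (\<lambda>t \<tau>. t \<le> k \<and> S \<tau>)"
  by (rule wp_Seq, rule wp_mono[OF assms(1)], elim conjE, rule wp_mono[OF assms(2)])
    (use assms(3) in linarith)+

lemma wp_le_mono: "wp W c \<sigma> (\<lambda>t \<tau>. t \<le> k \<and> R \<tau>) \<Longrightarrow> k \<le> k' \<Longrightarrow> (\<And>\<tau>. R \<tau> \<Longrightarrow> S \<tau>) \<Longrightarrow>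
    wp W c \<sigma> (\<lambda>t \<tau>. t \<le> k' \<and> S \<tau>)"
  by (erule wp_mono) auto

text \<open>The budget \<open>k\<close> is threaded through straight-line code:
  \<open>acost e + 1\<close> for the assignment and one unit for \<open>Seq\<close>. The side
  condition keeps the subtraction exact.\<close>

lemma wp_Assign_Seq:
  assumes "aval W e \<sigma> = Some x" "acost e + 2 \<le> k"
    "wp W q (\<sigma>\<lparr>reg := (reg \<sigma>)(r := x)\<rparr>) (\<lambda>t \<tau>. t \<le> k - (acost e + 2) \<and> R \<tau>)"
  shows "wp W (Assign r e ;; q) \<sigma> (\<lambda>t \<tau>. t \<le> k \<and> R \<tau>)"
  by (rule wp_Seq, rule wp_Assign[OF assms(1)], rule wp_mono[OF assms(3)]) (use assms(2) in auto)

lemma wp_Store_Seq: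
  assumes "aval W e \<sigma> = Some i" "aval W f \<sigma> = Some x" "acost e + acost f + 2 \<le> k"
    "wp W q (\<sigma>\<lparr>mem := (mem \<sigma>)(i := x)\<rparr>) (\<lambda>t \<tau>. t \<le> k - (acost e + acost f + 2) \<and> R \<tau>)"
  shows "wp W (Store e f ;; q) \<sigma> (\<lambda>t \<tau>. t \<le> k \<and> R \<tau>)"
  by (rule wp_Seq, rule wp_Store[OF assms(1,2)], rule wp_mono[OF assms(4)]) (use assms(3) in auto)

text \<open>The ghost value \<open>g\<close> carries a potential \<open>\<Phi> g\<close> that pays for the remaining iterations.\<close>

lemma wp_While:
  assumes "I g \<sigma>"
    and step: "\<And>g \<sigma>. I g \<sigma> \<Longrightarrow> \<exists>x. bval W b \<sigma> = Some x \<and>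
      (if x then wp W c \<sigma> (\<lambda>t \<tau>. \<exists>g'. I g' \<tau> \<and> t + bcost b + 1 + \<Phi> g' \<le> \<Phi> g) else Q \<sigma>)"
  shows "wp W (While b c) \<sigma> (\<lambda>t \<tau>. Q \<tau> \<and> t \<le> \<Phi> g + bcost b + 1)"
  using assms(1)
\<comment> \<open>Every round costs at least one unit, so the potential decreases strictly.\<close>
proof (induction "\<Phi> g" arbitrary: g \<sigma> rule: less_induct)
  case less
  from step[OF less.prems] obtain x where x: "bval W b \<sigma> = Some x"
    "if x then wp W c \<sigma> (\<lambda>t \<tau>. \<exists>g'. I g' \<tau> \<and> t + bcost b + 1 + \<Phi> g' \<le> \<Phi> g) else Q \<sigma>" by blast
  show ?case
  proof (cases x)
    case False
    then show ?thesis using x unfolding wp_def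
      by (auto intro!: exI[of _ "bcost b + 1"] exI[of _ \<sigma>] exec.WhileFalse)
  next
    case True
    then obtain t \<tau> g' where 1: "exec W c \<sigma> t \<tau>" "I g' \<tau>" "t + bcost b + 1 + \<Phi> g' \<le> \<Phi> g"
      using x(2) by (auto simp: wp_def)
    then obtain t' \<rho> where 2: "exec W (While b c) \<tau> t' \<rho>" "Q \<rho>" "t' \<le> \<Phi> g' + bcost b + 1"
      using less.hyps[of g' \<tau>] by (auto simp: wp_def)
    have "exec W (While b c) \<sigma> (bcost b + t + t' + 1) \<rho>"
      using exec.WhileTrue[OF _ 1(1) 2(1)] x(1) True by simp
    then show ?thesis using 1(3) 2 unfolding wp_def by fastforce
  qed
qed

definition For :: "nat \<Rightarrow> nat \<Rightarrow> com \<Rightarrow> com" where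
  "For r l c = (Assign r (Const 0) ;;
     While (Less (Reg r) (Reg l)) (c ;; Assign r (Add (Reg r) (Const 1))))"

lemma fit_Some [simp]: "x < W \<Longrightarrow> fit W x = Some x"
  by (simp add: fit_def)

text \<open>A round adds 9 units to the body: 4 for the test, 4 for the increment and 1 for
  \<open>Seq\<close>. The 7 units cover the initial assignment with its \<open>Seq\<close> and the
  failing test.\<close>

lemma wp_For:
  assumes N: "N < W"
    and init: "I 0 (\<sigma>\<lparr>reg := (reg \<sigma>)(r := 0)\<rparr>)"
    and limit: "\<And>i \<sigma>. I i \<sigma> \<Longrightarrow> reg \<sigma> l = N"
    and body: "\<And>i \<sigma>. I i \<sigma> \<Longrightarrow> i < N \<Longrightarrow> reg \<sigma> r = i \<Longrightarrow>
      wp W c \<sigma> (\<lambda>t \<tau>. t \<le> k \<and> reg \<tau> r = i \<and> I (Suc i) (\<tau>\<lparr>reg := (reg \<tau>)(r := Suc i)\<rparr>))"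
  shows "wp W (For r l c) \<sigma> (\<lambda>t \<tau>. I N \<tau> \<and> t \<le> (k + 9) * N + 7)"
proof -
  let ?b = "Less (Reg r) (Reg l)"
  let ?I = "\<lambda>i \<sigma>. I i \<sigma> \<and> i \<le> N \<and> reg \<sigma> r = i"
  let ?\<sigma> = "\<sigma>\<lparr>reg := (reg \<sigma>)(r := 0)\<rparr>"
  have "wp W (While ?b (c ;; Assign r (Add (Reg r) (Const 1)))) ?\<sigma>
    (\<lambda>t \<tau>. I N \<tau> \<and> t \<le> (k + 9) * (N - 0) + bcost ?b + 1)"
  proof (rule wp_While[where I = ?I and \<Phi> = "\<lambda>i. (k + 9) * (N - i)"])
    show "?I 0 ?\<sigma>" using init by simp
    fix i \<sigma> assume I: "?I i \<sigma>"
    show "\<exists>x. bval W ?b \<sigma> = Some x \<and>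
      (if x then wp W (c ;; Assign r (Add (Reg r) (Const 1))) \<sigma>
         (\<lambda>t \<tau>. \<exists>g'. ?I g' \<tau> \<and> t + bcost ?b + 1 + (k + 9) * (N - g') \<le> (k + 9) * (N - i))
       else I N \<sigma>)"
    proof (cases "i < N")
      case False
      then show ?thesis using I limit[of i \<sigma>] by auto
    next
      case True
      have eq: "(k + 9) * (N - i) = (k + 9) * (N - Suc i) + (k + 9)"
        using True by (metis Suc_diff_Suc mult_Suc_right add.commute)
      have "wp W (c ;; Assign r (Add (Reg r) (Const 1))) \<sigma>
         (\<lambda>t \<tau>. \<exists>g'. ?I g' \<tau> \<and> t + bcost ?b + 1 + (k + 9) * (N - g') \<le> (k + 9) * (N - i))"
        by (rule wp_Seq, rule wp_mono[OF body[of i]])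
          (use I True N eq in \<open>auto intro!: wp_Assign exI[of _ "Suc i"]\<close>)
      then show ?thesis using I True limit[of i \<sigma>] by auto
    qed
  qed
  then show ?thesis unfolding For_def
    using N by (auto intro!: wp_Seq wp_Assign elim!: wp_mono)
qed

section \<open>Linked adjacency lists in memory\<close>

text \<open>Five infinite arrays are interleaved in memory from address \<open>B\<close> on: the heads of the
  adjacency lists, the links, the targets, the counters, and the stack.\<close>

definition cell :: "nat \<Rightarrow> nat \<Rightarrow> nat \<Rightarrow> nat" where
  "cell B j i = B + j + 5 * i"

lemma cell_eq_iff [simp]:
  assumes "j < 5" "j' < 5"
  shows "cell B j i = cell B j' i' \<longleftrightarrow> j = j' \<and> i = i'"
proof
  assume "cell B j i = cell B j' i'"
  then have eq: "j + 5 * i = j' + 5 * i'" by (simp add: cell_def)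
  have "j = (j + 5 * i) mod 5" using assms by simp
  also have "\<dots> = j'" unfolding eq using assms by simp
  finally show "j = j' \<and> i = i'" using eq by simp
qed simp

lemma cell_neq [simp]: "i < B \<Longrightarrow> cell B j k \<noteq> i"
  by (simp add: cell_def)

lemma cell_neq' [simp]: "i < B \<Longrightarrow> i \<noteq> cell B j k"
  by (simp add: cell_def)

definition arr :: "nat \<Rightarrow> (nat \<Rightarrow> nat) \<Rightarrow> nat \<Rightarrow> nat \<Rightarrow> nat" where
  "arr B \<mu> j i = \<mu> (cell B j i)"

lemma arr_upd [simp]:
  "j < 5 \<Longrightarrow> j' < 5 \<Longrightarrow> arr B (\<mu>(cell B j i := v)) j' =
    (if j = j' then (arr B \<mu> j)(i := v) else arr B \<mu> j')"
  by (auto simp: arr_def fun_eq_iff)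

definition addr :: "nat \<Rightarrow> aexp \<Rightarrow> aexp" where
  "addr j e = Add (Add (Reg 3) (Const j)) (Mul (Const 5) e)"

lemma acost_addr [simp]: "acost (addr j e) = acost e + 6"
  by (simp add: addr_def)

lemma aval_addr:
  assumes "aval W e \<sigma> = Some i" "reg \<sigma> 3 = B" "j < 5" "B + 5 * i + 5 < W"
  shows "aval W (addr j e) \<sigma> = Some (cell B j i)"
  using assms by (simp add: addr_def cell_def)

lemma aval_Load: "aval W e \<sigma> = Some i \<Longrightarrow> aval W (Load e) \<sigma> = Some (mem \<sigma> i)"
  by simp

text \<open>Index 0 is the null link and records start at 1, so zeroed memory already holds empty
  lists. The bound \<open>k\<close> on the records in use makes writing record \<open>k\<close>
  harmless.\<close>

fun chain :: "nat \<Rightarrow> (nat \<Rightarrow> nat) \<Rightarrow> (nat \<Rightarrow> nat) \<Rightarrow> nat \<Rightarrow> nat list \<Rightarrow> bool" where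
  "chain k nxt tgt i [] \<longleftrightarrow> i = 0"
| "chain k nxt tgt i (y # ys) \<longleftrightarrow> 0 < i \<and> i < k \<and> tgt i = y \<and> chain k nxt tgt (nxt i) ys"

lemma chain_extend: "chain k nxt tgt i ys \<Longrightarrow> chain (Suc k) (nxt(k := a)) (tgt(k := b)) i ys"
  by (induction ys arbitrary: i) auto

definition succs :: "(nat \<times> nat) list \<Rightarrow> nat \<Rightarrow> nat list" where
  "succs es x = map snd (filter (\<lambda>e. fst e = x) es)"

lemma succs_Cons [simp]: "succs ((x, y) # es) z = (if x = z then y # succs es z else succs es z)"
  by (simp add: succs_def)

definition adjacency :: "nat \<Rightarrow> (nat \<times> nat) list \<Rightarrow> machine \<Rightarrow> bool" where
  "adjacency B es \<sigma> \<longleftrightarrow>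
     (\<forall>x. chain (Suc (length es)) (arr B (mem \<sigma>) 1) (arr B (mem \<sigma>) 2) (arr B (mem \<sigma>) 0 x) (succs es x))"

text \<open>The record becomes the new head of its list. This takes constant time and corresponds to
  a \<open>Cons\<close> on the list of edges.\<close>

definition add_edge :: com where
  "add_edge =
     (Store (addr 2 (Reg 4)) (Reg 6) ;;
      Store (addr 1 (Reg 4)) (Load (addr 0 (Reg 5))) ;;
      Store (addr 0 (Reg 5)) (Reg 4) ;;
      Assign 4 (Add (Reg 4) (Const 1)))"

definition incr :: com where
  "incr = Store (addr 3 (Reg 6)) (Add (Load (addr 3 (Reg 6))) (Const 1))"

lemma wp_add_edge:
  assumes "reg \<sigma> 3 = B" "reg \<sigma> 4 = Suc (length es)" "adjacency B es \<sigma>"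
    "reg \<sigma> 5 \<le> M" "length es < M" "B + 5 * M + 5 < W"
    and Q: "\<And>\<tau>. reg \<tau> = (reg \<sigma>)(4 := Suc (Suc (length es))) \<Longrightarrow>
      adjacency B ((reg \<sigma> 5, reg \<sigma> 6) # es) \<tau> \<Longrightarrow> arr B (mem \<tau>) 3 = arr B (mem \<sigma>) 3 \<Longrightarrow>
      arr B (mem \<tau>) 4 = arr B (mem \<sigma>) 4 \<Longrightarrow> (\<And>i. i < B \<Longrightarrow> mem \<tau> i = mem \<sigma> i) \<Longrightarrow> Q 41 \<tau>"
  shows "wp W add_edge \<sigma> Q"
  unfolding add_edge_def
  apply (rule wp_Seq wp_Store wp_Assign aval_addr aval_Load | (use assms in \<open>simp; fail\<close>))+
  apply simp
  apply (rule Q)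
      apply (simp add: assms)
     apply (use assms(3) in \<open>auto simp: adjacency_def assms chain_extend arr_def[symmetric]\<close>)[1]
    apply simp_all
  done

section \<open>Threshold reachability\<close>

definition hits :: "(nat \<times> nat) list \<Rightarrow> nat set \<Rightarrow> nat \<Rightarrow> nat" where
  "hits es X y = length (filter (\<lambda>e. fst e \<in> X \<and> snd e = y) es)"

text \<open>One shape for both kinds of node: the in-degree as threshold gives a conjunction, the
  threshold 1 a disjunction. Edges are counted with multiplicity, so repeated edges do no
  harm.\<close>

definition threshold_closed :: "nat \<Rightarrow> (nat \<Rightarrow> nat) \<Rightarrow> (nat \<times> nat) list \<Rightarrow> nat set \<Rightarrow> bool" where
  "threshold_closed K th es X \<longleftrightarrow> (\<forall>y<K. th y \<le> hits es X y \<longrightarrow> y \<in> X)"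

lemma hits_empty [simp]: "hits es {} y = 0"
  by (simp add: hits_def)

lemma hits_mono: "X \<subseteq> Y \<Longrightarrow> hits es X y \<le> hits es Y y"
  unfolding hits_def by (induction es) auto

lemma hits_insert:
  "x \<notin> X \<Longrightarrow> hits es (insert x X) y = hits es X y + length (filter ((=) y) (succs es x))"
  unfolding hits_def succs_def by (induction es) auto

text \<open>Each edge lies in the list of a single source; this is the amortisation behind the
  linear time of the search.\<close>

lemma sum_length_succs: "(\<Sum>x<k. length (succs es x)) \<le> length es"
proof (induction es)
  case (Cons e es)
  have "(\<Sum>x<k. length (succs (e # es) x)) =
      (\<Sum>x<k. length (succs es x)) + (\<Sum>x<k. if x = fst e then 1 else 0)"
    by (subst sum.distrib[symmetric], rule sum.cong) (auto simp: succs_def)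
  also have "(\<Sum>x<k. if x = fst e then 1 else 0 :: nat) \<le> 1" by simp
  finally show ?case using Cons.IH by simp
qed (simp add: succs_def)

definition stack_at :: "nat \<Rightarrow> nat list \<Rightarrow> machine \<Rightarrow> bool" where
  "stack_at B st \<sigma> \<longleftrightarrow> reg \<sigma> 12 = length st \<and> (\<forall>i<length st. arr B (mem \<sigma>) 4 i = st ! i)"

definition push :: "nat \<Rightarrow> com" where
  "push r = (Store (addr 4 (Reg 12)) (Reg r) ;; Assign 12 (Add (Reg 12) (Const 1)))"

lemma wp_push:
  assumes "stack_at B st \<sigma>" "reg \<sigma> 3 = B" "length st < M" "B + 5 * M + 5 < W"
    and Q: "\<And>\<tau>. reg \<tau> = (reg \<sigma>)(12 := Suc (length st)) \<Longrightarrow> stack_at B (st @ [reg \<sigma> r]) \<tau> \<Longrightarrow>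
      (\<And>j. j < 4 \<Longrightarrow> arr B (mem \<tau>) j = arr B (mem \<sigma>) j) \<Longrightarrow> Q 14 \<tau>"
  shows "wp W (push r) \<sigma> Q"
  unfolding push_def
  apply (rule wp_Seq wp_Store wp_Assign aval_addr aval_Load |
      (use assms in \<open>simp add: stack_at_def; fail\<close>))+
  apply simp
  apply (rule Q)
    apply (use assms in \<open>auto simp: stack_at_def nth_append\<close>)
  done

definition push_initial :: com where
  "push_initial =
     For 5 11 (If (Equal (Load (addr 3 (Reg 5))) (Const 0)) (push 5) Skip)"

text \<open>A node is pushed exactly when its counter is about to fall from one to zero, hence at
  most once. Truncated subtraction leaves the counters of reached nodes at zero.\<close>

definition relax :: com where
  "relax =
     (Assign 6 (Load (addr 2 (Reg 19))) ;;
      If (Equal (Load (addr 3 (Reg 6))) (Const 1)) (push 6) Skip ;;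
      Store (addr 3 (Reg 6)) (Sub (Load (addr 3 (Reg 6))) (Const 1)) ;;
      Assign 19 (Load (addr 1 (Reg 19))))"

definition pop :: com where
  "pop =
     (Assign 12 (Sub (Reg 12) (Const 1)) ;;
      Assign 19 (Load (addr 0 (Load (addr 4 (Reg 12))))))"

definition reach_com :: com where
  "reach_com = (push_initial ;;
     While (Less (Const 0) (Reg 12)) (pop ;; While (Not (Equal (Reg 19) (Const 0))) relax))"

text \<open>Lists are fixed during the search; only counters and stack change. \<open>fr\<close>
  records the values of the registers that must survive it.\<close>

locale reach =
  fixes W B M K :: nat and th :: "nat \<Rightarrow> nat" and es :: "(nat \<times> nat) list" and nxt tgt first :: "nat \<Rightarrow> nat"
    and fr :: "nat \<Rightarrow> nat"
  assumes targets: "\<And>x y. (x, y) \<in> set es \<Longrightarrow> y < K"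
    and chains: "\<And>x. chain (Suc (length es)) nxt tgt (first x) (succs es x)"
    and bounds: "K \<le> M" "length es < M" "B + 5 * M + 5 < W"
    and th_less: "\<And>y. th y < W"
    and frame: "fr 3 = B" "fr 11 = K"
begin

definition base :: "machine \<Rightarrow> bool" where
  "base \<sigma> \<longleftrightarrow> (\<forall>r\<in>{0, 3, 9, 11}. reg \<sigma> r = fr r) \<and>
     arr B (mem \<sigma>) 0 = first \<and> arr B (mem \<sigma>) 1 = nxt \<and> arr B (mem \<sigma>) 2 = tgt"

text \<open>\<open>D\<close> is the set of reached nodes that have left the stack; \<open>cnt\<close> counts down.\<close>

definition sound :: "nat set \<Rightarrow> nat list \<Rightarrow> (nat \<Rightarrow> nat) \<Rightarrow> bool" where
  "sound D st cnt \<longleftrightarrow> distinct st \<and> D \<union> set st \<subseteq> {..<K} \<and> D \<inter> set st = {} \<and>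
     (\<forall>y<K. cnt y = 0 \<longleftrightarrow> y \<in> D \<union> set st) \<and>
     (\<forall>X. threshold_closed K th es X \<longrightarrow> D \<union> set st \<subseteq> X)"

lemma length_stack:
  assumes "distinct st" "set st \<subseteq> {..<K}"
  shows "length st \<le> K"
  using card_mono[OF _ assms(2)] distinct_card[OF assms(1)] by simp

lemma length_stack_less:
  assumes "distinct st" "set st \<subseteq> {..<K}" "y \<notin> set st" "y < K"
  shows "length st < K"
  using length_stack[of "y # st"] assms by simp

lemma wp_push_initial:
  assumes "base \<sigma>" "arr B (mem \<sigma>) 3 = th" "reg \<sigma> 12 = 0"
  shows "wp W push_initial \<sigma> (\<lambda>t \<tau>.
    (\<exists>st. base \<tau> \<and> stack_at B st \<tau> \<and> arr B (mem \<tau>) 3 = th \<and> sound {} st th) \<and> t \<le> 41 * K + 7)"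
proof -
  let ?I = "\<lambda>i \<sigma>. \<exists>st. base \<sigma> \<and> stack_at B st \<sigma> \<and> arr B (mem \<sigma>) 3 = th \<and>
    distinct st \<and> set st = {y. y < i \<and> th y = 0}"
  have "wp W push_initial \<sigma> (\<lambda>t \<tau>. ?I K \<tau> \<and> t \<le> (32 + 9) * K + 7)"
    unfolding push_initial_def
  proof (rule wp_For)
    show "K < W" using bounds by simp
    show "?I 0 (\<sigma>\<lparr>reg := (reg \<sigma>)(5 := 0)\<rparr>)"
      using assms by (auto simp: base_def stack_at_def)
    show "reg \<sigma> 11 = K" if "?I i \<sigma>" for i \<sigma> using that frame by (auto simp: base_def)
    fix i \<sigma> assume "?I i \<sigma>" and i: "i < K" "reg \<sigma> 5 = i"
    then obtain st where st: "base \<sigma>" "stack_at B st \<sigma>" "arr B (mem \<sigma>) 3 = th" "distinct st"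
      "set st = {y. y < i \<and> th y = 0}" by blast
    have len: "length st < M"
    proof -
      have "set st \<subseteq> {..<K}" "i \<notin> set st" unfolding st(5) using i(1) by auto
      from length_stack_less[OF st(4) this i(1)] show ?thesis using bounds(1) by simp
    qed
    have B: "reg \<sigma> 3 = B" using st frame by (simp add: base_def)
    have b: "bval W (Equal (Load (addr 3 (Reg 5))) (Const 0)) \<sigma> = Some (th i = 0)"
    proof -
      have "aval W (addr 3 (Reg 5)) \<sigma> = Some (cell B 3 i)"
        by (rule aval_addr) (use B i bounds in auto)
      moreover have "mem \<sigma> (cell B 3 i) = th i" using st(3) by (auto simp: arr_def fun_eq_iff)
      ultimately show ?thesis using bounds by simp
    qed
    have "wp W (if th i = 0 then push 5 else Skip) \<sigma> (\<lambda>t \<tau>. t \<le> 15 \<and> reg \<tau> 5 = i \<and>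
       ?I (Suc i) (\<tau>\<lparr>reg := (reg \<tau>)(5 := Suc i)\<rparr>))"
    proof (cases "th i = 0")
      case True
      have "wp W (push 5) \<sigma> (\<lambda>t \<tau>. t \<le> 15 \<and> reg \<tau> 5 = i \<and>
         ?I (Suc i) (\<tau>\<lparr>reg := (reg \<tau>)(5 := Suc i)\<rparr>))"
      proof (rule wp_push[OF st(2) B len bounds(3)])
        fix \<tau>
        assume \<tau>: "reg \<tau> = (reg \<sigma>)(12 := Suc (length st))" "stack_at B (st @ [reg \<sigma> 5]) \<tau>"
          "\<And>j. j < 4 \<Longrightarrow> arr B (mem \<tau>) j = arr B (mem \<sigma>) j"
        have "base (\<tau>\<lparr>reg := (reg \<tau>)(5 := Suc i)\<rparr>)" using st(1) \<tau> by (simp add: base_def)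
        moreover have "stack_at B (st @ [i]) (\<tau>\<lparr>reg := (reg \<tau>)(5 := Suc i)\<rparr>)"
          using \<tau>(2) i by (simp add: stack_at_def)
        moreover have "set (st @ [i]) = {y. y < Suc i \<and> th y = 0}"
          using st(5) True by (auto simp: less_Suc_eq)
        moreover have "distinct (st @ [i])" using st(4,5) by simp
        moreover have "arr B (mem \<tau>) 3 = th" using \<tau>(3)[of 3] st(3) by simp
        ultimately show "14 \<le> (15::nat) \<and> reg \<tau> 5 = i \<and> ?I (Suc i) (\<tau>\<lparr>reg := (reg \<tau>)(5 := Suc i)\<rparr>)"
          using \<tau>(1) i by (intro conjI exI[of _ "st @ [i]"]) simp_all
      qed
      then show ?thesis using True by simp
    next
      case False
      then have "?I (Suc i) (\<sigma>\<lparr>reg := (reg \<sigma>)(5 := Suc i)\<rparr>)"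
      proof (intro exI[of _ st] conjI)
        show "set st = {y. y < Suc i \<and> th y = 0}" using False by (auto simp: st(5) less_Suc_eq)
      qed (use st in \<open>simp_all add: base_def stack_at_def\<close>)
      with False i show ?thesis by (simp only: if_False) (rule wp_Skip, simp)
    qed
    then show "wp W (If (Equal (Load (addr 3 (Reg 5))) (Const 0)) (push 5) Skip) \<sigma>
      (\<lambda>t \<tau>. t \<le> 32 \<and> reg \<tau> 5 = i \<and> ?I (Suc i) (\<tau>\<lparr>reg := (reg \<tau>)(5 := Suc i)\<rparr>))"
      by (rule wp_If_le[OF b]) simp
  qed
  then show ?thesis
  proof (rule wp_mono)
    fix t \<tau> assume *: "?I K \<tau> \<and> t \<le> (32 + 9) * K + 7"
    then obtain st where st: "base \<tau>" "stack_at B st \<tau>" "arr B (mem \<tau>) 3 = th" "distinct st"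
      "set st = {y. y < K \<and> th y = 0}" by blast
    then have "sound {} st th" by (auto simp: sound_def threshold_closed_def)
    then show "(\<exists>st. base \<tau> \<and> stack_at B st \<tau> \<and> arr B (mem \<tau>) 3 = th \<and> sound {} st th) \<and> t \<le> 41 * K + 7"
      using * st by auto
  qed
qed

text \<open>Node \<open>x\<close> has just been popped, and \<open>ys\<close> are its successors that are still to be relaxed.\<close>

definition relaxing :: "nat set \<Rightarrow> nat \<Rightarrow> nat list \<Rightarrow> machine \<Rightarrow> bool" where
  "relaxing D x ys \<sigma> \<longleftrightarrow> x \<notin> D \<and> (\<exists>st ys0. base \<sigma> \<and> stack_at B st \<sigma> \<and> succs es x = ys0 @ ys \<and>
     chain (Suc (length es)) nxt tgt (reg \<sigma> 19) ys \<and>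
     sound (insert x D) st (arr B (mem \<sigma>) 3) \<and>
     (\<forall>y. arr B (mem \<sigma>) 3 y = th y - (hits es D y + length (filter ((=) y) ys0))))"

text \<open>The invariant compares a counter with the hits from \<open>D\<close> plus those in the
  prefix \<open>ys0\<close> of successors of \<open>x\<close> already treated; a relaxation moves
  \<open>y\<close> to the end of this prefix.\<close>

lemma wp_relax:
  assumes "relaxing D x (y # ys) \<sigma>"
  shows "wp W relax \<sigma> (\<lambda>t \<tau>. relaxing D x ys \<tau> \<and> t \<le> 80)"
proof -
  let ?cnt = "arr B (mem \<sigma>) 3"
  obtain st ys0 where st: "base \<sigma>" "stack_at B st \<sigma>" "succs es x = ys0 @ y # ys"
    "chain (Suc (length es)) nxt tgt (reg \<sigma> 19) (y # ys)" "sound (insert x D) st ?cnt"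
    "\<And>z. ?cnt z = th z - (hits es D z + length (filter ((=) z) ys0))" and x: "x \<notin> D"
    using assms by (auto simp: relaxing_def)
  have "y \<in> set (succs es x)" using st(3) by simp
  then have y: "y < K" using targets by (auto simp: succs_def)
  have B: "reg \<sigma> 3 = B" using st frame by (simp add: base_def)
  have arrs: "arr B (mem \<sigma>) 0 = first" "arr B (mem \<sigma>) 1 = nxt" "arr B (mem \<sigma>) 2 = tgt"
    using st(1) by (simp_all add: base_def)
  let ?i = "reg \<sigma> 19"
  have i: "?i \<le> length es" "tgt ?i = y" "chain (Suc (length es)) nxt tgt (nxt ?i) ys"
    using st(4) by auto
  let ?\<sigma> = "\<sigma>\<lparr>reg := (reg \<sigma>)(6 := y)\<rparr>"
  let ?st = "if ?cnt y = 1 then st @ [y] else st"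
  have b: "bval W (Equal (Load (addr 3 (Reg 6))) (Const 1)) ?\<sigma> = Some (?cnt y = 1)"
    using B y bounds by (simp add: aval_addr[of W _ ?\<sigma> y B] arr_def)
  have snd: "sound (insert x D) ?st (?cnt(y := ?cnt y - 1))"
  proof (cases "?cnt y = 1")
    case False
    then have "?cnt y = 0 \<longleftrightarrow> ?cnt y - 1 = 0" by auto
    then show ?thesis using False st(5) by (auto simp: sound_def)
  next
    case True
    \<comment> \<open>A counter of one means that the edges counted so far fall one short of
      \<open>th y\<close>. The current edge closes the gap, so \<open>insert x D\<close>, and with
      it any closed set, has enough edges into \<open>y\<close>.\<close>
    have "y \<in> X" if X: "threshold_closed K th es X" for X
    proof -
      have "hits es (insert x D) y = hits es D y + length (filter ((=) y) (ys0 @ y # ys))"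
        using hits_insert[OF x] st(3) by simp
      also have "\<dots> \<ge> th y" using True st(6)[of y] by simp
      finally have "th y \<le> hits es (insert x D) y" .
      also have "\<dots> \<le> hits es X y"
        by (rule hits_mono) (use st(5) X in \<open>auto simp: sound_def\<close>)
      finally show ?thesis using X y by (simp add: threshold_closed_def)
    qed
    then show ?thesis using True st(5) y by (auto simp: sound_def)
  qed
  have "wp W (if ?cnt y = 1 then push 6 else Skip) ?\<sigma> (\<lambda>t \<tau>.
    reg \<tau> = (reg \<sigma>)(6 := y, 12 := length ?st) \<and> stack_at B ?st \<tau> \<and> t \<le> 14 \<and>
    (\<forall>j<4. arr B (mem \<tau>) j = arr B (mem \<sigma>) j))"
  proof (cases "?cnt y = 1")
    case True
    have len: "length st < M"
      using length_stack_less[of st y] st(5) True y bounds by (auto simp: sound_def)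
    have stk: "stack_at B st ?\<sigma>" using st(2) by (simp add: stack_at_def)
    have "wp W (push 6) ?\<sigma> (\<lambda>t \<tau>.
      reg \<tau> = (reg \<sigma>)(6 := y, 12 := length ?st) \<and> stack_at B ?st \<tau> \<and> t \<le> 14 \<and>
      (\<forall>j<4. arr B (mem \<tau>) j = arr B (mem \<sigma>) j))"
      by (rule wp_push[OF stk _ len bounds(3)]) (use B True in auto)
    then show ?thesis using True by simp
  next
    case False
    then show ?thesis using st(2) by (auto intro!: wp_Skip simp: stack_at_def)
  qed
  then have 1: "wp W (If (Equal (Load (addr 3 (Reg 6))) (Const 1)) (push 6) Skip) ?\<sigma> (\<lambda>t \<tau>.
    reg \<tau> = (reg \<sigma>)(6 := y, 12 := length ?st) \<and> stack_at B ?st \<tau> \<and> t \<le> 25 \<and>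
    (\<forall>j<4. arr B (mem \<tau>) j = arr B (mem \<sigma>) j))"
    by (intro wp_If[OF b]) (auto elim!: wp_mono)
  have 2: "wp W (Store (addr 3 (Reg 6)) (Sub (Load (addr 3 (Reg 6))) (Const 1)) ;;
      Assign 19 (Load (addr 1 (Reg 19)))) \<tau> (\<lambda>t \<rho>. relaxing D x ys \<rho> \<and> t \<le> 30)"
    if \<tau>: "reg \<tau> = (reg \<sigma>)(6 := y, 12 := length ?st)" "stack_at B ?st \<tau>"
      "\<forall>j<4. arr B (mem \<tau>) j = arr B (mem \<sigma>) j" for \<tau>
  proof -
    have cnt: "mem \<tau> (cell B 3 y) = ?cnt y" and nxt: "mem \<tau> (cell B 1 ?i) = nxt ?i"
      using \<tau>(3)[rule_format, of 3] \<tau>(3)[rule_format, of 1] arrs by (simp_all add: arr_def fun_eq_iff)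
    have regs: "reg \<tau> 3 = B" "reg \<tau> 6 = y" "reg \<tau> 19 = ?i" by (simp_all add: \<tau>(1) B)
    let ?\<tau> = "\<tau>\<lparr>mem := (mem \<tau>)(cell B 3 y := ?cnt y - 1)\<rparr>"
    have a: "aval W (addr 3 (Reg 6)) \<tau> = Some (cell B 3 y)"
      by (rule aval_addr) (use regs y bounds in auto)
    have W: "?cnt y - 1 < W" "1 < W" using st(6)[of y] th_less[of y] bounds by auto
    have a': "aval W (Sub (Load (addr 3 (Reg 6))) (Const 1)) \<tau> = Some (?cnt y - 1)"
      using W a by (simp add: cnt)
    have "aval W (addr 1 (Reg 19)) ?\<tau> = Some (cell B 1 ?i)"
      by (rule aval_addr) (use regs i bounds in auto)
    then have a'': "aval W (Load (addr 1 (Reg 19))) ?\<tau> = Some (nxt ?i)"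
      by (simp add: nxt del: One_nat_def)
    let ?\<rho> = "?\<tau>\<lparr>reg := (reg ?\<tau>)(19 := nxt ?i)\<rparr>"
    have arr3: "arr B (mem ?\<rho>) 3 = ?cnt(y := ?cnt y - 1)"
      using \<tau>(3) by simp
    have "relaxing D x ys ?\<rho>"
      unfolding relaxing_def arr3
    proof (intro conjI exI)
      show "x \<notin> D" by (rule x)
      show "base ?\<rho>" using st(1) \<tau> by (simp add: base_def)
      show "stack_at B ?st ?\<rho>" using \<tau>(2) by (simp add: stack_at_def)
      show "succs es x = (ys0 @ [y]) @ ys" using st(3) by simp
      show "chain (Suc (length es)) nxt tgt (reg ?\<rho> 19) ys" using i by simp
      show "sound (insert x D) ?st (?cnt(y := ?cnt y - 1))" by (rule snd)
      show "\<forall>z. (?cnt(y := ?cnt y - 1)) z =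
          th z - (hits es D z + length (filter ((=) z) (ys0 @ [y])))"
        using st(6) by simp
    qed
    then show ?thesis
      by (intro wp_Seq wp_Store[OF a a'] wp_Assign[OF a'']) simp
  qed
  have "aval W (addr 2 (Reg 19)) \<sigma> = Some (cell B 2 ?i)"
    by (rule aval_addr) (use B i bounds in auto)
  moreover have "mem \<sigma> (cell B 2 ?i) = y" using arrs i by (simp add: arr_def fun_eq_iff)
  ultimately have a: "aval W (Load (addr 2 (Reg 19))) \<sigma> = Some y" by simp
  have "wp W (If (Equal (Load (addr 3 (Reg 6))) (Const 1)) (push 6) Skip ;;
      Store (addr 3 (Reg 6)) (Sub (Load (addr 3 (Reg 6))) (Const 1)) ;;
      Assign 19 (Load (addr 1 (Reg 19)))) ?\<sigma> (\<lambda>t \<tau>. relaxing D x ys \<tau> \<and> t \<le> 56)"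
    by (rule wp_Seq, rule wp_mono[OF 1], rule wp_mono[OF 2]) auto
  then show ?thesis
    unfolding relax_def by - (rule wp_Seq, rule wp_Assign[OF a], erule wp_mono, simp)
qed

definition reaching :: "nat set \<Rightarrow> machine \<Rightarrow> bool" where
  "reaching D \<sigma> \<longleftrightarrow> (\<exists>st. base \<sigma> \<and> stack_at B st \<sigma> \<and> sound D st (arr B (mem \<sigma>) 3) \<and>
     (\<forall>y. arr B (mem \<sigma>) 3 y = th y - hits es D y))"

lemma wp_relax_loop:
  assumes "relaxing D x ys \<sigma>"
  shows "wp W (While (Not (Equal (Reg 19) (Const 0))) relax) \<sigma>
    (\<lambda>t \<tau>. reaching (insert x D) \<tau> \<and> t \<le> 85 * length ys + 5)"
proof -
  let ?b = "Not (Equal (Reg 19) (Const 0))"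
  have b: "bcost ?b = 4" by simp
  have "wp W (While ?b relax) \<sigma>
    (\<lambda>t \<tau>. reaching (insert x D) \<tau> \<and> t \<le> 85 * length ys + bcost ?b + 1)"
  proof (rule wp_While[where I = "relaxing D x"])
    show "relaxing D x ys \<sigma>" by (rule assms)
    fix ys \<sigma> assume I: "relaxing D x ys \<sigma>"
    then have ch: "chain (Suc (length es)) nxt tgt (reg \<sigma> 19) ys" by (auto simp: relaxing_def)
    have W: "0 < W" using bounds by simp
    show "\<exists>v. bval W ?b \<sigma> = Some v \<and> (if v then wp W relax \<sigma> (\<lambda>t \<tau>.
      \<exists>ys'. relaxing D x ys' \<tau> \<and> t + bcost ?b + 1 + 85 * length ys' \<le> 85 * length ys)
      else reaching (insert x D) \<sigma>)"
    proof (cases ys)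
      case Nil
      \<comment> \<open>Now \<open>ys0\<close> is the whole successor list, and
        \<open>hits_insert\<close> turns the two counts into the hits from
        \<open>insert x D\<close>.\<close>
      have "reaching (insert x D) \<sigma>"
        using I Nil hits_insert[of x D] unfolding relaxing_def reaching_def by auto
      then show ?thesis using ch Nil W by auto
    next
      case (Cons y zs)
      have "wp W relax \<sigma> (\<lambda>t \<tau>.
        \<exists>ys'. relaxing D x ys' \<tau> \<and> t + bcost ?b + 1 + 85 * length ys' \<le> 85 * length ys)"
        using I unfolding Cons by (rule wp_mono[OF wp_relax]) auto
      then show ?thesis using ch Cons W by auto
    qed
  qed
  then show ?thesis unfolding b by (simp add: add.commute)
qed

text \<open>Each node not yet popped prepays 85 = 80 + 5 per outgoing edge, for a relaxation and its
  loop test, and 37 = 33 + 4 for the pop and the test of the outer loop.\<close>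

definition potential :: "nat set \<Rightarrow> nat" where
  "potential D = (\<Sum>x\<in>{..<K} - D. 85 * length (succs es x) + 37)"

lemma wp_reach_step:
  assumes "reaching D \<sigma>" "reg \<sigma> 12 \<noteq> 0"
  shows "wp W (pop ;; While (Not (Equal (Reg 19) (Const 0))) relax) \<sigma> (\<lambda>t \<tau>.
    \<exists>x. reaching (insert x D) \<tau> \<and> x < K \<and> x \<notin> D \<and> t \<le> 85 * length (succs es x) + 33)"
proof -
  obtain st where st: "base \<sigma>" "stack_at B st \<sigma>" "sound D st (arr B (mem \<sigma>) 3)"
    "\<And>y. arr B (mem \<sigma>) 3 y = th y - hits es D y" using assms(1) by (auto simp: reaching_def)
  then have "st \<noteq> []" using assms(2) by (auto simp: stack_at_def)
  then obtain st' x where x: "st = st' @ [x]" by (cases st rule: rev_cases) auto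
  have xK: "x < K" "x \<notin> D" using st(3) x by (auto simp: sound_def)
  have B: "reg \<sigma> 3 = B" using st frame by (simp add: base_def)
  have sp: "reg \<sigma> 12 = Suc (length st')" "length st' < M"
    using st(2,3) x length_stack[of st] bounds by (auto simp: stack_at_def sound_def)
  let ?\<sigma> = "\<sigma>\<lparr>reg := (reg \<sigma>)(12 := length st')\<rparr>"
  let ?\<tau> = "?\<sigma>\<lparr>reg := (reg ?\<sigma>)(19 := first x)\<rparr>"
  have a: "aval W (Sub (Reg 12) (Const 1)) \<sigma> = Some (length st')"
    using sp bounds by simp
  have "aval W (addr 4 (Reg 12)) ?\<sigma> = Some (cell B 4 (length st'))"
    by (rule aval_addr) (use B sp bounds in auto)
  moreover have "mem \<sigma> (cell B 4 (length st')) = x"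
    using st(2) x by (simp add: stack_at_def arr_def nth_append)
  ultimately have "aval W (Load (addr 4 (Reg 12))) ?\<sigma> = Some x" by simp
  then have "aval W (addr 0 (Load (addr 4 (Reg 12)))) ?\<sigma> = Some (cell B 0 x)"
    by (rule aval_addr) (use B xK bounds in auto)
  moreover have "mem \<sigma> (cell B 0 x) = first x" using st(1) by (auto simp: base_def arr_def fun_eq_iff)
  ultimately have a': "aval W (Load (addr 0 (Load (addr 4 (Reg 12))))) ?\<sigma> = Some (first x)" by simp
  have "relaxing D x (succs es x) ?\<tau>"
    unfolding relaxing_def
  proof (intro conjI exI)
    show "x \<notin> D" by (rule xK)
    show "base ?\<tau>" using st(1) by (simp add: base_def)
    show "stack_at B st' ?\<tau>" using st(2) x by (auto simp: stack_at_def nth_append)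
    show "succs es x = [] @ succs es x" by simp
    show "chain (Suc (length es)) nxt tgt (reg ?\<tau> 19) (succs es x)" using chains by simp
    show "sound (insert x D) st' (arr B (mem ?\<tau>) 3)" using st(3) x by (auto simp: sound_def)
    show "\<forall>y. arr B (mem ?\<tau>) 3 y = th y - (hits es D y + length (filter ((=) y) []))"
      using st(4) by simp
  qed
  then have 1: "wp W (While (Not (Equal (Reg 19) (Const 0))) relax) ?\<tau>
    (\<lambda>t \<tau>. reaching (insert x D) \<tau> \<and> t \<le> 85 * length (succs es x) + 5)" by (rule wp_relax_loop)
  show ?thesis unfolding pop_def
    by (intro wp_Seq wp_Assign[OF a] wp_Assign[OF a'], rule wp_mono[OF 1])
      (use xK in \<open>auto intro!: exI[of _ x]\<close>)
qed

text \<open>The coefficient 78 is 41 for the initial scan plus 37 for the pop. Leastness is part of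
  the invariant; closedness appears only when the stack is empty.\<close>

lemma wp_reach:
  assumes "base \<sigma>" "arr B (mem \<sigma>) 3 = th" "reg \<sigma> 12 = 0"
  shows "wp W reach_com \<sigma> (\<lambda>t \<tau>. (\<forall>r\<in>{0, 3, 9, 11}. reg \<tau> r = fr r) \<and>
    t \<le> 78 * K + 85 * length es + 12 \<and>
    (\<exists>S\<subseteq>{..<K}. threshold_closed K th es S \<and> (\<forall>X. threshold_closed K th es X \<longrightarrow> S \<subseteq> X) \<and>
       (\<forall>y<K. arr B (mem \<tau>) 3 y = 0 \<longleftrightarrow> y \<in> S)))" (is "wp W _ \<sigma> (\<lambda>t \<tau>. ?Q t \<tau>)")
proof -
  let ?b = "Less (Const 0) (Reg 12)"
  let ?c = "pop ;; While (Not (Equal (Reg 19) (Const 0))) relax"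
  let ?R = "\<lambda>\<tau>. \<exists>D. reaching D \<tau> \<and> reg \<tau> 12 = 0"
  have b: "bcost ?b = 3" by simp
  have loop: "wp W (While ?b ?c) \<tau> (\<lambda>t \<tau>. ?R \<tau> \<and> t \<le> potential {} + bcost ?b + 1)"
    if "reaching {} \<tau>" for \<tau>
  proof (rule wp_While[where I = "\<lambda>D \<sigma>. reaching D \<sigma>", OF that])
    fix D \<sigma> assume I: "reaching D \<sigma>"
    have W: "0 < W" using bounds by simp
    show "\<exists>v. bval W ?b \<sigma> = Some v \<and> (if v then wp W ?c \<sigma> (\<lambda>t \<tau>.
      \<exists>D'. reaching D' \<tau> \<and> t + bcost ?b + 1 + potential D' \<le> potential D) else ?R \<sigma>)"
    proof (cases "reg \<sigma> 12 = 0")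
      case True
      then show ?thesis using I W by auto
    next
      case False
      have "wp W ?c \<sigma> (\<lambda>t \<tau>.
        \<exists>D'. reaching D' \<tau> \<and> t + bcost ?b + 1 + potential D' \<le> potential D)"
      proof (rule wp_mono[OF wp_reach_step[OF I False]])
        fix t \<tau>
        assume "\<exists>x. reaching (insert x D) \<tau> \<and> x < K \<and> x \<notin> D \<and> t \<le> 85 * length (succs es x) + 33"
        then obtain x where x: "reaching (insert x D) \<tau>" "x < K" "x \<notin> D"
          "t \<le> 85 * length (succs es x) + 33" by blast
        have "{..<K} - insert x D = {..<K} - D - {x}" by blast
        then have "potential D = 85 * length (succs es x) + 37 + potential (insert x D)"
          unfolding potential_def using x by (simp add: sum.remove[of _ x])
        then show "\<exists>D'. reaching D' \<tau> \<and> t + bcost ?b + 1 + potential D' \<le> potential D"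
          using x by (intro exI[of _ "insert x D"]) simp
      qed
      then show ?thesis using False W by auto
    qed
  qed
  have pot: "potential {} \<le> 85 * length es + 37 * K"
    using sum_length_succs[of es K]
    by (simp add: potential_def sum.distrib sum_distrib_left[symmetric])
  have fin: "?Q (t' + t + 1) \<tau>"
    if D: "reaching D \<tau>" "reg \<tau> 12 = 0" and t: "t \<le> potential {} + bcost ?b + 1" "t' \<le> 41 * K + 7"
    for D t t' \<tau>
  proof -
    obtain st where st: "base \<tau>" "stack_at B st \<tau>" "sound D st (arr B (mem \<tau>) 3)"
      "\<And>y. arr B (mem \<tau>) 3 y = th y - hits es D y" using D(1) by (auto simp: reaching_def)
    then have [simp]: "st = []" using D(2) by (simp add: stack_at_def)
    show ?thesis
    proof (intro conjI exI[of _ D])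
      show "\<forall>r\<in>{0, 3, 9, 11}. reg \<tau> r = fr r" using st(1) by (simp add: base_def)
      show "t' + t + 1 \<le> 78 * K + 85 * length es + 12" using t pot by simp
      show "D \<subseteq> {..<K}" "\<forall>X. threshold_closed K th es X \<longrightarrow> D \<subseteq> X"
        "\<forall>y<K. (arr B (mem \<tau>) 3 y = 0) = (y \<in> D)"
        using st(3) by (auto simp: sound_def)
      \<comment> \<open>If \<open>th y \<le> hits es D y\<close>, the counter of \<open>y\<close> is
        zero, and a zero counter means membership in \<open>D\<close> because nothing is left on the
        stack.\<close>
      then show "threshold_closed K th es D" using st(4) by (auto simp: threshold_closed_def)
    qed
  qed
  show ?thesis
    unfolding reach_com_def
  proof (rule wp_Seq, rule wp_mono[OF wp_push_initial[OF assms]])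
    fix t' \<tau>
    assume *: "(\<exists>st. base \<tau> \<and> stack_at B st \<tau> \<and> arr B (mem \<tau>) 3 = th \<and> sound {} st th) \<and> t' \<le> 41 * K + 7"
    then have "reaching {} \<tau>" by (auto simp: reaching_def)
    from loop[OF this] show "wp W (While ?b ?c) \<tau> (\<lambda>t \<tau>. ?Q (t' + t + 1) \<tau>)"
      by (rule wp_mono) (use * fin in blast)
  qed
qed

end

section \<open>The order as reachability in an AND-OR graph\<close>

text \<open>A pair of states or a pair of a transition and a state is numbered \<open>i * n + j\<close>. Nodes of
  kinds 0, 1, 2 and 3 with number \<open>p\<close> stand for: the pair is distinguished; the pair is excluded;
  the pair violates one of the co-lex axioms if it is distinguished; every transition into the
  state with the same letter as the given transition starts at a state distinguished from its
  source. The odd kinds are conjunctions, the even ones disjunctions.\<close>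

definition node :: "nat \<Rightarrow> nat \<Rightarrow> nat" where
  "node k p = 4 * p + k"

lemma node_div [simp]: "k < 4 \<Longrightarrow> node k p div 4 = p"
  by (simp add: node_def)

lemma node_mod [simp]: "k < 4 \<Longrightarrow> node k p mod 4 = k"
  by (simp add: node_def)

lemma node_eq_iff [simp]: "j < 4 \<Longrightarrow> k < 4 \<Longrightarrow> node j p = node k q \<longleftrightarrow> j = k \<and> p = q"
  by (metis node_div node_mod)

lemma even_node [simp]: "even (node k p) \<longleftrightarrow> even k"
  by (simp add: node_def)

lemma node_less_iff [simp]: "k < 4 \<Longrightarrow> node k p < 4 * q \<longleftrightarrow> p < q"
  by (simp add: node_def less_mult_imp_div_less) linarith

lemma node_cases: obtains p where "y = node 0 p" | p where "y = node 1 p"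
  | p where "y = node 2 p" | p where "y = node 3 p"
proof -
  have y: "y = node (y mod 4) (y div 4)" by (simp add: node_def)
  have "y mod 4 < 4" by simp
  then consider "y mod 4 = 0" | "y mod 4 = 1" | "y mod 4 = 2" | "y mod 4 = 3" by linarith
  then show ?thesis by cases (use y that in auto)
qed

lemma pairing_eq_iff:
  fixes i j n :: nat
  assumes "j < n" "j' < n"
  shows "i * n + j = i' * n + j' \<longleftrightarrow> i = i' \<and> j = j'"
proof
  assume eq: "i * n + j = i' * n + j'"
  have "i = (i * n + j) div n" using assms(1) by simp
  also have "\<dots> = i'" unfolding eq using assms(2) by simp
  finally show "i = i' \<and> j = j'" using eq by simp
qed simp

lemma pairing_less: "i < k \<Longrightarrow> j < n \<Longrightarrow> i * n + j < k * n" for i j k n :: nat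
proof -
  assume "i < k" "j < n"
  then have "i * n + j < Suc i * n" by simp
  also have "\<dots> \<le> k * n" using \<open>i < k\<close> by (intro mult_le_mono1) simp
  finally show ?thesis .
qed

text \<open>The edge list after \<open>k\<close> rounds of a loop that prepends; later rounds stand
  in front, hence \<open>rev\<close>.\<close>

definition accumulate :: "(nat \<Rightarrow> 'b list) \<Rightarrow> nat \<Rightarrow> 'b list \<Rightarrow> 'b list" where
  "accumulate f k es = concat (map f (rev [0..<k])) @ es"

lemma accumulate_0 [simp]: "accumulate f 0 es = es"
  by (simp add: accumulate_def)

lemma accumulate_Suc [simp]: "accumulate f (Suc k) es = f k @ accumulate f k es"
  by (simp add: accumulate_def)

lemma set_accumulate: "set (accumulate f k es) = (\<Union>i<k. set (f i)) \<union> set es"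
  by (induction k) (auto simp: less_Suc_eq)

lemma length_accumulate:
  "(\<And>i. i < k \<Longrightarrow> length (f i) \<le> c) \<Longrightarrow> length (accumulate f k es) \<le> c * k + length es"
  by (induction k) (auto simp: add_mono add.assoc)

definition pair_edges :: "nat \<Rightarrow> (nat \<times> nat) list" where
  "pair_edges p = [(node 0 p, node 1 p), (node 2 p, node 1 p)]"

text \<open>Both orders of the pair are emitted, one for each of the rules \<open>left\<close> and
  \<open>right\<close>.\<close>

definition target_edges :: "nat \<Rightarrow> (nat \<times> nat \<times> nat) list \<Rightarrow> nat \<Rightarrow> nat \<Rightarrow> (nat \<times> nat) list" where
  "target_edges n ts e z = (case ts ! e of (u, a, w) \<Rightarrow>
     [(node 3 (e * n + z), node 0 (z * n + w)), (node 3 (e * n + z), node 0 (w * n + z))])"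

text \<open>Two transitions with a common letter give a premise of the conjunction for
  \<open>e\<close> and \<open>z\<close> and an instance of the rule \<open>step\<close>. Letters in
  the wrong order violate the label axiom unconditionally, hence the edge from
  \<open>h\<close>.\<close>

definition letter_edges ::
  "nat \<Rightarrow> nat \<Rightarrow> (nat \<times> nat \<times> nat) list \<Rightarrow> nat \<Rightarrow> nat \<Rightarrow> (nat \<times> nat) list" where
  "letter_edges n h ts e f = (case (ts ! e, ts ! f) of ((u, a, w), (v, b, z)) \<Rightarrow>
     if a = b then [(node 0 (u * n + v), node 3 (e * n + z)), (node 1 (u * n + v), node 2 (w * n + z))]
     else if b < a then [(h, node 2 (w * n + z))]
     else [])"

text \<open>The label \<open>None\<close> of the initial state lies below every letter, so a state
  with an incoming transition must not precede it.\<close>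

definition init_edges :: "nat \<Rightarrow> nat \<Rightarrow> nat \<Rightarrow> (nat \<times> nat \<times> nat) list \<Rightarrow> nat \<Rightarrow> (nat \<times> nat) list" where
  "init_edges n s h ts e = (case ts ! e of (u, a, w) \<Rightarrow> [(h, node 2 (w * n + s))])"

definition transition_edges ::
  "nat \<Rightarrow> nat \<Rightarrow> nat \<Rightarrow> (nat \<times> nat \<times> nat) list \<Rightarrow> nat \<Rightarrow> (nat \<times> nat) list" where
  "transition_edges n s h ts e =
     accumulate (letter_edges n h ts e) (length ts)
       (accumulate (target_edges n ts e) n (init_edges n s h ts e))"

text \<open>The node of kind 3 with this number stands for no pair. It has no predecessors, so it
  is always reached.\<close>

definition top_node :: "nat \<Rightarrow> nat \<Rightarrow> nat" where
  "top_node n m = node 3 (n * n + m * n)"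

definition graph_edges :: "nat \<Rightarrow> nat \<Rightarrow> (nat \<times> nat \<times> nat) list \<Rightarrow> (nat \<times> nat) list" where
  "graph_edges n s ts = accumulate (transition_edges n s (top_node n (length ts)) ts) (length ts)
     (accumulate pair_edges (n * n) [])"

text \<open>\<open>P\<close> counts the pairs whose two disjunction counters have been set to one.
  The cells of later ones still hold the initial zero, so these surplus nodes count as
  reached.\<close>

definition threshold :: "nat \<Rightarrow> (nat \<times> nat) list \<Rightarrow> nat \<Rightarrow> nat" where
  "threshold P es y =
     (if odd y then length (filter (\<lambda>e. snd e = y) es) else if y div 4 < P then 1 else 0)"

lemma length_filter_conj_iff:
  "length (filter Q xs) \<le> length (filter (\<lambda>x. R x \<and> Q x) xs) \<longleftrightarrow> (\<forall>x\<in>set xs. Q x \<longrightarrow> R x)"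
proof (induction xs)
  case (Cons x xs)
  have "length (filter (\<lambda>x. R x \<and> Q x) xs) \<le> length (filter Q xs)"
    by (induction xs) auto
  then show ?case using Cons by auto
qed simp

text \<open>Hits equal to the in-degree express that all predecessors are reached, at least one hit
  that some predecessor is.\<close>

lemma threshold_closed_iff:
  "threshold_closed K (threshold P es) es X \<longleftrightarrow> (\<forall>y<K.
     (odd y \<and> (\<forall>x. (x, y) \<in> set es \<longrightarrow> x \<in> X) \<longrightarrow> y \<in> X) \<and>
     (even y \<and> (P \<le> y div 4 \<or> (\<exists>x. (x, y) \<in> set es \<and> x \<in> X)) \<longrightarrow> y \<in> X))"
proof -
  have 1: "threshold P es y \<le> hits es X y \<longleftrightarrow> (\<forall>x. (x, y) \<in> set es \<longrightarrow> x \<in> X)" if "odd y" for y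
    using length_filter_conj_iff[of "\<lambda>e. snd e = y" es "\<lambda>e. fst e \<in> X"] that
    by (auto simp: threshold_def hits_def)
  have "0 < hits es X y \<longleftrightarrow> (\<exists>x. (x, y) \<in> set es \<and> x \<in> X)" for y
    by (force simp: hits_def filter_empty_conv)
  then have 2: "threshold P es y \<le> hits es X y \<longleftrightarrow>
      P \<le> y div 4 \<or> (\<exists>x. (x, y) \<in> set es \<and> x \<in> X)" if "even y" for y
    using that by (auto simp: threshold_def Suc_le_eq)
  show ?thesis unfolding threshold_closed_def using 1 2 by blast
qed

lemma graph_edges_cases:
  assumes "(x, y) \<in> set (graph_edges n s ts)"
  obtains p where "p < n * n" "x = node 0 p \<or> x = node 2 p" "y = node 1 p"
  | e u a w where "e < length ts" "ts ! e = (u, a, w)" "x = top_node n (length ts)"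
      "y = node 2 (w * n + s)"
  | e u a w z where "e < length ts" "ts ! e = (u, a, w)" "z < n" "x = node 3 (e * n + z)"
      "y = node 0 (z * n + w) \<or> y = node 0 (w * n + z)"
  | e u a w f v z where "e < length ts" "ts ! e = (u, a, w)" "f < length ts" "ts ! f = (v, a, z)"
      "x = node 0 (u * n + v)" "y = node 3 (e * n + z)"
  | e u a w f v z where "e < length ts" "ts ! e = (u, a, w)" "f < length ts" "ts ! f = (v, a, z)"
      "x = node 1 (u * n + v)" "y = node 2 (w * n + z)"
  | e u a w f v b z where "e < length ts" "ts ! e = (u, a, w)" "f < length ts" "ts ! f = (v, b, z)"
      "b < a" "x = top_node n (length ts)" "y = node 2 (w * n + z)"
proof -
  consider p where "p < n * n" "(x, y) \<in> set (pair_edges p)"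
    | e where "e < length ts" "(x, y) \<in> set (init_edges n s (top_node n (length ts)) ts e)"
    | e z where "e < length ts" "z < n" "(x, y) \<in> set (target_edges n ts e z)"
    | e f where "e < length ts" "f < length ts"
        "(x, y) \<in> set (letter_edges n (top_node n (length ts)) ts e f)"
    using assms unfolding graph_edges_def transition_edges_def set_accumulate by auto
  then show ?thesis
  proof cases
    case 1
    then show ?thesis using that(1) by (auto simp: pair_edges_def)
  next
    case 2
    then show ?thesis using that(2) by (cases "ts ! e") (auto simp: init_edges_def)
  next
    case 3
    then show ?thesis using that(3) by (cases "ts ! e") (auto simp: target_edges_def)
  next
    case 4
    then show ?thesis using that(4-6)
      by (cases "ts ! e"; cases "ts ! f") (auto simp: letter_edges_def split: if_splits)
  qed
qed

lemma graph_edgesI: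
  "p < n * n \<Longrightarrow> (node 0 p, node 1 p) \<in> set (graph_edges n s ts)"
  "p < n * n \<Longrightarrow> (node 2 p, node 1 p) \<in> set (graph_edges n s ts)"
  "e < length ts \<Longrightarrow> ts ! e = (u, a, w) \<Longrightarrow>
    (top_node n (length ts), node 2 (w * n + s)) \<in> set (graph_edges n s ts)"
  "e < length ts \<Longrightarrow> ts ! e = (u, a, w) \<Longrightarrow> z < n \<Longrightarrow>
    (node 3 (e * n + z), node 0 (z * n + w)) \<in> set (graph_edges n s ts)"
  "e < length ts \<Longrightarrow> ts ! e = (u, a, w) \<Longrightarrow> z < n \<Longrightarrow>
    (node 3 (e * n + z), node 0 (w * n + z)) \<in> set (graph_edges n s ts)"
  "e < length ts \<Longrightarrow> ts ! e = (u, a, w) \<Longrightarrow> f < length ts \<Longrightarrow> ts ! f = (v, a, z) \<Longrightarrow>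
    (node 0 (u * n + v), node 3 (e * n + z)) \<in> set (graph_edges n s ts)"
  "e < length ts \<Longrightarrow> ts ! e = (u, a, w) \<Longrightarrow> f < length ts \<Longrightarrow> ts ! f = (v, a, z) \<Longrightarrow>
    (node 1 (u * n + v), node 2 (w * n + z)) \<in> set (graph_edges n s ts)"
  "e < length ts \<Longrightarrow> ts ! e = (u, a, w) \<Longrightarrow> f < length ts \<Longrightarrow> ts ! f = (v, b, z) \<Longrightarrow> b < a \<Longrightarrow>
    (top_node n (length ts), node 2 (w * n + z)) \<in> set (graph_edges n s ts)"
proof -
  have init: "set (init_edges n s (top_node n (length ts)) ts e) \<subseteq> set (graph_edges n s ts)"
    if "e < length ts" for e
    using that unfolding graph_edges_def transition_edges_def set_accumulate by auto
  have target: "set (target_edges n ts e z) \<subseteq> set (graph_edges n s ts)"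
    if "e < length ts" "z < n" for e z
    using that unfolding graph_edges_def transition_edges_def set_accumulate by auto
  have letter: "set (letter_edges n (top_node n (length ts)) ts e f) \<subseteq> set (graph_edges n s ts)"
    if "e < length ts" "f < length ts" for e f
    using that unfolding graph_edges_def transition_edges_def set_accumulate by blast
  have pair: "set (pair_edges p) \<subseteq> set (graph_edges n s ts)" if "p < n * n" for p
    using that unfolding graph_edges_def set_accumulate by auto
  show "p < n * n \<Longrightarrow> (node 0 p, node 1 p) \<in> set (graph_edges n s ts)"
    "p < n * n \<Longrightarrow> (node 2 p, node 1 p) \<in> set (graph_edges n s ts)"
    using pair[of p] by (simp_all add: pair_edges_def)
  assume e: "e < length ts" "ts ! e = (u, a, w)"
  show "(top_node n (length ts), node 2 (w * n + s)) \<in> set (graph_edges n s ts)"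
    using init[OF e(1)] e(2) by (simp add: init_edges_def)
  show "z < n \<Longrightarrow> (node 3 (e * n + z), node 0 (z * n + w)) \<in> set (graph_edges n s ts)"
    "z < n \<Longrightarrow> (node 3 (e * n + z), node 0 (w * n + z)) \<in> set (graph_edges n s ts)"
    using target[OF e(1), of z] e(2) by (simp_all add: target_edges_def)
  assume f: "f < length ts"
  show "ts ! f = (v, a, z) \<Longrightarrow> (node 0 (u * n + v), node 3 (e * n + z)) \<in> set (graph_edges n s ts)"
    "ts ! f = (v, a, z) \<Longrightarrow> (node 1 (u * n + v), node 2 (w * n + z)) \<in> set (graph_edges n s ts)"
    "ts ! f = (v, b, z) \<Longrightarrow> b < a \<Longrightarrow>
      (top_node n (length ts), node 2 (w * n + z)) \<in> set (graph_edges n s ts)"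
    using letter[OF e(1) f] e(2) by (simp_all add: letter_edges_def)
qed

section \<open>Correctness of the AND-OR graph\<close>

definition violates :: "('q, nat) nfa \<Rightarrow> 'q \<Rightarrow> 'q \<Rightarrow> bool" where
  "violates A w z \<longleftrightarrow> \<not> labels_le A w z \<or>
     (\<exists>u a v. (u, a, w) \<in> transitions A \<and> (v, a, z) \<in> transitions A \<and> excluded A u v)"

text \<open>One unfolding of the fixed point. Splitting off the shared premise makes a node of kind
  1 a conjunction of just two nodes.\<close>

lemma excluded_iff: "excluded A w z \<longleftrightarrow> distinguished A w z \<and> violates A w z"
  unfolding violates_def
  using excluded.labels[of A w z] excluded.step[of A w z] excluded_distinguished[of A w z]
  by (metis excluded.cases)

locale encoded =
  fixes A :: "('q, nat) nfa" and \<nu> :: "'q \<Rightarrow> nat" and ts :: "(nat \<times> nat \<times> nat) list"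
  assumes nfa: "is_nfa A" and enc: "encodes \<nu> ts A"
begin

abbreviation "n \<equiv> card (states A)"
abbreviation "m \<equiv> length ts"
abbreviation "s \<equiv> \<nu> (init A)"
abbreviation "K \<equiv> 4 * (n * n + m * n + 1)"
abbreviation "es \<equiv> graph_edges n s ts"
abbreviation "closed_set X \<equiv> threshold_closed K (threshold (n * n) es) es X"

lemma \<nu>_less: "u \<in> states A \<Longrightarrow> \<nu> u < n"
  using enc by (auto simp: encodes_def bij_betw_def)

lemma \<nu>_eq_iff: "u \<in> states A \<Longrightarrow> v \<in> states A \<Longrightarrow> \<nu> u = \<nu> v \<longleftrightarrow> u = v"
  using enc by (auto simp: encodes_def bij_betw_def inj_on_def)

lemma \<nu>_surj: "i < n \<Longrightarrow> \<exists>u\<in>states A. i = \<nu> u"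
  using enc by (auto simp: encodes_def bij_betw_def image_iff set_eq_iff)

lemma init_state: "init A \<in> states A"
  using nfa by (simp add: is_nfa_def)

lemma transition_index: "(u, a, w) \<in> transitions A \<Longrightarrow> \<exists>e<m. ts ! e = (\<nu> u, a, \<nu> w)"
  using enc by (force simp: encodes_def in_set_conv_nth[symmetric])

lemma index_transition:
  assumes "e < m" "ts ! e = (i, a, j)"
  obtains u w where "(u, a, w) \<in> transitions A" "i = \<nu> u" "j = \<nu> w" "u \<in> states A" "w \<in> states A"
proof -
  have "(i, a, j) \<in> set ts" using assms by (metis nth_mem)
  then show ?thesis using enc that transitions_states[OF nfa] by (auto simp: encodes_def)
qed

lemma pair_less: "u \<in> states A \<Longrightarrow> v \<in> states A \<Longrightarrow> \<nu> u * n + \<nu> v < n * n"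
  using \<nu>_less pairing_less by blast

lemma closed_odd:
  assumes "closed_set S" "odd k" "k < 4" "p \<le> n * n + m * n"
    "\<And>x. (x, node k p) \<in> set es \<Longrightarrow> x \<in> S"
  shows "node k p \<in> S"
proof -
  have "node k p < K" using assms(3,4) node_less_iff[of k p "n * n + m * n + 1"] by simp
  then show ?thesis using assms unfolding threshold_closed_iff by simp
qed

lemma closed_even:
  assumes "closed_set S" "even k" "k < 4" "p < n * n" "(x, node k p) \<in> set es" "x \<in> S"
  shows "node k p \<in> S"
proof -
  have "node k p < K" using assms(3,4) node_less_iff[of k p "n * n + m * n + 1"] by simp
  then show ?thesis using assms unfolding threshold_closed_iff by auto
qed

text \<open>The induction covers both orders at once: a conjunction of kind 3 keeps the source of
  its transition on the left, whereas the rule \<open>right\<close> delivers it on the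
  right.\<close>

lemma reached_distinguished:
  assumes S: "closed_set S" and "distinguished A u v"
  shows "node 0 (\<nu> u * n + \<nu> v) \<in> S"
proof -
  have C: "node 3 (e * n + \<nu> z) \<in> S"
    if e: "e < m" "ts ! e = (\<nu> u, a, \<nu> w)" and z: "z \<in> states A"
      and all: "\<And>v. (v, a, z) \<in> transitions A \<Longrightarrow> node 0 (\<nu> u * n + \<nu> v) \<in> S" for e u a w z
  proof -
    \<comment> \<open>Only pairs of transitions with one letter lead to kind 3; since state numbers
      are below \<open>n\<close>, the node number determines \<open>e\<close> and
      \<open>z\<close>.\<close>
    have "x \<in> S" if "(x, node 3 (e * n + \<nu> z)) \<in> set es" for x
      using that
    proof (cases rule: graph_edges_cases)
      case (4 e' u' a' w' f v' z')
      obtain v y where v: "(v, a', y) \<in> transitions A" "v' = \<nu> v" "z' = \<nu> y" "y \<in> states A"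
        using index_transition[OF 4(3,4)] by metis
      have "e * n + \<nu> z = e' * n + z'" using 4(6) by simp
      then have "e' = e" "y = z"
        using pairing_eq_iff[OF \<nu>_less[OF z] \<nu>_less[OF v(4)]] v z by (auto simp: \<nu>_eq_iff)
      then show ?thesis using all[of v] v 4 e by simp
    qed auto
    moreover have "e * n + \<nu> z \<le> n * n + m * n"
      using pairing_less[OF e(1) \<nu>_less[OF z]] by simp
    ultimately show ?thesis using closed_odd[OF S] by simp
  qed
  have N: "node 0 p \<in> S" if "(x, node 0 p) \<in> set es" "x \<in> S" "p < n * n" for x p
    using closed_even[OF S _ _ that(3,1,2)] by simp
  have step: "node 0 (\<nu> w * n + \<nu> z) \<in> S \<and> node 0 (\<nu> z * n + \<nu> w) \<in> S"
    if tr: "(u, a, w) \<in> transitions A" and z: "z \<in> states A"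
      and all: "\<And>v. (v, a, z) \<in> transitions A \<Longrightarrow> node 0 (\<nu> u * n + \<nu> v) \<in> S" for u a w z
  proof -
    obtain e where e: "e < m" "ts ! e = (\<nu> u, a, \<nu> w)" using transition_index[OF tr] by blast
    have w: "w \<in> states A" using tr transitions_states[OF nfa] by blast
    note c = C[OF e z all]
    show ?thesis
      using N[OF graph_edgesI(5)[OF e \<nu>_less[OF z]] c pair_less[OF w z]]
        N[OF graph_edgesI(4)[OF e \<nu>_less[OF z]] c pair_less[OF z w]] by blast
  qed
  have "node 0 (\<nu> u * n + \<nu> v) \<in> S \<and> node 0 (\<nu> v * n + \<nu> u) \<in> S"
    using assms(2)
  proof (induction rule: distinguished.induct)
    case (left u a w z)
    show ?case by (rule step[OF left.hyps(1,2)]) (use left.IH in blast)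
  next
    case (right u a w z)
    have "node 0 (\<nu> w * n + \<nu> z) \<in> S \<and> node 0 (\<nu> z * n + \<nu> w) \<in> S"
      by (rule step[OF right.hyps(1,2)]) (use right.IH in blast)
    then show ?case by blast
  qed
  then show ?thesis by blast
qed

lemma top_reached:
  assumes "closed_set S"
  shows "top_node n m \<in> S"
proof -
  have "False" if "(x, top_node n m) \<in> set es" for x
    using that
  proof (cases rule: graph_edges_cases)
    case (4 e u a w f v z)
    obtain z' where "z = \<nu> z'" "z' \<in> states A" using index_transition[OF 4(3,4)] by metis
    then have "e * n + z < m * n" using 4(1) \<nu>_less pairing_less by blast
    then show ?thesis using 4(6) by (simp add: top_node_def)
  qed (simp_all add: top_node_def)
  then show ?thesis using closed_odd[OF assms, of 3 "n * n + m * n"] by (auto simp: top_node_def)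
qed

lemma reached_excluded:
  assumes S: "closed_set S" and "excluded A u v"
  shows "node 1 (\<nu> u * n + \<nu> v) \<in> S"
proof -
  have N: "node 2 p \<in> S" if "(x, node 2 p) \<in> set es" "x \<in> S" "p < n * n" for x p
    using closed_even[OF S _ _ that(3,1,2)] by simp
  have G: "node 1 (\<nu> w * n + \<nu> z) \<in> S"
    if d: "distinguished A w z" and H: "node 2 (\<nu> w * n + \<nu> z) \<in> S" for w z
  proof -
    have "x \<in> S" if "(x, node 1 (\<nu> w * n + \<nu> z)) \<in> set es" for x
      using that H reached_distinguished[OF S d] by (cases rule: graph_edges_cases) auto
    moreover have "\<nu> w * n + \<nu> z < n * n"
      using d distinguished_states[OF nfa] pair_less by blast
    ultimately show ?thesis using closed_odd[OF S] by simp
  qed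
  show ?thesis
    using assms(2)
  proof (induction rule: excluded.induct)
    case (labels w z)
    have wz: "w \<in> states A" "z \<in> states A" using labels.hyps(1) distinguished_states[OF nfa] by blast+
    obtain a b where ab: "a \<in> labels A w" "b \<in> labels A z" "\<not> a \<le> b"
      using labels.hyps(2) by (auto simp: labels_le_def)
    \<comment> \<open>\<open>None\<close> is least, so it cannot exceed \<open>b\<close>; the larger
      label is a genuine letter and comes with a transition.\<close>
    have "a \<noteq> None" using ab(3) by (cases a) simp_all
    then obtain a' where a': "a = Some a'" by blast
    then obtain u where u: "(u, a', w) \<in> transitions A"
      using ab(1) by (auto simp: labels_def split: if_splits)
    obtain e where e: "e < m" "ts ! e = (\<nu> u, a', \<nu> w)" using transition_index[OF u] by blast
    have "(top_node n m, node 2 (\<nu> w * n + \<nu> z)) \<in> set es"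
    proof (cases b)
      case None
      then have "z = init A" using ab(2) by (auto simp: labels_def split: if_splits)
      then show ?thesis using graph_edgesI(3)[OF e] by simp
    next
      case (Some b')
      then obtain v where v: "(v, b', z) \<in> transitions A"
        using ab(2) by (auto simp: labels_def split: if_splits)
      obtain f where f: "f < m" "ts ! f = (\<nu> v, b', \<nu> z)" using transition_index[OF v] by blast
      then show ?thesis using graph_edgesI(8)[OF e f] ab(3) a' Some by simp
    qed
    then have "node 2 (\<nu> w * n + \<nu> z) \<in> S" using N top_reached[OF S] pair_less[OF wz] by blast
    then show ?case using G labels.hyps(1) by blast
  next
    case (step w z u a v)
    have wz: "w \<in> states A" "z \<in> states A" using step.hyps(1) distinguished_states[OF nfa] by blast+
    obtain e where e: "e < m" "ts ! e = (\<nu> u, a, \<nu> w)" using transition_index[OF step.hyps(2)] by blast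
    obtain f where f: "f < m" "ts ! f = (\<nu> v, a, \<nu> z)" using transition_index[OF step.hyps(3)] by blast
    have "node 2 (\<nu> w * n + \<nu> z) \<in> S"
      using N[OF graph_edgesI(7)[OF e f] step.IH pair_less[OF wz]] .
    then show ?case using G step.hyps(1) by blast
  qed
qed

text \<open>The intended meaning of the nodes. Implications admit every node that stands for no
  pair; this is necessary, since surplus nodes are reached from the start.\<close>

definition model :: "nat set" where
  "model = {y. \<forall>w\<in>states A. \<forall>z\<in>states A.
     (y = node 0 (\<nu> w * n + \<nu> z) \<longrightarrow> distinguished A w z) \<and>
     (y = node 1 (\<nu> w * n + \<nu> z) \<longrightarrow> excluded A w z) \<and>
     (y = node 2 (\<nu> w * n + \<nu> z) \<longrightarrow> violates A w z) \<and>
     (\<forall>u a e. (u, a, w) \<in> transitions A \<and> e < m \<and> ts ! e = (\<nu> u, a, \<nu> w) \<and>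
        y = node 3 (e * n + \<nu> z) \<longrightarrow> (\<forall>v. (v, a, z) \<in> transitions A \<longrightarrow> distinguished A u v))}"

lemma pairing_states_eq_iff:
  "v \<in> states A \<Longrightarrow> v' \<in> states A \<Longrightarrow> i * n + \<nu> v = i' * n + \<nu> v' \<longleftrightarrow> i = i' \<and> v = v'"
  using pairing_eq_iff[OF \<nu>_less \<nu>_less, of v v' i i'] \<nu>_eq_iff[of v v'] by simp

lemma model_0:
  "w \<in> states A \<Longrightarrow> z \<in> states A \<Longrightarrow> node 0 (\<nu> w * n + \<nu> z) \<in> model \<longleftrightarrow> distinguished A w z"
  unfolding model_def by (auto simp: pairing_states_eq_iff \<nu>_eq_iff)

lemma model_1:
  "w \<in> states A \<Longrightarrow> z \<in> states A \<Longrightarrow> node 1 (\<nu> w * n + \<nu> z) \<in> model \<longleftrightarrow> excluded A w z"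
  unfolding model_def by (auto simp: pairing_states_eq_iff \<nu>_eq_iff)

lemma model_2:
  "w \<in> states A \<Longrightarrow> z \<in> states A \<Longrightarrow> node 2 (\<nu> w * n + \<nu> z) \<in> model \<longleftrightarrow> violates A w z"
  unfolding model_def by (auto simp: pairing_states_eq_iff \<nu>_eq_iff)

lemma model_3:
  assumes "(u, a, w) \<in> transitions A" "e < m" "ts ! e = (\<nu> u, a, \<nu> w)" "z \<in> states A"
  shows "node 3 (e * n + \<nu> z) \<in> model \<longleftrightarrow> (\<forall>v. (v, a, z) \<in> transitions A \<longrightarrow> distinguished A u v)"
proof -
  have "u' = u \<and> a' = a"
    if "(u', a', w') \<in> transitions A" "ts ! e = (\<nu> u', a', \<nu> w')" for u' a' w'
    using that assms transitions_states[OF nfa] by (simp add: \<nu>_eq_iff)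
  then show ?thesis
    using assms transitions_states[OF nfa, OF assms(1)] unfolding model_def
    by (auto simp: pairing_states_eq_iff)
qed

text \<open>Edges into disjunctions replay single rules, conjunctions replay
  \<open>excluded_iff\<close> or their own meaning. The least closed set therefore contains nothing
  beyond the intended meaning.\<close>

lemma closed_model: "closed_set model"
proof -
  have odd: "y \<in> model" if y: "odd y" and pred: "\<And>x. (x, y) \<in> set es \<Longrightarrow> x \<in> model" for y
  proof (cases y rule: node_cases)
    case (2 p)
    have "excluded A w z" if wz: "w \<in> states A" "z \<in> states A" "p = \<nu> w * n + \<nu> z" for w z
    proof -
      have "node 0 p \<in> model" "node 2 p \<in> model"
        using graph_edgesI(1,2)[of p n] pair_less[OF wz(1,2)] wz(3) pred 2 by blast+
      then show ?thesis using wz by (simp add: model_0 model_2 excluded_iff)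
    qed
    then show ?thesis using 2 by (auto simp: model_def)
  next
    case (4 p)
    have "distinguished A u v" if t: "z \<in> states A" "(u, a, w) \<in> transitions A"
      "e < m" "ts ! e = (\<nu> u, a, \<nu> w)" "p = e * n + \<nu> z" "(v, a, z) \<in> transitions A" for u a w e z v
    proof -
      obtain f where f: "f < m" "ts ! f = (\<nu> v, a, \<nu> z)" using transition_index[OF t(6)] by blast
      have "node 0 (\<nu> u * n + \<nu> v) \<in> model"
        using graph_edgesI(6)[OF t(3,4) f] pred 4 t(5) by blast
      then show ?thesis using t transitions_states[OF nfa] model_0 by blast
    qed
    then show ?thesis using 4 by (auto simp: model_def)
  qed (use y in auto)
  \<comment> \<open>These disjunctions have threshold zero, but their numbers exceed those of all
    pairs of states, so the model contains them vacuously.\<close>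
  have junk: "y \<in> model" if "even y" "n * n \<le> y div 4" for y
    using that pair_less by (cases y rule: node_cases) (fastforce simp: model_def)+
  have even: "y \<in> model" if y: "even y" and x: "(x, y) \<in> set es" "x \<in> model" for x y
    using x(1)
  proof (cases rule: graph_edges_cases)
    case (1 p)
    then show ?thesis using y by simp
  next
    case (2 e u a w)
    obtain u' w' where u': "(u', a, w') \<in> transitions A" "w = \<nu> w'" "w' \<in> states A"
      using index_transition[OF 2(1,2)] by metis
    then have "Some a \<in> labels A w'" using labels_transition[OF nfa] by blast
    then have "\<not> labels_le A w' (init A)" by (force simp: labels_le_def labels_def[of A "init A"])
    then show ?thesis using 2 u' init_state by (simp add: model_2 violates_def)
  next
    case (3 e u a w z)
    obtain u' w' where u': "(u', a, w') \<in> transitions A" "u = \<nu> u'" "w = \<nu> w'" "w' \<in> states A"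
      using index_transition[OF 3(1,2)] by metis
    obtain z' where z': "z' \<in> states A" "z = \<nu> z'" using \<nu>_surj[OF 3(3)] by blast
    have d: "distinguished A u' v" if "(v, a, z') \<in> transitions A" for v
      using model_3[OF u'(1) 3(1) _ z'(1)] x(2) 3(2,4) u' z' that by simp
    have "distinguished A w' z'" by (rule distinguished.left[OF u'(1) z'(1) d])
    then show ?thesis using 3(5) u' z' distinguished_sym by (auto simp: model_0)
  next
    case (4 e u a w f v z)
    then show ?thesis using y by simp
  next
    case (5 e u a w f v z)
    obtain u' w' where u': "(u', a, w') \<in> transitions A" "u = \<nu> u'" "w = \<nu> w'" "u' \<in> states A" "w' \<in> states A"
      using index_transition[OF 5(1,2)] by metis
    obtain v' z' where v': "(v', a, z') \<in> transitions A" "v = \<nu> v'" "z = \<nu> z'" "v' \<in> states A" "z' \<in> states A"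
      using index_transition[OF 5(3,4)] by metis
    have "excluded A u' v'" using x(2) 5(5) u' v' model_1[of u' v'] by simp
    then show ?thesis using 5(6) u' v' by (auto simp: model_2 violates_def)
  next
    case (6 e u a w f v b z)
    obtain u' w' where u': "(u', a, w') \<in> transitions A" "w = \<nu> w'" "w' \<in> states A"
      using index_transition[OF 6(1,2)] by metis
    obtain v' z' where v': "(v', b, z') \<in> transitions A" "z = \<nu> z'" "z' \<in> states A"
      using index_transition[OF 6(3,4)] by metis
    have "Some a \<in> labels A w'" "Some b \<in> labels A z'" "\<not> Some a \<le> Some b"
      using u' v' labels_transition[OF nfa] 6(5) by auto
    then have "\<not> labels_le A w' z'" unfolding labels_le_def by blast
    then show ?thesis using 6 u' v' by (simp add: model_2 violates_def)
  qed
  show ?thesis unfolding threshold_closed_iff using odd junk even by blast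
qed

theorem least_closed_excluded:
  assumes "closed_set S" "\<And>X. closed_set X \<Longrightarrow> S \<subseteq> X" "u \<in> states A" "v \<in> states A"
  shows "node 1 (\<nu> u * n + \<nu> v) \<in> S \<longleftrightarrow> excluded A u v"
  using reached_excluded[OF assms(1)] assms(2)[OF closed_model] model_1[OF assms(3,4)] by blast

end

section \<open>The program\<close>

text \<open>Registers 0, 1, 2 keep the input; 3 holds the address \<open>B\<close> of the arrays, 4 the index of the
  next free edge record (0 being the null link), 5 and 6 the source and target of a new edge, 7
  and 8 loop variables, 9 the number of pairs of states, 10 the top node, 11 the number of nodes,
  12 the height of the stack, 13 to 18 the two current transitions, and 19 a link.\<close>

definition nodeE :: "nat \<Rightarrow> aexp \<Rightarrow> aexp" where
  "nodeE k e = Add (Mul (Const 4) e) (Const k)"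

definition pairE :: "nat \<Rightarrow> nat \<Rightarrow> aexp" where
  "pairE a b = Add (Mul (Reg a) (Reg 0)) (Reg b)"

lemma acost_nodeE [simp]: "acost (nodeE k e) = acost e + 4"
  by (simp add: nodeE_def)

lemma acost_pairE [simp]: "acost (pairE a b) = 5"
  by (simp add: pairE_def)

lemma aval_nodeE: "aval W e \<sigma> = Some p \<Longrightarrow> node k p < W \<Longrightarrow> 4 < W \<Longrightarrow> aval W (nodeE k e) \<sigma> = Some (node k p)"
  by (simp add: nodeE_def node_def)

lemma aval_pairE:
  "reg \<sigma> a = i \<Longrightarrow> reg \<sigma> 0 = n \<Longrightarrow> reg \<sigma> b = j \<Longrightarrow> i * n + j < W \<Longrightarrow>
    aval W (pairE a b) \<sigma> = Some (i * n + j)"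
  by (simp add: pairE_def)

text \<open>Only conjunctions count incoming edges, since only their threshold is the
  in-degree.\<close>

definition and_edge :: com where
  "and_edge = (add_edge ;; incr)"

text \<open>The edge from the node of kind 2 is inserted first because prepending reverses the order
  in \<open>pair_edges\<close>.\<close>

definition pair_com :: com where
  "pair_com =
     (Store (addr 3 (nodeE 0 (Reg 7))) (Const 1) ;;
      Store (addr 3 (nodeE 2 (Reg 7))) (Const 1) ;;
      Assign 6 (nodeE 1 (Reg 7)) ;;
      Assign 5 (nodeE 2 (Reg 7)) ;;
      and_edge ;;
      Assign 5 (nodeE 0 (Reg 7)) ;;
      and_edge)"

definition target_com :: com where
  "target_com =
     (Assign 5 (nodeE 3 (pairE 7 8)) ;;
      Assign 6 (nodeE 0 (pairE 15 8)) ;;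
      add_edge ;;
      Assign 6 (nodeE 0 (pairE 8 15)) ;;
      add_edge)"

definition letter_com :: com where
  "letter_com =
     (Assign 16 (Load (Mul (Const 3) (Reg 8))) ;;
      Assign 17 (Load (Add (Mul (Const 3) (Reg 8)) (Const 1))) ;;
      Assign 18 (Load (Add (Mul (Const 3) (Reg 8)) (Const 2))) ;;
      Assign 6 (nodeE 2 (pairE 15 18)) ;;
      If (Equal (Reg 14) (Reg 17))
        (Assign 5 (nodeE 1 (pairE 13 16)) ;;
         add_edge ;;
         Assign 5 (nodeE 0 (pairE 13 16)) ;;
         Assign 6 (nodeE 3 (pairE 7 18)) ;;
         and_edge)
        (If (Less (Reg 17) (Reg 14)) (Assign 5 (Reg 10) ;; add_edge) Skip))"

definition transition_com :: com where
  "transition_com =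
     (Assign 13 (Load (Mul (Const 3) (Reg 7))) ;;
      Assign 14 (Load (Add (Mul (Const 3) (Reg 7)) (Const 1))) ;;
      Assign 15 (Load (Add (Mul (Const 3) (Reg 7)) (Const 2))) ;;
      Assign 5 (Reg 10) ;;
      Assign 6 (nodeE 2 (pairE 15 2)) ;;
      add_edge ;;
      For 8 0 target_com ;;
      For 8 1 letter_com)"

definition build_com :: com where
  "build_com = (For 7 9 pair_com ;; For 7 1 transition_com)"

definition setup_com :: com where
  "setup_com =
     (Assign 3 (Mul (Const 3) (Reg 1)) ;;
      Assign 4 (Const 1) ;;
      Assign 9 (Mul (Reg 0) (Reg 0)) ;;
      Assign 10 (nodeE 3 (Add (Reg 9) (Mul (Reg 1) (Reg 0)))) ;;
      Assign 11 (Add (Reg 10) (Const 1)))"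

text \<open>The matrix is written from address 0 on. This is safe because the counter read for entry
  \<open>p\<close> and all later ones lie above address \<open>p\<close>.\<close>

definition output_com :: com where
  "output_com =
     (For 7 9 (Store (Reg 7)
        (Sub (Const 1) (Sub (Const 1) (Load (addr 3 (nodeE 1 (Reg 7))))))) ;;
      Assign 0 (Const 0))"

definition CFS_com :: com where
  "CFS_com = (setup_com ;; build_com ;; reach_com ;; output_com)"

section \<open>Verification and cost of the program\<close>

lemma threshold_Suc:
  "(threshold p es)(node 0 p := 1, node 2 p := 1) = threshold (Suc p) es"
proof
  fix y
  show "((threshold p es)(node 0 p := 1, node 2 p := 1)) y = threshold (Suc p) es y"
    by (cases y rule: node_cases) (auto simp: threshold_def less_Suc_eq)
qed

lemma threshold_even: "even y \<Longrightarrow> threshold P ((x, y) # es) = threshold P es"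
  by (auto simp: threshold_def fun_eq_iff)

lemma threshold_odd:
  "odd y \<Longrightarrow> threshold P ((x, y) # es) = (threshold P es)(y := Suc (threshold P es y))"
  by (auto simp: threshold_def fun_eq_iff)

lemma threshold_le: "threshold P es y \<le> Suc (length es)"
  by (auto simp: threshold_def intro: le_SucI)

lemma threshold_odd_le: "odd y \<Longrightarrow> threshold P es y \<le> length es"
  by (auto simp: threshold_def)

text \<open>\<open>M\<close> bounds node numbers and edge records alike: two edges per pair of
  states and, for each transition, two per transition, two per state and one for the initial state.
  Words must address the input and five interleaved arrays of length \<open>M\<close>.\<close>

locale ram =
  fixes W M n s :: nat and ts :: "(nat \<times> nat \<times> nat) list"
  assumes s: "s < n"
    and ts: "\<And>e u a w. e < length ts \<Longrightarrow> ts ! e = (u, a, w) \<Longrightarrow> u < n \<and> w < n"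
    and M: "4 * (n * n + length ts * n + 1) \<le> M"
      "2 * (n * n) + length ts * (2 * length ts + 2 * n + 1) + 4 \<le> M"
    and W: "3 * length ts + 5 * M + 5 < W"
begin

abbreviation "m \<equiv> length ts"
abbreviation "B \<equiv> 3 * m"
abbreviation "K \<equiv> 4 * (n * n + m * n + 1)"

definition tape :: "machine \<Rightarrow> bool" where
  "tape \<sigma> \<longleftrightarrow> (\<forall>e<m. (mem \<sigma> (3 * e), mem \<sigma> (3 * e + 1), mem \<sigma> (3 * e + 2)) = ts ! e)"

text \<open>\<open>P\<close> is separate from the edges because the disjunction counters are set in
  the first loop only, pair by pair. Register 12 is zero since the stack stays empty until the
  search.\<close>

definition inv :: "nat \<Rightarrow> (nat \<times> nat) list \<Rightarrow> machine \<Rightarrow> bool" where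
  "inv P es \<sigma> \<longleftrightarrow> reg \<sigma> 0 = n \<and> reg \<sigma> 1 = m \<and> reg \<sigma> 2 = s \<and> reg \<sigma> 3 = B \<and>
     reg \<sigma> 4 = Suc (length es) \<and> reg \<sigma> 9 = n * n \<and> reg \<sigma> 10 = top_node n m \<and> reg \<sigma> 11 = K \<and>
     reg \<sigma> 12 = 0 \<and> tape \<sigma> \<and> adjacency B es \<sigma> \<and> arr B (mem \<sigma>) 3 = threshold P es"

lemma tape_reg [simp]: "tape (\<sigma>\<lparr>reg := f\<rparr>) = tape \<sigma>"
  by (simp add: tape_def)

lemma tape_cong: "(\<And>i. i < B \<Longrightarrow> mem \<tau> i = mem \<sigma> i) \<Longrightarrow> tape \<tau> = tape \<sigma>"
  by (simp add: tape_def)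

lemma adjacency_reg [simp]: "adjacency B es (\<sigma>\<lparr>reg := f\<rparr>) = adjacency B es \<sigma>"
  by (simp add: adjacency_def)

lemma inv_reg [simp]:
  "r \<notin> {0, 1, 2, 3, 4, 9, 10, 11, 12} \<Longrightarrow>
    inv P es (\<sigma>\<lparr>reg := f(r := x)\<rparr>) = inv P es (\<sigma>\<lparr>reg := f\<rparr>)"
  by (auto simp: inv_def)

lemma inv_reg_id [simp]: "inv P es (\<sigma>\<lparr>reg := reg \<sigma>\<rparr>) = inv P es \<sigma>"
    "inv P es (\<sigma>\<lparr>mem := \<mu>, reg := reg \<sigma>\<rparr>) = inv P es (\<sigma>\<lparr>mem := \<mu>\<rparr>)"
  by (simp_all add: inv_def adjacency_def tape_def)

lemma invD:
  assumes "inv P es \<sigma>"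
  shows "reg \<sigma> 0 = n" "reg \<sigma> 1 = m" "reg \<sigma> 2 = s" "reg \<sigma> 3 = B" "reg \<sigma> 9 = n * n"
    "reg \<sigma> 10 = top_node n m"
  using assms by (simp_all add: inv_def)

lemma node_bounds:
  "p < n * n \<Longrightarrow> k < 4 \<Longrightarrow> node k p \<le> M" "p < m * n \<Longrightarrow> k < 4 \<Longrightarrow> node k p \<le> M" "top_node n m \<le> M"
  using M(1) by (simp_all add: node_def top_node_def)

lemma node_bounds_W:
  "p < n * n \<Longrightarrow> k < 4 \<Longrightarrow> node k p < W" "p < m * n \<Longrightarrow> k < 4 \<Longrightarrow> node k p < W"
  "p < n * n \<Longrightarrow> p < W" "p < m * n \<Longrightarrow> p < W" "top_node n m < W"
  "4 < W" "1 < W" "n * n < W" "m * n < W" "3 * m < W" "n < W" "m < W" "K < W"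
proof -
  have "n \<le> n * n" using s by simp
  then show "n < W" using M W by linarith
qed (use M W in \<open>simp_all add: node_def top_node_def\<close>)

lemma wp_add_edge_le:
  assumes "inv P es \<sigma>" "reg \<sigma> 5 = x" "reg \<sigma> 6 = y" "x \<le> M" "length es < M" "even y"
  shows "wp W add_edge \<sigma> (\<lambda>t \<tau>. t \<le> 41 \<and> (inv P ((x, y) # es) \<tau> \<and> (\<forall>r. r \<noteq> 4 \<longrightarrow> reg \<tau> r = reg \<sigma> r)))"
proof (rule wp_add_edge[where B = B and es = es and M = M])
  fix \<tau>
  assume \<tau>: "reg \<tau> = (reg \<sigma>)(4 := Suc (Suc (length es)))" "adjacency B ((reg \<sigma> 5, reg \<sigma> 6) # es) \<tau>"
    "arr B (mem \<tau>) 3 = arr B (mem \<sigma>) 3" "\<And>i. i < B \<Longrightarrow> mem \<tau> i = mem \<sigma> i"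
  have "tape \<tau>" using tape_cong[OF \<tau>(4)] assms(1) by (simp add: inv_def)
  then have "inv P ((x, y) # es) \<tau>"
    using assms \<tau>(1-3) by (simp add: inv_def threshold_even)
  then show "41 \<le> (41::nat) \<and> (inv P ((x, y) # es) \<tau> \<and> (\<forall>r. r \<noteq> 4 \<longrightarrow> reg \<tau> r = reg \<sigma> r))"
    using \<tau>(1) by simp
qed (use assms W in \<open>simp_all add: inv_def\<close>)

lemma wp_and_edge_le:
  assumes "inv P es \<sigma>" "reg \<sigma> 5 = x" "reg \<sigma> 6 = y" "x \<le> M" "y \<le> M" "length es < M" "odd y"
  shows "wp W and_edge \<sigma> (\<lambda>t \<tau>. t \<le> 60 \<and> (inv P ((x, y) # es) \<tau> \<and> (\<forall>r. r \<noteq> 4 \<longrightarrow> reg \<tau> r = reg \<sigma> r)))"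
  unfolding and_edge_def
proof (rule wp_Seq, rule wp_add_edge[where B = B and es = es and M = M])
  fix \<tau>
  assume \<tau>: "reg \<tau> = (reg \<sigma>)(4 := Suc (Suc (length es)))" "adjacency B ((reg \<sigma> 5, reg \<sigma> 6) # es) \<tau>"
    "arr B (mem \<tau>) 3 = arr B (mem \<sigma>) 3" "\<And>i. i < B \<Longrightarrow> mem \<tau> i = mem \<sigma> i"
  have t3: "arr B (mem \<tau>) 3 = threshold P es" using \<tau>(3) assms(1) by (simp add: inv_def)
  then have y3: "mem \<tau> (cell B 3 y) = threshold P es y" by (auto simp: arr_def fun_eq_iff)
  have a: "aval W (addr 3 (Reg 6)) \<tau> = Some (cell B 3 y)"
    by (rule aval_addr) (use assms \<tau>(1) W in \<open>simp_all add: inv_def\<close>)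
  \<comment> \<open>An in-degree is at most the number of edges, so the incremented counter is still
    a machine word.\<close>
  have "threshold P es y + 1 < W" using threshold_odd_le[OF assms(7), of P es] assms(6) W by simp
  then have b: "aval W (Add (Load (addr 3 (Reg 6))) (Const 1)) \<tau> = Some (Suc (threshold P es y))"
    using a y3 by simp
  let ?\<tau> = "\<tau>\<lparr>mem := (mem \<tau>)(cell B 3 y := Suc (threshold P es y))\<rparr>"
  have "tape ?\<tau>"
    using tape_cong[of ?\<tau> \<sigma>] \<tau>(4) assms(1) by (simp add: inv_def)
  moreover have "adjacency B ((x, y) # es) ?\<tau>"
    using \<tau>(2) assms(2,3) by (simp add: adjacency_def)
  moreover have "arr B (mem ?\<tau>) 3 = threshold P ((x, y) # es)"
    using t3 by (simp add: threshold_odd[OF assms(7)])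
  ultimately have "inv P ((x, y) # es) ?\<tau>"
    using assms(1) \<tau>(1) by (simp add: inv_def)
  then show "wp W incr \<tau> (\<lambda>t' \<rho>. 41 + t' + 1 \<le> 60 \<and>
      (inv P ((x, y) # es) \<rho> \<and> (\<forall>r. r \<noteq> 4 \<longrightarrow> reg \<rho> r = reg \<sigma> r)))"
    unfolding incr_def by (intro wp_Store[OF a b]) (use \<tau>(1) in simp)
qed (use assms W in \<open>simp_all add: inv_def\<close>)

lemma wp_add_edge_Seq:
  assumes "inv P es \<sigma>" "reg \<sigma> 5 = x" "reg \<sigma> 6 = y" "x \<le> M" "length es < M" "even y" "42 \<le> k"
    and "\<And>\<tau>. inv P ((x, y) # es) \<tau> \<Longrightarrow> (\<And>r. r \<noteq> 4 \<Longrightarrow> reg \<tau> r = reg \<sigma> r) \<Longrightarrow>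
      wp W q \<tau> (\<lambda>t \<rho>. t \<le> k - 42 \<and> R \<rho>)"
  shows "wp W (add_edge ;; q) \<sigma> (\<lambda>t \<rho>. t \<le> k \<and> R \<rho>)"
  by (rule wp_Seq_le[OF wp_add_edge_le[OF assms(1-6)]]) (use assms(7,8) in auto)

lemma wp_and_edge_Seq:
  assumes "inv P es \<sigma>" "reg \<sigma> 5 = x" "reg \<sigma> 6 = y" "x \<le> M" "y \<le> M" "length es < M" "odd y" "61 \<le> k"
    and "\<And>\<tau>. inv P ((x, y) # es) \<tau> \<Longrightarrow> (\<And>r. r \<noteq> 4 \<Longrightarrow> reg \<tau> r = reg \<sigma> r) \<Longrightarrow>
      wp W q \<tau> (\<lambda>t \<rho>. t \<le> k - 61 \<and> R \<rho>)"
  shows "wp W (and_edge ;; q) \<sigma> (\<lambda>t \<rho>. t \<le> k \<and> R \<rho>)"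
  by (rule wp_Seq_le[OF wp_and_edge_le[OF assms(1-7)]]) (use assms(8,9) in auto)

lemma aval_node_pair:
  assumes "reg \<sigma> 0 = n" "reg \<sigma> a = i" "reg \<sigma> b = j" "j < n" "k < 4" "i < n \<or> i < m"
  shows "aval W (nodeE k (pairE a b)) \<sigma> = Some (node k (i * n + j))"
proof (rule aval_nodeE)
  have *: "i * n + j < n * n \<or> i * n + j < m * n" using assms(4,6) pairing_less by blast
  then show "aval W (pairE a b) \<sigma> = Some (i * n + j)"
    using assms by (intro aval_pairE) (use node_bounds_W(3,4) in auto)
  show "node k (i * n + j) < W" using * node_bounds_W(1,2) assms(5) by blast
qed (rule node_bounds_W)

lemma node_pair_le:
  assumes "j < n" "k < 4" "i < n \<or> i < m"
  shows "node k (i * n + j) \<le> M"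
  using assms pairing_less[of i n j n] pairing_less[of i m j n] node_bounds(1,2) by blast

lemma wp_pair_com:
  assumes \<sigma>: "inv p es \<sigma>" "reg \<sigma> 7 = p" and p: "p < n * n" "length es + 2 \<le> M"
  shows "wp W pair_com \<sigma> (\<lambda>t \<tau>. t \<le> 200 \<and> (inv (Suc p) (pair_edges p @ es) \<tau> \<and> reg \<tau> 7 = p))"
proof -
  have N: "aval W (nodeE k (Reg 7)) \<tau> = Some (node k p)" if "reg \<tau> 7 = p" "k < 4" for k \<tau>
    by (rule aval_nodeE) (use that p node_bounds_W in simp_all)
  have A: "aval W (addr 3 (nodeE k (Reg 7))) \<tau> = Some (cell B 3 (node k p))"
    if "reg \<tau> 7 = p" "k < 4" "reg \<tau> 3 = B" for k \<tau>
    by (rule aval_addr[OF N]) (use that node_bounds(1)[OF p(1), of k] W in simp_all)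
  have regs: "reg \<sigma> 3 = B" using \<sigma> by (simp add: inv_def)
  let ?\<mu> = "(mem \<sigma>)(cell B 3 (node 0 p) := 1, cell B 3 (node 2 p) := 1)"
  \<comment> \<open>Setting the two counters moves the progress parameter from \<open>p\<close> to
    \<open>Suc p\<close> before any edge of this pair is inserted.\<close>
  have inv: "inv (Suc p) es (\<sigma>\<lparr>mem := ?\<mu>\<rparr>)"
  proof -
    have "tape (\<sigma>\<lparr>mem := ?\<mu>\<rparr>)" using tape_cong[of "\<sigma>\<lparr>mem := ?\<mu>\<rparr>" \<sigma>] \<sigma>(1) by (simp add: inv_def)
    moreover have "adjacency B es (\<sigma>\<lparr>mem := ?\<mu>\<rparr>)" using \<sigma>(1) by (simp add: inv_def adjacency_def)
    moreover have "arr B ?\<mu> 3 = threshold (Suc p) es"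
      using \<sigma>(1) by (simp add: inv_def threshold_Suc del: One_nat_def)
    ultimately show ?thesis using \<sigma>(1) by (simp add: inv_def)
  qed
  show ?thesis
    unfolding pair_com_def
    apply (rule wp_Store_Seq[OF A])
         apply (use \<sigma> regs node_bounds_W in simp_all)[3]
       apply (simp add: node_bounds_W del: One_nat_def)
      apply simp
    apply (rule wp_Store_Seq[OF A])
         apply (use \<sigma> regs node_bounds_W in simp_all)[3]
       apply (simp add: node_bounds_W del: One_nat_def)
      apply simp
    apply (rule wp_Assign_Seq[OF N])
       apply (use \<sigma> in simp_all)[2]
     apply simp
    apply (rule wp_Assign_Seq[OF N])
       apply (use \<sigma> in simp_all)[2]
     apply simp
    apply (rule wp_and_edge_Seq[where P = "Suc p" and es = es and x = "node 2 p" and y = "node 1 p"])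
            apply (use inv node_bounds(1)[OF p(1)] p in \<open>simp_all\<close>)[8]
    apply (rule wp_Assign_Seq[OF N])
       apply (use \<sigma> in simp_all)[2]
     apply simp
    apply (rule wp_le_mono[OF wp_and_edge_le[where P = "Suc p" and es = "(node 2 p, node 1 p) # es"
            and x = "node 0 p" and y = "node 1 p"]])
            apply (use inv node_bounds(1)[OF p(1)] p in \<open>simp_all\<close>)[8]
    apply (use \<sigma> in \<open>simp add: pair_edges_def\<close>)
    done
qed

lemma wp_target_com:
  assumes \<sigma>: "inv P es \<sigma>" "reg \<sigma> 7 = e" "reg \<sigma> 8 = z" "reg \<sigma> 15 = w"
    and e: "e < m" "ts ! e = (u, a, w)" "z < n" "length es + 2 \<le> M"
  shows "wp W target_com \<sigma> (\<lambda>t \<tau>. t \<le> 150 \<and>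
    (inv P (target_edges n ts e z @ es) \<tau> \<and> (\<forall>r\<ge>7. reg \<tau> r = reg \<sigma> r)))"
proof -
  have w: "w < n" using ts[OF e(1,2)] by simp
  have n: "reg \<sigma> 0 = n" using \<sigma> by (simp add: inv_def)
  show ?thesis
    unfolding target_com_def
    apply (rule wp_Assign_Seq[OF aval_node_pair[where i = e and j = z]])
           apply (use \<sigma> n e in simp_all)[6]
     apply simp
    apply (rule wp_Assign_Seq[OF aval_node_pair[where i = w and j = z]])
           apply (use \<sigma> n e w in simp_all)[6]
     apply simp
    apply (rule wp_add_edge_Seq[where P = P and es = es and x = "node 3 (e * n + z)"
          and y = "node 0 (w * n + z)"])
           apply (use \<sigma> node_pair_le e w in \<open>simp_all\<close>)[7]
    apply (rule wp_Assign_Seq[OF aval_node_pair[where i = z and j = w]])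
           apply (use \<sigma> n e w in simp_all)[6]
     apply simp
    apply (rule wp_le_mono[OF wp_add_edge_le[where P = P and x = "node 3 (e * n + z)"
          and y = "node 0 (z * n + w)" and es = "(node 3 (e * n + z), node 0 (w * n + z)) # es"]])
           apply (use \<sigma> node_pair_le e w in \<open>simp_all\<close>)[7]
    apply (use e in \<open>simp add: target_edges_def\<close>)
    done
qed

lemma aval_tape:
  assumes "tape \<sigma>" "reg \<sigma> r = f" "f < m" "ts ! f = (v, b, z)"
  shows "aval W (Load (Mul (Const 3) (Reg r))) \<sigma> = Some v"
    "aval W (Load (Add (Mul (Const 3) (Reg r)) (Const 1))) \<sigma> = Some b"
    "aval W (Load (Add (Mul (Const 3) (Reg r)) (Const 2))) \<sigma> = Some z"
proof -
  have *: "mem \<sigma> (3 * f) = v" "mem \<sigma> (3 * f + 1) = b" "mem \<sigma> (3 * f + 2) = z"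
    using assms by (auto simp: tape_def)
  have W: "3 < W" "2 < W" "1 < W" "3 * f < W" "3 * f + 1 < W" "3 * f + 2 < W"
    using W assms(3) by simp_all
  show "aval W (Load (Mul (Const 3) (Reg r))) \<sigma> = Some v"
    "aval W (Load (Add (Mul (Const 3) (Reg r)) (Const 1))) \<sigma> = Some b"
    "aval W (Load (Add (Mul (Const 3) (Reg r)) (Const 2))) \<sigma> = Some z"
    using W * assms(2) by simp_all
qed

lemma inv_tape: "inv P es \<sigma> \<Longrightarrow> tape \<sigma>"
  by (simp add: inv_def)

lemma wp_letter_com:
  assumes \<sigma>: "inv P es \<sigma>" "reg \<sigma> 7 = e" "reg \<sigma> 8 = f" "reg \<sigma> 13 = u" "reg \<sigma> 14 = a" "reg \<sigma> 15 = w"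
    and e: "e < m" "ts ! e = (u, a, w)" "f < m" "length es + 2 \<le> M"
  shows "wp W letter_com \<sigma> (\<lambda>t \<tau>. t \<le> 250 \<and>
    (inv P (letter_edges n (top_node n m) ts e f @ es) \<tau> \<and> (\<forall>r\<in>{7, 8, 13, 14, 15}. reg \<tau> r = reg \<sigma> r)))"
proof -
  obtain v b z where f: "ts ! f = (v, b, z)" by (metis prod_cases3)
  have bd: "u < n" "w < n" "v < n" "z < n" using ts[OF e(1,2)] ts[OF e(3) f] by simp_all
  have n: "reg \<sigma> 0 = n" using \<sigma> by (simp add: inv_def)
  let ?h = "top_node n m"
  let ?\<sigma> = "\<sigma>\<lparr>reg := (reg \<sigma>)(16 := v, 17 := b, 18 := z, 6 := node 2 (w * n + z))\<rparr>"
  let ?R = "\<lambda>\<tau>. inv P (letter_edges n ?h ts e f @ es) \<tau> \<and> (\<forall>r\<in>{7, 8, 13, 14, 15}. reg \<tau> r = reg \<sigma> r)"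
  have b1: "bval W (Equal (Reg 14) (Reg 17)) ?\<sigma> = Some (a = b)"
    and b2: "bval W (Less (Reg 17) (Reg 14)) ?\<sigma> = Some (b < a)" using \<sigma> by simp_all
  have inv: "inv P es ?\<sigma>" using \<sigma>(1) by simp
  have eq: "wp W (Assign 5 (nodeE 1 (pairE 13 16)) ;; add_edge ;; Assign 5 (nodeE 0 (pairE 13 16)) ;;
      Assign 6 (nodeE 3 (pairE 7 18)) ;; and_edge) ?\<sigma> (\<lambda>t \<tau>. t \<le> 160 \<and> ?R \<tau>)" if ab: "a = b"
    apply (rule wp_Assign_Seq[OF aval_node_pair[where i = u and j = v]])
           apply (use \<sigma> n bd in simp_all)[6]
     apply simp
    apply (rule wp_add_edge_Seq[where P = P and es = es and x = "node 1 (u * n + v)"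
          and y = "node 2 (w * n + z)"])
           apply (use \<sigma> node_pair_le e bd in \<open>simp_all\<close>)[7]
    apply (rule wp_Assign_Seq[OF aval_node_pair[where i = u and j = v]])
           apply (use \<sigma> n bd in simp_all)[6]
     apply simp
    apply (rule wp_Assign_Seq[OF aval_node_pair[where i = e and j = z]])
           apply (use \<sigma> n bd e in simp_all)[6]
     apply simp
    apply (rule wp_le_mono[OF wp_and_edge_le[where P = P and x = "node 0 (u * n + v)"
          and y = "node 3 (e * n + z)" and es = "(node 1 (u * n + v), node 2 (w * n + z)) # es"]])
            apply (use \<sigma> node_pair_le e bd in \<open>simp_all\<close>)[8]
    apply (use e f ab in \<open>simp add: letter_edges_def\<close>)
    done
  have less: "wp W (Assign 5 (Reg 10) ;; add_edge) ?\<sigma> (\<lambda>t \<tau>. t \<le> 60 \<and> ?R \<tau>)" if ab: "b < a"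
    apply (rule wp_Assign_Seq[where x = ?h])
      apply (use invD[OF \<sigma>(1)] in simp)
     apply simp
    apply (rule wp_le_mono[OF wp_add_edge_le[where P = P and x = ?h
          and y = "node 2 (w * n + z)" and es = es]])
           apply (use \<sigma> node_bounds(3) e in \<open>simp_all\<close>)[7]
    apply (use e f ab in \<open>simp add: letter_edges_def\<close>)
    done
  have skip: "wp W Skip ?\<sigma> (\<lambda>t \<tau>. t \<le> 60 \<and> ?R \<tau>)" if "\<not> b < a" "a \<noteq> b"
    by (rule wp_Skip) (use inv e f that in \<open>simp add: letter_edges_def\<close>)
  have inner: "wp W (If (Less (Reg 17) (Reg 14)) (Assign 5 (Reg 10) ;; add_edge) Skip) ?\<sigma>
      (\<lambda>t \<tau>. t \<le> 160 \<and> ?R \<tau>)" if "a \<noteq> b"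
    by (rule wp_If_le[OF b2, where k = 60]) (use less skip that in auto)
  have outer: "wp W (If (Equal (Reg 14) (Reg 17))
        (Assign 5 (nodeE 1 (pairE 13 16)) ;; add_edge ;; Assign 5 (nodeE 0 (pairE 13 16)) ;;
         Assign 6 (nodeE 3 (pairE 7 18)) ;; and_edge)
        (If (Less (Reg 17) (Reg 14)) (Assign 5 (Reg 10) ;; add_edge) Skip)) ?\<sigma>
      (\<lambda>t \<tau>. t \<le> 170 \<and> ?R \<tau>)"
    by (rule wp_If_le[OF b1, where k = 160]) (use eq inner in \<open>cases "a = b"; simp\<close>)+
  show ?thesis
    unfolding letter_com_def
    apply (rule wp_Assign_Seq[OF aval_tape(1)[OF _ _ e(3) f]])
       apply (use \<sigma> inv_tape in simp_all)[3]
    apply (rule wp_Assign_Seq[OF aval_tape(2)[OF _ _ e(3) f]])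
       apply (use \<sigma> inv_tape in simp_all)[3]
    apply (rule wp_Assign_Seq[OF aval_tape(3)[OF _ _ e(3) f]])
       apply (use \<sigma> inv_tape in simp_all)[3]
    apply (rule wp_Assign_Seq[OF aval_node_pair[where i = w and j = z]])
           apply (use \<sigma> n bd in simp_all)[6]
     apply simp
    apply (rule wp_le_mono[where k = 170 and R = ?R])
      apply (use outer in simp)
     apply simp
    apply simp
    done
qed

text \<open>Stated for partially executed loops, so that it also bounds the edge list in the middle
  of a round.\<close>

lemma length_transition_edges:
  "length (accumulate (letter_edges n h ts e) k (accumulate (target_edges n ts e) k'
     (init_edges n s h ts e))) \<le> 2 * k + 2 * k' + 1"
proof -
  have 1: "length (letter_edges n h ts e f) \<le> 2" for f
    by (auto simp: letter_edges_def split: prod.splits)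
  have 2: "length (target_edges n ts e z) \<le> 2" for z
    by (auto simp: target_edges_def split: prod.splits)
  have 3: "length (init_edges n s h ts e) = 1"
    by (auto simp: init_edges_def split: prod.splits)
  show ?thesis
    using length_accumulate[of k "letter_edges n h ts e" 2 "accumulate (target_edges n ts e) k'
     (init_edges n s h ts e)"] length_accumulate[of k' "target_edges n ts e" 2 "init_edges n s h ts e"]
      1 2 3 by simp
qed

lemma wp_transition_com:
  assumes \<sigma>: "inv P es \<sigma>" "reg \<sigma> 7 = e" and e: "e < m" "length es + (2 * m + 2 * n + 1) + 2 \<le> M"
  shows "wp W transition_com \<sigma> (\<lambda>t \<tau>. t \<le> 159 * n + 259 * m + 150 \<and>
    (inv P (transition_edges n s (top_node n m) ts e @ es) \<tau> \<and> reg \<tau> 7 = e))"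
proof -
  obtain u a w where ea: "ts ! e = (u, a, w)" by (metis prod_cases3)
  have w: "w < n" using ts[OF e(1) ea] by simp
  let ?h = "top_node n m"
  let ?regs = "\<lambda>\<tau>. reg \<tau> 7 = e \<and> reg \<tau> 13 = u \<and> reg \<tau> 14 = a \<and> reg \<tau> 15 = w"
  let ?es1 = "init_edges n s ?h ts e"
  let ?es2 = "accumulate (target_edges n ts e) n ?es1"
  have targets: "wp W (For 8 0 target_com) \<tau> (\<lambda>t \<rho>. t \<le> (150 + 9) * n + 7 \<and> (inv P (?es2 @ es) \<rho> \<and> ?regs \<rho>))"
    if \<tau>: "inv P (?es1 @ es) \<tau>" "?regs \<tau>" for \<tau>
  proof -
    let ?I = "\<lambda>i \<rho>. inv P (accumulate (target_edges n ts e) i ?es1 @ es) \<rho> \<and> ?regs \<rho>"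
    have "wp W (For 8 0 target_com) \<tau> (\<lambda>t \<rho>. ?I n \<rho> \<and> t \<le> (150 + 9) * n + 7)"
    proof (rule wp_For[where I = ?I])
      show "n < W" by (rule node_bounds_W)
      show "?I 0 (\<tau>\<lparr>reg := (reg \<tau>)(8 := 0)\<rparr>)" using \<tau> by simp
      show "reg \<rho> 0 = n" if "?I i \<rho>" for i \<rho> using that invD(1) by blast
      fix i \<rho> assume I: "?I i \<rho>" and i: "i < n" "reg \<rho> 8 = i"
      have len: "length (accumulate (target_edges n ts e) i ?es1 @ es) + 2 \<le> M"
        using length_transition_edges[of ?h e 0 i] i(1) e(2) by simp
      show "wp W target_com \<rho> (\<lambda>t \<tau>. t \<le> 150 \<and> reg \<tau> 8 = i \<and> ?I (Suc i) (\<tau>\<lparr>reg := (reg \<tau>)(8 := Suc i)\<rparr>))"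
        by (rule wp_le_mono[OF wp_target_com[OF _ _ i(2) _ e(1) ea i(1) len]])
          (use I i in auto)
    qed
    then show ?thesis by (rule wp_mono) simp
  qed
  let ?es3 = "accumulate (letter_edges n ?h ts e) m ?es2"
  have letters: "wp W (For 8 1 letter_com) \<tau> (\<lambda>t \<rho>. t \<le> (250 + 9) * m + 7 \<and> (inv P (?es3 @ es) \<rho> \<and> ?regs \<rho>))"
    if \<tau>: "inv P (?es2 @ es) \<tau>" "?regs \<tau>" for \<tau>
  proof -
    let ?I = "\<lambda>i \<rho>. inv P (accumulate (letter_edges n ?h ts e) i ?es2 @ es) \<rho> \<and> ?regs \<rho>"
    have "wp W (For 8 1 letter_com) \<tau> (\<lambda>t \<rho>. ?I m \<rho> \<and> t \<le> (250 + 9) * m + 7)"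
    proof (rule wp_For[where I = ?I])
      show "m < W" by (rule node_bounds_W)
      show "?I 0 (\<tau>\<lparr>reg := (reg \<tau>)(8 := 0)\<rparr>)" using \<tau> by simp
      show "reg \<rho> 1 = m" if "?I i \<rho>" for i \<rho> using that invD(2) by blast
      fix i \<rho> assume I: "?I i \<rho>" and i: "i < m" "reg \<rho> 8 = i"
      have len: "length (accumulate (letter_edges n ?h ts e) i ?es2 @ es) + 2 \<le> M"
        using length_transition_edges[of ?h e i n] i(1) e(2) by simp
      show "wp W letter_com \<rho> (\<lambda>t \<tau>. t \<le> 250 \<and> reg \<tau> 8 = i \<and> ?I (Suc i) (\<tau>\<lparr>reg := (reg \<tau>)(8 := Suc i)\<rparr>))"
        by (rule wp_le_mono[OF wp_letter_com[OF _ _ i(2) _ _ _ e(1) ea i(1) len]])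
          (use I i in auto)
    qed
    then show ?thesis by (rule wp_mono) simp
  qed
  have loops: "wp W (For 8 0 target_com ;; For 8 1 letter_com) \<tau> (\<lambda>t \<rho>. t \<le> 159 * n + 259 * m + 15 \<and>
      (inv P (transition_edges n s ?h ts e @ es) \<rho> \<and> reg \<rho> 7 = e))"
    if "inv P (?es1 @ es) \<tau>" "?regs \<tau>" for \<tau>
    by (rule wp_Seq_le[OF targets[OF that]], rule wp_le_mono[OF letters])
      (auto simp: transition_edges_def)
  have es1: "?es1 = [(?h, node 2 (w * n + s))]" by (simp add: init_edges_def ea)
  show ?thesis
    unfolding transition_com_def
    apply (rule wp_Assign_Seq[OF aval_tape(1)[OF _ _ e(1) ea]])
       apply (use \<sigma> inv_tape in simp_all)[3]
    apply (rule wp_Assign_Seq[OF aval_tape(2)[OF _ _ e(1) ea]])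
       apply (use \<sigma> inv_tape in simp_all)[3]
    apply (rule wp_Assign_Seq[OF aval_tape(3)[OF _ _ e(1) ea]])
       apply (use \<sigma> inv_tape in simp_all)[3]
    apply (rule wp_Assign_Seq[where x = ?h])
      apply (use invD[OF \<sigma>(1)] in simp)
     apply simp
    apply (rule wp_Assign_Seq[OF aval_node_pair[where i = w and j = s]])
           apply (use invD[OF \<sigma>(1)] w s in simp_all)[6]
     apply simp
    apply (rule wp_add_edge_Seq[where P = P and es = es and x = ?h and y = "node 2 (w * n + s)"])
           apply (use \<sigma> node_bounds(3) e in \<open>simp_all\<close>)[7]
    apply (rule wp_le_mono[OF loops])
       apply (use \<sigma> es1 in \<open>simp_all\<close>)
    done
qed

lemma accumulate_transitions_length:
  "length (accumulate (transition_edges n s h ts) k es) \<le> (2 * m + 2 * n + 1) * k + length es"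
  by (rule length_accumulate) (use length_transition_edges in \<open>auto simp: transition_edges_def\<close>)

lemma accumulate_pairs_length: "length (accumulate pair_edges k []) \<le> 2 * k"
  using length_accumulate[of k pair_edges 2 "[]"] by (simp add: pair_edges_def)

lemma wp_build:
  assumes "inv 0 [] \<sigma>"
  shows "wp W build_com \<sigma> (\<lambda>t \<tau>.
    t \<le> 209 * (n * n) + (159 * n + 259 * m + 159) * m + 15 \<and> inv (n * n) (graph_edges n s ts) \<tau>)"
proof -
  let ?h = "top_node n m"
  let ?es = "accumulate pair_edges (n * n) []"
  have pairs: "wp W (For 7 9 pair_com) \<sigma> (\<lambda>t \<rho>. inv (n * n) ?es \<rho> \<and> t \<le> (200 + 9) * (n * n) + 7)"
  proof (rule wp_For[where I = "\<lambda>i. inv i (accumulate pair_edges i [])"])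
    show "n * n < W" by (rule node_bounds_W)
    show "inv 0 (accumulate pair_edges 0 []) (\<sigma>\<lparr>reg := (reg \<sigma>)(7 := 0)\<rparr>)" using assms by simp
    show "reg \<rho> 9 = n * n" if "inv i (accumulate pair_edges i []) \<rho>" for i \<rho> using that by (rule invD)
    fix i \<rho> assume I: "inv i (accumulate pair_edges i []) \<rho>" and i: "i < n * n" "reg \<rho> 7 = i"
    have len: "length (accumulate pair_edges i []) + 2 \<le> M"
      using accumulate_pairs_length[of i] i(1) M(2) by linarith
    show "wp W pair_com \<rho> (\<lambda>t \<tau>. t \<le> 200 \<and> reg \<tau> 7 = i \<and>
        inv (Suc i) (accumulate pair_edges (Suc i) []) (\<tau>\<lparr>reg := (reg \<tau>)(7 := Suc i)\<rparr>))"
      by (rule wp_le_mono[OF wp_pair_com[OF I i(2,1) len]]) auto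
  qed
  let ?I = "\<lambda>i. inv (n * n) (accumulate (transition_edges n s ?h ts) i ?es)"
  have transitions: "wp W (For 7 1 transition_com) \<tau> (\<lambda>t \<rho>. ?I m \<rho> \<and>
      t \<le> ((159 * n + 259 * m + 150) + 9) * m + 7)" if "inv (n * n) ?es \<tau>" for \<tau>
  proof (rule wp_For[where I = ?I])
    show "m < W" by (rule node_bounds_W)
    show "?I 0 (\<tau>\<lparr>reg := (reg \<tau>)(7 := 0)\<rparr>)" using that by simp
    show "reg \<rho> 1 = m" if "?I i \<rho>" for i \<rho> using that by (rule invD)
    fix i \<rho> assume I: "?I i \<rho>" and i: "i < m" "reg \<rho> 7 = i"
    \<comment> \<open>Space is needed for the full block of the current transition, hence
      \<open>Suc i\<close> instead of \<open>i\<close>.\<close>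
    have "(2 * m + 2 * n + 1) * Suc i \<le> (2 * m + 2 * n + 1) * m" using i(1) by (intro mult_le_mono2) simp
    then have "length (accumulate (transition_edges n s ?h ts) i ?es) + (2 * m + 2 * n + 1) + 2 \<le>
        (2 * m + 2 * n + 1) * m + 2 * (n * n) + 2"
      using accumulate_transitions_length[of ?h i ?es] accumulate_pairs_length[of "n * n"] by simp
    also have "\<dots> \<le> M" using M(2) by (simp add: mult.commute)
    finally have len: "length (accumulate (transition_edges n s ?h ts) i ?es) + (2 * m + 2 * n + 1) + 2 \<le> M" .
    show "wp W transition_com \<rho> (\<lambda>t \<tau>. t \<le> 159 * n + 259 * m + 150 \<and> reg \<tau> 7 = i \<and>
        ?I (Suc i) (\<tau>\<lparr>reg := (reg \<tau>)(7 := Suc i)\<rparr>))"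
      by (rule wp_le_mono[OF wp_transition_com[OF I i(2,1) len]]) auto
  qed
  show ?thesis unfolding build_com_def
    by (rule wp_Seq, rule wp_mono[OF pairs], elim conjE, rule wp_mono[OF transitions])
      (auto simp: graph_edges_def algebra_simps)
qed

definition fresh :: "machine \<Rightarrow> bool" where
  "fresh \<sigma> \<longleftrightarrow> reg \<sigma> 0 = n \<and> reg \<sigma> 1 = m \<and> reg \<sigma> 2 = s \<and> reg \<sigma> 12 = 0 \<and> tape \<sigma> \<and>
     (\<forall>i\<ge>B. mem \<sigma> i = 0)"

lemma wp_setup:
  assumes "fresh \<sigma>"
  shows "wp W setup_com \<sigma> (\<lambda>t \<tau>. t \<le> 60 \<and> inv 0 [] \<tau>)"
proof -
  have regs: "reg \<sigma> 0 = n" "reg \<sigma> 1 = m" "reg \<sigma> 2 = s" "reg \<sigma> 12 = 0" using assms by (simp_all add: fresh_def)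
  have W: "n * n + m * n < W" "3 < W" "4 * (n * n + m * n) + 3 < W" "4 * (n * n + m * n) + 4 < W"
    "4 * (n * n + m * n) < W"
    using M W by simp_all
  let ?\<tau> = "\<sigma>\<lparr>reg := (reg \<sigma>)(3 := B, 4 := 1, 9 := n * n, 10 := top_node n m, 11 := K)\<rparr>"
  have zero: "mem \<sigma> (cell B j i) = 0" for i j using assms by (simp add: fresh_def cell_def)
  \<comment> \<open>Zeroed memory represents both empty lists, 0 being the null link, and the
    counters of a graph without edges and without treated pairs.\<close>
  have "inv 0 [] ?\<tau>"
    using assms regs zero by (simp add: inv_def fresh_def adjacency_def succs_def threshold_def arr_def fun_eq_iff)
  moreover have "K = top_node n m + 1" by (simp add: top_node_def node_def)
  ultimately show ?thesis
    unfolding setup_com_def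
    apply -
    apply (rule wp_Assign_Seq[where x = B])
      apply (use regs node_bounds_W W in simp)
     apply simp
    apply (rule wp_Assign_Seq[where x = 1])
      apply (use node_bounds_W in simp)
     apply simp
    apply (rule wp_Assign_Seq[where x = "n * n"])
      apply (use regs node_bounds_W in simp)
     apply simp
    apply (rule wp_Assign_Seq[OF aval_nodeE[where p = "n * n + m * n"]])
        apply (use regs node_bounds_W W in simp)
       apply (use node_bounds_W(5) in \<open>simp add: top_node_def\<close>)
      apply (rule node_bounds_W(6))
     apply simp
    apply (rule wp_Assign[where x = K])
     apply (use node_bounds_W in \<open>simp add: top_node_def\<close>)
    apply (simp add: top_node_def)
    done
qed

lemma wp_output:
  assumes \<sigma>: "reg \<sigma> 3 = B" "reg \<sigma> 9 = n * n"
    and S: "\<And>y. y < K \<Longrightarrow> arr B (mem \<sigma>) 3 y = 0 \<longleftrightarrow> y \<in> S"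
  shows "wp W output_com \<sigma> (\<lambda>t \<tau>. t \<le> 27 * (n * n) + 10 \<and>
    (reg \<tau> 0 = 0 \<and> (\<forall>p<n * n. mem \<tau> p = of_bool (node 1 p \<notin> S))))"
proof -
  \<comment> \<open>Two truncated subtractions from one compute the sign of the counter: 0 for a
    reached, that is excluded, pair and 1 otherwise.\<close>
  let ?e = "Sub (Const 1) (Sub (Const 1) (Load (addr 3 (nodeE 1 (Reg 7)))))"
  let ?I = "\<lambda>i (\<rho> :: machine). reg \<rho> 3 = B \<and> reg \<rho> 9 = n * n \<and> (\<forall>a\<ge>i. mem \<rho> a = mem \<sigma> a) \<and>
    (\<forall>p<i. mem \<rho> p = of_bool (node 1 p \<notin> S))"
  have "wp W (For 7 9 (Store (Reg 7) ?e)) \<sigma> (\<lambda>t \<tau>. ?I (n * n) \<tau> \<and> t \<le> (18 + 9) * (n * n) + 7)"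
  proof (rule wp_For[where I = ?I])
    show "n * n < W" by (rule node_bounds_W)
    show "?I 0 (\<sigma>\<lparr>reg := (reg \<sigma>)(7 := 0)\<rparr>)" using \<sigma> by simp
    show "reg \<rho> 9 = n * n" if "?I i \<rho>" for i \<rho> using that by simp
    fix i \<rho> assume I: "?I i \<rho>" and i: "i < n * n" "reg \<rho> 7 = i"
    have "aval W (nodeE 1 (Reg 7)) \<rho> = Some (node 1 i)"
      by (rule aval_nodeE) (use i node_bounds_W in simp_all)
    then have a: "aval W (addr 3 (nodeE 1 (Reg 7))) \<rho> = Some (cell B 3 (node 1 i))"
      by (rule aval_addr) (use I node_bounds(1)[OF i(1), of 1] W in simp_all)
    have "i \<le> cell B 3 (node 1 i)" by (simp add: cell_def node_def)
    then have "mem \<rho> (cell B 3 (node 1 i)) = mem \<sigma> (cell B 3 (node 1 i))" using I by blast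
    moreover have "node 1 i < K"
      using node_less_iff[of 1 i "n * n + m * n + 1"] i(1) by simp
    then have "mem \<sigma> (cell B 3 (node 1 i)) = 0 \<longleftrightarrow> node 1 i \<in> S" using S by (simp add: arr_def)
    ultimately have e: "aval W ?e \<rho> = Some (of_bool (node 1 i \<notin> S))"
      using a node_bounds_W(7) by auto
    show "wp W (Store (Reg 7) ?e) \<rho> (\<lambda>t \<tau>. t \<le> 18 \<and> reg \<tau> 7 = i \<and> ?I (Suc i) (\<tau>\<lparr>reg := (reg \<tau>)(7 := Suc i)\<rparr>))"
      by (rule wp_Store[OF _ e, where i = i]) (use I i in \<open>auto simp: less_Suc_eq\<close>)
  qed
  then show ?thesis
    unfolding output_com_def
    using node_bounds_W by (intro wp_Seq, elim wp_mono) (auto intro!: wp_Assign)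
qed

text \<open>The search scans and stacks nodes below \<open>K\<close> only, so no edge may leave this
  range.\<close>

lemma graph_edges_less:
  assumes "(x, y) \<in> set (graph_edges n s ts)"
  shows "y < K"
proof -
  have *: "node k (i * n + j) < K" if "i < n \<or> i < m" "j < n" "k < 4" for i j k
    using node_less_iff[of k "i * n + j" "n * n + m * n + 1"] pairing_less[of i n j n]
      pairing_less[of i m j n] that by auto
  show ?thesis
    using assms
  proof (cases rule: graph_edges_cases)
    case (1 p)
    then show ?thesis using node_less_iff[of 1 p "n * n + m * n + 1"] by simp
  next
    case (2 e u a w)
    then show ?thesis using *[of w s 2] s ts[OF 2(1,2)] by simp
  next
    case (3 e u a w z)
    then show ?thesis using *[of z w 0] *[of w z 0] ts[OF 3(1,2)] by auto
  next
    case (4 e u a w f v z)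
    then show ?thesis using *[of e z 3] ts[OF 4(3,4)] by simp
  next
    case (5 e u a w f v z)
    then show ?thesis using *[of w z 2] ts[OF 5(1,2)] ts[OF 5(3,4)] by simp
  next
    case (6 e u a w f v b z)
    then show ?thesis using *[of w z 2] ts[OF 6(1,2)] ts[OF 6(3,4)] by simp
  qed
qed

lemma length_graph_edges: "length (graph_edges n s ts) \<le> (2 * m + 2 * n + 1) * m + 2 * (n * n)"
  unfolding graph_edges_def
  using accumulate_transitions_length[of "top_node n m" m "accumulate pair_edges (n * n) []"]
    accumulate_pairs_length[of "n * n"] by linarith

lemma wp_reach_graph:
  assumes "inv (n * n) (graph_edges n s ts) \<sigma>"
  shows "wp W reach_com \<sigma> (\<lambda>t \<tau>. t \<le> 78 * K + 85 * ((2 * m + 2 * n + 1) * m + 2 * (n * n)) + 12 \<and>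
    (reg \<tau> 3 = B \<and> reg \<tau> 9 = n * n \<and>
     (\<exists>S. threshold_closed K (threshold (n * n) (graph_edges n s ts)) (graph_edges n s ts) S \<and>
       (\<forall>X. threshold_closed K (threshold (n * n) (graph_edges n s ts)) (graph_edges n s ts) X \<longrightarrow> S \<subseteq> X) \<and>
       (\<forall>y<K. arr B (mem \<tau>) 3 y = 0 \<longleftrightarrow> y \<in> S))))"
proof -
  let ?es = "graph_edges n s ts" and ?\<mu> = "mem \<sigma>"
  have len: "length ?es < M" using length_graph_edges M(2) by (simp add: mult.commute)
  interpret reach W B M K "threshold (n * n) ?es" ?es "arr B ?\<mu> 1" "arr B ?\<mu> 2" "arr B ?\<mu> 0" "reg \<sigma>"
  proof
    show "y < K" if "(x, y) \<in> set ?es" for x y using that by (rule graph_edges_less)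
    show "chain (Suc (length ?es)) (arr B ?\<mu> 1) (arr B ?\<mu> 2) (arr B ?\<mu> 0 x) (succs ?es x)" for x
      using assms by (simp add: inv_def adjacency_def)
    show "K \<le> M" "B + 5 * M + 5 < W" by (rule M(1), rule W)
    show "length ?es < M" by (rule len)
    show "threshold (n * n) ?es y < W" for y using threshold_le[of "n * n" ?es y] len W by linarith
    show "reg \<sigma> 3 = B" "reg \<sigma> 11 = K" using assms by (simp_all add: inv_def)
  qed
  have "base \<sigma>" unfolding base_def by blast
  moreover have "arr B ?\<mu> 3 = threshold (n * n) ?es" "reg \<sigma> 12 = 0" using assms by (simp_all add: inv_def)
  ultimately show ?thesis
    by (rule wp_mono[OF wp_reach]) (use assms length_graph_edges in \<open>auto simp: inv_def\<close>)
qed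

lemma wp_CFS_com:
  assumes "fresh \<sigma>"
  shows "wp W CFS_com \<sigma> (\<lambda>t \<tau>. t \<le> 209 * (n * n) + (159 * n + 259 * m + 159) * m +
      (78 * K + 85 * ((2 * m + 2 * n + 1) * m + 2 * (n * n))) + 27 * (n * n) + 100 \<and>
    (reg \<tau> 0 = 0 \<and>
     (\<exists>S. threshold_closed K (threshold (n * n) (graph_edges n s ts)) (graph_edges n s ts) S \<and>
       (\<forall>X. threshold_closed K (threshold (n * n) (graph_edges n s ts)) (graph_edges n s ts) X \<longrightarrow> S \<subseteq> X) \<and>
       (\<forall>p<n * n. mem \<tau> p = of_bool (node 1 p \<notin> S)))))"
  (is "wp W CFS_com \<sigma> (\<lambda>t \<tau>. t \<le> ?t1 + ?t2 + ?t3 + 100 \<and> ?R \<tau>)")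
proof -
  have out: "wp W output_com \<tau> (\<lambda>t \<tau>. t \<le> ?t3 + 10 \<and> ?R \<tau>)"
    if \<tau>: "reg \<tau> 3 = B \<and> reg \<tau> 9 = n * n \<and>
     (\<exists>S. threshold_closed K (threshold (n * n) (graph_edges n s ts)) (graph_edges n s ts) S \<and>
       (\<forall>X. threshold_closed K (threshold (n * n) (graph_edges n s ts)) (graph_edges n s ts) X \<longrightarrow> S \<subseteq> X) \<and>
       (\<forall>y<K. arr B (mem \<tau>) 3 y = 0 \<longleftrightarrow> y \<in> S))" for \<tau>
  proof -
    from \<tau> obtain S where S:
      "threshold_closed K (threshold (n * n) (graph_edges n s ts)) (graph_edges n s ts) S"
      "\<forall>X. threshold_closed K (threshold (n * n) (graph_edges n s ts)) (graph_edges n s ts) X \<longrightarrow> S \<subseteq> X"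
      "\<forall>y<K. arr B (mem \<tau>) 3 y = 0 \<longleftrightarrow> y \<in> S" by blast
    show ?thesis
      by (rule wp_le_mono[OF wp_output[of \<tau> S]]) (use \<tau> S in blast)+
  qed
  \<comment> \<open>Additive constants: 23 = 12 + 10 + 1, then 39 = 15 + 23 + 1 and 100 = 60 + 39 +
    1, the last summand being the cost of \<open>Seq\<close>.\<close>
  have 1: "wp W (reach_com ;; output_com) \<tau> (\<lambda>t \<tau>. t \<le> ?t2 + ?t3 + 23 \<and> ?R \<tau>)"
    if "inv (n * n) (graph_edges n s ts) \<tau>" for \<tau>
    by (rule wp_Seq_le[OF wp_reach_graph[OF that] out]) simp_all
  have 2: "wp W (build_com ;; reach_com ;; output_com) \<tau> (\<lambda>t \<tau>. t \<le> ?t1 + ?t2 + ?t3 + 39 \<and> ?R \<tau>)"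
    if "inv 0 [] \<tau>" for \<tau>
    by (rule wp_Seq_le[OF wp_build[OF that] 1]) simp_all
  show ?thesis unfolding CFS_com_def
    by (rule wp_Seq_le[OF wp_setup[OF assms] 2]) simp_all
qed

end

section \<open>Input layout and the quadratic bound\<close>

lemma nth_concat_triples:
  "e < length ts \<Longrightarrow> ts ! e = (u, a, w) \<Longrightarrow>
    concat (map (\<lambda>(i, a, j). [i, a, j]) ts) ! (3 * e) = u \<and>
    concat (map (\<lambda>(i, a, j). [i, a, j]) ts) ! (3 * e + 1) = a \<and>
    concat (map (\<lambda>(i, a, j). [i, a, j]) ts) ! (3 * e + 2) = w"
proof (induction ts arbitrary: e)
  case (Cons x ts)
  then show ?case by (cases e) (auto split: prod.splits)
qed simp

lemma length_concat_triples: "length (concat (map (\<lambda>(i, a, j). [i, a, j]) ts)) = 3 * length ts"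
  by (induction ts) auto

context encoded
begin

lemma length_ts: "length ts = card (transitions A)"
proof -
  have "inj_on (\<lambda>(u, a, v). (\<nu> u, a, \<nu> v)) (transitions A)"
    using transitions_states[OF nfa] by (auto simp: inj_on_def \<nu>_eq_iff)
  then have "card (set ts) = card (transitions A)"
    using enc by (simp add: encodes_def card_image)
  moreover have "distinct ts" using enc by (simp add: encodes_def)
  ultimately show ?thesis by (simp add: distinct_card)
qed

lemma card_states: "n \<le> m + 1"
proof -
  have fin: "finite (transitions A)" by (rule finite_transitions[OF nfa])
  have "states A \<subseteq> insert (init A) ((\<lambda>(u, a, v). v) ` transitions A)"
  proof
    fix v assume v: "v \<in> states A"
    show "v \<in> insert (init A) ((\<lambda>(u, a, v). v) ` transitions A)"
    proof (cases "v = init A")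
      case False
      then obtain u a where "(u, a, v) \<in> transitions A" using ex_transition_to[OF nfa v] by blast
      then show ?thesis by force
    qed simp
  qed
  then have "n \<le> card (insert (init A) ((\<lambda>(u, a, v). v) ` transitions A))"
    by (rule card_mono[rotated]) (simp add: fin)
  also have "\<dots> \<le> Suc (card ((\<lambda>(u, a, v). v) ` transitions A))"
    by (rule card_insert_le_m1) simp_all
  also have "\<dots> \<le> Suc (card (transitions A))" using card_image_le[OF fin] by simp
  finally show ?thesis by (simp add: length_ts)
qed

lemma CFS_com_correct:
  assumes W: "(m + 2) ^ 8 \<le> W"
  shows "\<exists>t \<tau>. exec W CFS_com (input_machine \<nu> ts A) t \<tau> \<and> t \<le> 5000 * (m + 1)\<^sup>2 \<and>
    output_relation \<nu> A \<tau> (CFS_order A)"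
proof -
  let ?M = "12 * (m + 2)\<^sup>2" and ?\<sigma> = "input_machine \<nu> ts A"
  have nm: "n * n \<le> (m + 1) * (m + 1)" "m * n \<le> m * (m + 1)" "n \<le> m + 1"
    using mult_le_mono[OF card_states card_states] mult_le_mono2[OF card_states, of m] card_states
    by simp_all
  interpret ram: ram W ?M n s ts
  proof
    show "s < n" by (rule \<nu>_less[OF init_state])
    show "u < n \<and> w < n" if "e < length ts" "ts ! e = (u, a, w)" for e u a w
      using index_transition[OF that] \<nu>_less by metis
    show "4 * (n * n + m * n + 1) \<le> ?M"
      using nm by (simp add: power2_eq_square algebra_simps)
    have "m * (2 * m + 2 * n + 1) = 2 * (m * m) + 2 * (m * n) + m" by (simp add: algebra_simps)
    then show "2 * (n * n) + m * (2 * m + 2 * n + 1) + 4 \<le> ?M"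
      using nm by (simp add: power2_eq_square algebra_simps)
    \<comment> \<open>The arrays take 60 of the 64 squares, and the other four exceed
      \<open>3 * m + 5\<close>. As 64 is the sixth power of 2, it is absorbed by
      \<open>(m + 2) ^ 6\<close>, whence the exponent 8 = 6 + 2.\<close>
    have "3 * m + 5 * ?M + 5 < 64 * (m + 2)\<^sup>2" by (simp add: power2_eq_square algebra_simps)
    also have "64 * (m + 2)\<^sup>2 \<le> (m + 2) ^ 6 * (m + 2)\<^sup>2"
      using power_mono[of 2 "m + 2" 6] by (intro mult_le_mono1) simp
    also have "\<dots> = (m + 2) ^ 8" using power_add[of "m + 2" 6 2] by simp
    also note W
    finally show "3 * m + 5 * ?M + 5 < W" .
  qed
  have "ram.tape ?\<sigma>"
    unfolding ram.tape_def
  proof (intro allI impI)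
    fix e assume e: "e < m"
    obtain u a w where ea: "ts ! e = (u, a, w)" by (metis prod_cases3)
    show "(mem ?\<sigma> (3 * e), mem ?\<sigma> (3 * e + 1), mem ?\<sigma> (3 * e + 2)) = ts ! e"
      using nth_concat_triples[OF e ea] e ea
      by (simp add: input_machine_def length_concat_triples Let_def)
  qed
  then have "ram.fresh ?\<sigma>"
    by (simp add: ram.fresh_def input_machine_def Let_def length_concat_triples)
  from ram.wp_CFS_com[OF this] obtain t \<tau> S where t: "exec W CFS_com ?\<sigma> t \<tau>"
    "t \<le> 209 * (n * n) + (159 * n + 259 * m + 159) * m +
      (78 * K + 85 * ((2 * m + 2 * n + 1) * m + 2 * (n * n))) + 27 * (n * n) + 100"
    and \<tau>: "reg \<tau> 0 = 0" "closed_set S" "\<And>X. closed_set X \<Longrightarrow> S \<subseteq> X"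
      "\<And>p. p < n * n \<Longrightarrow> mem \<tau> p = of_bool (node 1 p \<notin> S)"
    unfolding wp_def by blast
  \<comment> \<open>Replacing \<open>n\<close> by \<open>m + 1\<close> leaves a quadratic in
    \<open>m\<close> with leading coefficient 1788, linear coefficient 2321 and constant
    1130.\<close>
  have "t \<le> 5000 * (m + 1)\<^sup>2"
    using t(2) nm by (simp add: power2_eq_square algebra_simps)
  moreover have "output_relation \<nu> A \<tau> (CFS_order A)"
    unfolding output_relation_def
  proof (intro ballI)
    fix u v assume uv: "u \<in> states A" "v \<in> states A"
    then show "mem \<tau> (reg \<tau> 0 + \<nu> u * n + \<nu> v) = of_bool ((u, v) \<in> CFS_order A)"
      using \<tau>(1) \<tau>(4)[OF pair_less[OF uv]] least_closed_excluded[OF \<tau>(2,3) uv]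
      by (simp add: CFS_order_eq[OF nfa])
  qed
  ultimately show ?thesis using t(1) by blast
qed

end

lemma quadratic_bigo: "(\<lambda>m. real (5000 * (m + 1)\<^sup>2)) \<in> O(\<lambda>m. (real m)\<^sup>2)"
proof (rule bigoI[of _ 20000])
  have "real (5000 * (m + 1)\<^sup>2) \<le> 20000 * (real m)\<^sup>2" if "1 \<le> m" for m
  proof -
    \<comment> \<open>For positive \<open>m\<close> this costs a factor 4 after squaring, hence
      20000 = 4 * 5000.\<close>
    have "m + 1 \<le> 2 * m" using that by simp
    then have "(m + 1)\<^sup>2 \<le> (2 * m)\<^sup>2" by (rule power_mono) simp
    then have "5000 * (m + 1)\<^sup>2 \<le> 20000 * m\<^sup>2" by (simp add: power_mult_distrib)
    then have "real (5000 * (m + 1)\<^sup>2) \<le> real (20000 * m\<^sup>2)" by (rule of_nat_mono)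
    then show ?thesis by (simp only: of_nat_mult of_nat_numeral of_nat_power)
  qed
  then show "\<forall>\<^sub>F m in at_top. norm (real (5000 * (m + 1)\<^sup>2)) \<le> 20000 * norm ((real m)\<^sup>2)"
    unfolding real_norm_def abs_of_nat abs_power2 by (rule eventually_at_top_linorderI)
qed
theorem corollary1:
  shows "\<exists>(p :: com) (k :: nat) (T :: nat \<Rightarrow> real).
    T \<in> O(\<lambda>m. (real m)\<^sup>2) \<and>
    (\<forall>(A :: (nat, nat) nfa) (\<nu> :: nat \<Rightarrow> nat) ts (W :: nat).
       is_nfa A \<and> encodes \<nu> ts A \<and>
       (card (transitions A) + 2) ^ k \<le> W \<and> (\<forall>a\<in>alphabet A. a < W) \<longrightarrow>
       (\<exists>t \<tau>. exec W p (input_machine \<nu> ts A) t \<tau> \<and>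
              real t \<le> T (card (transitions A)) \<and>
              output_relation \<nu> A \<tau> (CFS_order A)))"
\<comment> \<open>The program, the word-size exponent and the time bound are uniform: they are
  chosen before the automaton and its encoding.\<close>
proof (rule exI[of _ CFS_com], rule exI[of _ 8], rule exI[of _ "\<lambda>m. real (5000 * (m + 1)\<^sup>2)"],
    intro conjI allI impI)
  let ?T = "\<lambda>m. real (5000 * (m + 1)\<^sup>2)"
  show "?T \<in> O(\<lambda>m. (real m)\<^sup>2)" by (rule quadratic_bigo)
  fix A :: "(nat, nat) nfa" and \<nu> :: "nat \<Rightarrow> nat" and ts W
  assume *: "is_nfa A \<and> encodes \<nu> ts A \<and>
    (card (transitions A) + 2) ^ 8 \<le> W \<and> (\<forall>a\<in>alphabet A. a < W)"
  then interpret encoded A \<nu> ts by unfold_locales simp_all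
  have "(length ts + 2) ^ 8 \<le> W" using * by (simp add: length_ts)
  from CFS_com_correct[OF this] obtain t \<tau> where
    t: "exec W CFS_com (input_machine \<nu> ts A) t \<tau>" "t \<le> 5000 * (card (transitions A) + 1)\<^sup>2"
      "output_relation \<nu> A \<tau> (CFS_order A)" unfolding length_ts by blast
  then show "\<exists>t \<tau>. exec W CFS_com (input_machine \<nu> ts A) t \<tau> \<and>
      real t \<le> ?T (card (transitions A)) \<and> output_relation \<nu> A \<tau> (CFS_order A)"
    using of_nat_mono[OF t(2), where 'a = real] by blast
qed

end
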